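(* Let $t_0>0$ and let $\{h^k\}$ be the family of functions on $\mathbb R^N\times[t_0,\infty)$ defined in the context. Then, for every sequence $k\to\infty$, there exists a subsequence of $h^k$ which is uniformly convergent on every compact subset of $\mathbb R^N\times[2t_0,\infty)$.
   Context: $J\in C_0^\infty(\mathbb R^N)$ is radially symmetric, $J\ge0$, $\int J=1$; $p>1$; $0\le u_0\in L^\infty(\mathbb R^N)$, $u_0\neq0$, and there is $\kappa>0$ with $\int_{B_k}u_0\ge\kappa k^N$ for all small $k>0$, where $B_k$ is the ball of radius $k$ centered at $0$. Put $$f(k)=\frac{k^N}{\int_{B_k}u_0},\qquad F(k)=f(k)^{1-p}k^2 .$$ Assume: (F1) there is $B>0$ with $f(|x|)u_0(x)\le B$; (F2) there is $k_0>0$ such that for every $\delta>0$ there is $C_\delta>0$ with $f(k)\le C_\delta f(l)$ whenever $k_0\le k\le l\delta^{-1}$; (F3) there is $c_0\ge0$ with $F(k)\to c_0$ as $k\to\infty$. Let $u$ be the nonnegative bounded solution of $u_t=\int J(x-y)(u(y,t)-u(x,t))\,dy-u^p$ in $\mathbb R^N\times(0,\infty)$, $u(x,0)=u_0(x)$, and set $u^k(x,t)=f(k)\,u(kx,k^2t)$, $J_k(x)=k^NJ(kx)$. Let $W$ be the smooth function such that $e^{-t}\delta+W(x,t)$ is the fundamental solution of $v_t=\int J(x-y)(v(y,t)-v(x,t))\,dy$; equivalently $W_t=J*W-W+e^{-t}J$, $W(x,0)=0$. Set $W_k(x,t)=k^NW(kx,k^2t)$. For $t\ge t_0$ define $$h^k(x,t)=k^2\int_{t_0}^t\!\int_{\mathbb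 R^N} W_k(x-y,t-s)e^{-k^2(s-t_0)}\big(J_k*u^k(\cdot,t_0)\big)(y)\,dy\,ds-F(k)\int_{t_0}^t\!\int_{\mathbb R^N} W_k(x-y,t-s)(u^k)^p(y,s)\,dy\,ds .$$ *)

theory Defs
  imports "HOL-Analysis.Analysis"
begin

text \<open>Lebesgue measure (rather than its Borel restriction) is used throughout, so that
  elements of \<open>L\<^sup>\<infinity>\<close> are Lebesgue measurable functions, and statements about them hold
  almost everywhere.\<close>

fun Ck_on :: "nat \<Rightarrow> 'a::euclidean_space set \<Rightarrow> ('a \<Rightarrow> real) \<Rightarrow> bool" where
  "Ck_on 0 S f \<longleftrightarrow> continuous_on S f"
| "Ck_on (Suc n) S f \<longleftrightarrow>
     f differentiable_on S \<and> (\<forall>b\<in>Basis. Ck_on n S (\<lambda>x. frechet_derivative f (at x) b))"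

text \<open>Only meant for open \<open>S\<close>, where the derivative at a point does not depend on \<open>S\<close>.\<close>

definition smooth_on :: "'a::euclidean_space set \<Rightarrow> ('a \<Rightarrow> real) \<Rightarrow> bool" where
  "smooth_on S f \<longleftrightarrow> (\<forall>n. Ck_on n S f)"

definition conv :: "('a::euclidean_space \<Rightarrow> real) \<Rightarrow> ('a \<Rightarrow> real) \<Rightarrow> 'a \<Rightarrow> real" where
  "conv f g x = (LINT y|lebesgue. f (x - y) * g y)"

definition admissible_kernel :: "('a::euclidean_space \<Rightarrow> real) \<Rightarrow> bool" where
  "admissible_kernel J \<longleftrightarrow>
     smooth_on UNIV J \<and> compact (closure {x. J x \<noteq> 0}) \<and>
     (\<forall>x y. norm x = norm y \<longrightarrow> J x = J y) \<and>
     (\<forall>x. 0 \<le> J x) \<and> (LINT x|lebesgue. J x) = 1"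

definition admissible_datum :: "('a::euclidean_space \<Rightarrow> real) \<Rightarrow> bool" where
  "admissible_datum u0 \<longleftrightarrow>
     u0 \<in> borel_measurable lebesgue \<and>
     (\<exists>M. AE x in lebesgue. \<bar>u0 x\<bar> \<le> M) \<and>
     (AE x in lebesgue. 0 \<le> u0 x) \<and>
     \<not> (AE x in lebesgue. u0 x = 0) \<and>
     (\<exists>\<kappa>>0. \<forall>\<^sub>F k in at_right 0. \<kappa> * k ^ DIM('a) \<le> (LINT x:ball 0 k|lebesgue. u0 x))"

definition scale_f :: "('a::euclidean_space \<Rightarrow> real) \<Rightarrow> real \<Rightarrow> real" where
  "scale_f u0 k = k ^ DIM('a) / (LINT x:ball 0 k|lebesgue. u0 x)"

definition scale_F :: "real \<Rightarrow> ('a::euclidean_space \<Rightarrow> real) \<Rightarrow> real \<Rightarrow> real" where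
  "scale_F p u0 k = scale_f u0 k powr (1 - p) * k\<^sup>2"

text \<open>Nonnegative bounded solutions of the absorption problem.  The initial datum is only
  defined up to null sets, so the equation is required for almost every \<open>x\<close> (and all times);
  the continuity requirement says that the datum is attained as \<open>t \<rightarrow> 0\<close>.\<close>

definition nonneg_bounded_solution ::
  "('a::euclidean_space \<Rightarrow> real) \<Rightarrow> real \<Rightarrow> ('a \<Rightarrow> real) \<Rightarrow> ('a \<Rightarrow> real \<Rightarrow> real) \<Rightarrow> bool" where
  "nonneg_bounded_solution J p u0 u \<longleftrightarrow>
     (\<forall>t\<ge>0. (\<lambda>x. u x t) \<in> borel_measurable lebesgue) \<and>
     (\<exists>M. AE x in lebesgue. \<forall>t\<ge>0. 0 \<le> u x t \<and> u x t \<le> M) \<and>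
     (AE x in lebesgue. u x 0 = u0 x) \<and>
     (AE x in lebesgue. continuous_on {0..} (u x)) \<and>
     (AE x in lebesgue. \<forall>t>0.
        (u x has_real_derivative
           (LINT y|lebesgue. J (x - y) * (u y t - u x t)) - u x t powr p) (at t))"

text \<open>\<open>W\<close> is the smooth part of the fundamental solution \<open>e\<^sup>-\<^sup>t \<delta> + W\<close> of
  \<open>v\<^sub>t = J * v - v\<close>.  A growth condition in space is needed to single it out among the
  solutions of the Cauchy problem for \<open>W\<close>: boundedness on strips \<open>\<real>\<^sup>N \<times> [0, T]\<close> yields
  uniqueness by Gronwall's inequality and holds for the fundamental solution, for which
  \<open>W = e\<^sup>-\<^sup>t \<Sum>\<^sub>n t\<^sup>n / n! J\<^sup>*\<^sup>n\<close> with \<open>n \<ge> 1\<close>.\<close>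

definition fundamental_solution_smooth_part ::
  "('a::euclidean_space \<Rightarrow> real) \<Rightarrow> ('a \<Rightarrow> real \<Rightarrow> real) \<Rightarrow> bool" where
  "fundamental_solution_smooth_part J W \<longleftrightarrow>
     smooth_on (UNIV \<times> {0<..}) (\<lambda>(x, t). W x t) \<and>
     continuous_on (UNIV \<times> {0..}) (\<lambda>(x, t). W x t) \<and>
     (\<forall>T. \<exists>M. \<forall>x. \<forall>t\<in>{0..T}. \<bar>W x t\<bar> \<le> M) \<and>
     (\<forall>x. W x 0 = 0) \<and>
     (\<forall>x. \<forall>t>0. (W x has_real_derivative
        conv J (\<lambda>y. W y t) x - W x t + exp (- t) * J x) (at t))"

definition scale_u ::
  "('a::euclidean_space \<Rightarrow> real) \<Rightarrow> ('a \<Rightarrow> real \<Rightarrow> real) \<Rightarrow> real \<Rightarrow> 'a \<Rightarrow> real \<Rightarrow> real" where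
  "scale_u u0 u k x t = scale_f u0 k * u (k *\<^sub>R x) (k\<^sup>2 * t)"

definition scale_J :: "('a::euclidean_space \<Rightarrow> real) \<Rightarrow> real \<Rightarrow> 'a \<Rightarrow> real" where
  "scale_J J k x = k ^ DIM('a) * J (k *\<^sub>R x)"

definition scale_W :: "('a::euclidean_space \<Rightarrow> real \<Rightarrow> real) \<Rightarrow> real \<Rightarrow> 'a \<Rightarrow> real \<Rightarrow> real" where
  "scale_W W k x t = k ^ DIM('a) * W (k *\<^sub>R x) (k\<^sup>2 * t)"

definition h_family ::
  "('a::euclidean_space \<Rightarrow> real) \<Rightarrow> real \<Rightarrow> ('a \<Rightarrow> real) \<Rightarrow> ('a \<Rightarrow> real \<Rightarrow> real)
     \<Rightarrow> ('a \<Rightarrow> real \<Rightarrow> real) \<Rightarrow> real \<Rightarrow> real \<Rightarrow> 'a \<Rightarrow> real \<Rightarrow> real" where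
  "h_family J p u0 u W t0 k x t =
     k\<^sup>2 * (LINT s:{t0..t}|lebesgue. LINT y|lebesgue.
       scale_W W k (x - y) (t - s) * exp (- k\<^sup>2 * (s - t0))
         * conv (scale_J J k) (\<lambda>z. scale_u u0 u k z t0) y)
     - scale_F p u0 k * (LINT s:{t0..t}|lebesgue. LINT y|lebesgue.
       scale_W W k (x - y) (t - s) * scale_u u0 u k y s powr p)"

end

theory Submission
  imports Defs "HOL-Complex_Analysis.Complex_Analysis"
begin

text \<open>
  Write \<open>J^n g\<close> for the iterated convolution \<open>J * \<dots> * J * g\<close>.  On a small ball \<open>J\<close> dominates
  an average of a density and its translate by a small vector \<open>z\<close>, so \<open>J^n\<close> contains about \<open>c n\<close>
  fair coin tosses between \<open>0\<close> and \<open>z\<close>; hence first differences of \<open>J^n g\<close> are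
  \<open>O(n^(-1/2))\<close> in terms of \<open>sup \<bar>g\<bar>\<close>, and by symmetry of \<open>J\<close> the time difference
  \<open>J^(n+1) g - J^n g\<close>, an average of second differences, is \<open>O(1/n)\<close>.
  Since \<open>W(\<cdot>, t) * g\<close> is a Poisson average of the \<open>J^n g\<close> with \<open>n \<ge> 1\<close>, it has spatial
  modulus \<open>O(t^(-1/2))\<close> and time derivative \<open>O(1/t)\<close>, up to terms of order \<open>e^(-t)\<close>; after the
  parabolic rescaling these are uniform in \<open>k\<close>.

  The rescaled solutions are bounded for \<open>t \<ge> t\<^sub>0\<close> because \<open>u\<close> lies below the linear flow of \<open>u\<^sub>0\<close>:
  the part of \<open>u\<^sub>0\<close> in \<open>B\<^sub>k\<close> is controlled by the decay \<open>t^(-N/2)\<close> of the kernel and the part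
  outside by the two growth conditions on \<open>f\<close>.  So \<open>h\<^sup>k\<close> is equicontinuous up to an error that tends to
  \<open>0\<close> as \<open>k \<rightarrow> \<infinity>\<close>, and an Arzela-Ascoli argument gives the subsequence.
\<close>

section \<open>Convolution with an integrable kernel\<close>

text \<open>The functions to be smoothed, the rescaled solutions and their powers, carry sup bounds
  only, so every modulus of continuity must come from the kernel. Its singular part
  \<open>e^(-t) \<delta>\<close> never smooths. In the first term it costs an exponential in
  \<open>- k^2 (t - t0)\<close>, harmless since \<open>t \<ge> 2 t0\<close>; in the second it forces
  a cut-off of the last moments before \<open>t\<close>. The difference estimate for the iterates
  also has a smallest length below which it does not improve, and this length becomes
  \<open>1/k\<close> after rescaling. The modulus of \<open>h^k\<close> thus contains
  \<open>1/k\<close>, and equicontinuity holds only in the limit. \<open>W\<close> is given only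
  through its Cauchy problem, so its series must be recovered, which boundedness on strips permits.
  The same Picard iteration, rather than a maximum principle, compares \<open>u\<close> with the
  linear flow, as the equation for \<open>u\<close> holds for almost every \<open>x\<close> only.
  The data are Lebesgue measurable at each fixed time, and nothing is known jointly in space and
  time. Estimates are therefore made for everywhere bounded Borel functions, a Borel version being
  chosen at each time, and time integrals are handled through continuity.\<close>

definition bdd_borel :: "real \<Rightarrow> ('a::euclidean_space \<Rightarrow> real) \<Rightarrow> bool" where
  "bdd_borel C g \<longleftrightarrow> g \<in> borel_measurable borel \<and> (\<forall>x. \<bar>g x\<bar> \<le> C)"

text \<open>Convolution with the kernel evaluated at the integration variable, so that it visibly
  commutes with translations of \<open>g\<close>; \<open>conv\<close> has the kernel at
  \<open>x - y\<close> and integrates over the completed measure.\<close>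

definition kop :: "('a::euclidean_space \<Rightarrow> real) \<Rightarrow> ('a \<Rightarrow> real) \<Rightarrow> 'a \<Rightarrow> real" where
  "kop k g x = (LINT y|lborel. k y * g (x - y))"

text \<open>Convolution with the measure \<open>(\<delta>_0 + \<delta>_z) / 2\<close>, the law of
  one coin toss. It is kept apart from \<open>kop\<close> because this measure has no
  density.\<close>

definition avg :: "'a::euclidean_space \<Rightarrow> ('a \<Rightarrow> real) \<Rightarrow> 'a \<Rightarrow> real" where
  "avg z g x = (g x + g (x - z)) / 2"

lemma bdd_borelD:
  assumes "bdd_borel C g"
  shows "g \<in> borel_measurable borel" "\<bar>g x\<bar> \<le> C" "g x \<le> C" "- C \<le> g x" "0 \<le> C"
proof -
  show 1: "g \<in> borel_measurable borel" "\<bar>g x\<bar> \<le> C" for x using assms by (auto simp: bdd_borel_def)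
  from 1(2)[of x] show "g x \<le> C" "- C \<le> g x" "0 \<le> C" by linarith+
qed

lemma bdd_borel_shift: "bdd_borel C g \<Longrightarrow> bdd_borel C (\<lambda>x. g (x - z))"
  unfolding bdd_borel_def by auto

lemma bdd_borel_diff:
  assumes "bdd_borel C g" "bdd_borel D h" shows "bdd_borel (C + D) (\<lambda>x. g x - h x)"
proof -
  have "\<bar>g x - h x\<bar> \<le> C + D" for x
    using assms[THEN bdd_borelD(2), of x] by linarith
  then show ?thesis using assms by (auto simp: bdd_borel_def)
qed

lemma bdd_borel_avg:
  assumes "bdd_borel C g" shows "bdd_borel C (avg z g)"
proof -
  have "\<bar>avg z g x\<bar> \<le> C" for x
    using bdd_borelD(2)[OF assms, of x] bdd_borelD(2)[OF assms, of "x - z"] by (simp add: avg_def)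
  then show ?thesis using assms unfolding avg_def by (auto simp: bdd_borel_def)
qed

lemma kop_integrable:
  assumes k: "integrable lborel k" and g: "bdd_borel C g"
  shows "integrable lborel (\<lambda>y. k y * g (x - y))"
proof (rule Bochner_Integration.integrable_bound[where f = "\<lambda>y. C * \<bar>k y\<bar>"])
  show "integrable lborel (\<lambda>y. C * \<bar>k y\<bar>)" using k by auto
  have [measurable]: "k \<in> borel_measurable borel" using k by auto
  have [measurable]: "g \<in> borel_measurable borel" using g by (auto simp: bdd_borel_def)
  show "(\<lambda>y. k y * g (x - y)) \<in> borel_measurable lborel" by measurable
  have "norm (k y * g (x - y)) \<le> norm (C * \<bar>k y\<bar>)" for y
  proof -
    have "\<bar>k y\<bar> * \<bar>g (x - y)\<bar> \<le> \<bar>k y\<bar> * C"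
      using bdd_borelD(2)[OF g] by (intro mult_left_mono) auto
    then show ?thesis using bdd_borelD(5)[OF g] by (simp add: abs_mult mult.commute)
  qed
  then show "AE y in lborel. norm (k y * g (x - y)) \<le> norm (C * \<bar>k y\<bar>)" by simp
qed

lemma kop_const: "kop k (\<lambda>_. c) x = (LINT y|lborel. k y) * c"
  by (simp add: kop_def)

lemma bdd_borel_kop:
  assumes k: "integrable lborel k" "\<And>y. 0 \<le> k y" and g: "bdd_borel C g"
  shows "bdd_borel ((LINT y|lborel. k y) * C) (kop k g)"
proof -
  have [measurable]: "k \<in> borel_measurable borel" using k by auto
  have [measurable]: "g \<in> borel_measurable borel" using g by (auto simp: bdd_borel_def)
  have "kop k g \<in> borel_measurable borel"
    unfolding kop_def by measurable
  moreover have "\<bar>kop k g x\<bar> \<le> (LINT y|lborel. k y) * C" for x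
  proof -
    have "norm (kop k g x) \<le> (LINT y|lborel. norm (k y * g (x - y)))"
      unfolding kop_def by (rule integral_norm_bound)
    also have "\<dots> \<le> (LINT y|lborel. k y * C)"
      using k bdd_borelD(2)[OF g]
      by (intro integral_mono integrable_norm kop_integrable[OF k(1) g]) (auto simp: abs_mult intro: mult_left_mono)
    finally show ?thesis by simp
  qed
  ultimately show ?thesis by (auto simp: bdd_borel_def)
qed

lemma kop_diff:
  assumes k: "integrable lborel k" and g: "bdd_borel C g" and h: "bdd_borel D h"
  shows "kop k (\<lambda>x. g x - h x) x = kop k g x - kop k h x"
  unfolding kop_def right_diff_distrib
  by (intro Bochner_Integration.integral_diff kop_integrable[OF k g] kop_integrable[OF k h])

lemma kop_shift: "kop k (\<lambda>x. g (x - z)) x = kop k g (x - z)"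
  by (simp add: kop_def algebra_simps)

lemma kop_avg:
  assumes k: "integrable lborel k" and g: "bdd_borel C g"
  shows "kop k (avg z g) = avg z (kop k g)"
proof
  fix x
  have i: "integrable lborel (\<lambda>y. k y * g (x - y))" "integrable lborel (\<lambda>y. k y * g (x - z - y))"
    by (intro kop_integrable[OF k g])+
  have "kop k (avg z g) x = (LINT y|lborel. (k y * g (x - y) + k y * g (x - z - y)) / 2)"
    unfolding kop_def avg_def by (intro Bochner_Integration.integral_cong) (auto simp: algebra_simps)
  also have "\<dots> = avg z (kop k g) x"
    using i by (simp add: kop_def avg_def)
  finally show "kop k (avg z g) x = avg z (kop k g) x" .
qed

lemma bdd_borel_avg_pow: "bdd_borel C g \<Longrightarrow> bdd_borel C ((avg z ^^ m) g)"
  by (induction m) (auto intro: bdd_borel_avg)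

text \<open>Convolutions commute, so tosses already made can be carried through a further
  application of \<open>J\<close>.\<close>

lemma kop_avg_pow:
  assumes k: "integrable lborel k" and g: "bdd_borel C g"
  shows "kop k ((avg z ^^ m) g) = (avg z ^^ m) (kop k g)"
  by (induction m) (use kop_avg[OF k bdd_borel_avg_pow[OF g]] in auto)

section \<open>First differences of iterated convolutions\<close>

lemma avg_pow_binomial:
  "(avg z ^^ m) g x = (\<Sum>j\<le>m. real (m choose j) / 2 ^ m * g (x - real j *\<^sub>R z))"
proof (induction m arbitrary: x)
  case 0 then show ?case by simp
next
  case (Suc m)
  let ?G = "\<lambda>j. g (x - real j *\<^sub>R z)"
  have sh: "x - z - real j *\<^sub>R z = x - real (Suc j) *\<^sub>R z" for j
    by (simp add: algebra_simps)
  have "(\<Sum>j\<le>Suc m. real (Suc m choose j) * ?G j)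
      = (\<Sum>j\<le>m. real (m choose j) * ?G (Suc j)) + (\<Sum>j\<le>m. real (m choose j) * ?G j)"
  proof -
    have "(\<Sum>j\<le>Suc m. real (Suc m choose j) * ?G j)
        = ?G 0 + (\<Sum>j\<le>m. real (m choose j) * ?G (Suc j)) + (\<Sum>j\<le>m. real (m choose Suc j) * ?G (Suc j))"
      by (simp add: sum.atMost_Suc_shift sum.distrib algebra_simps del: sum.atMost_Suc)
    also have "?G 0 + (\<Sum>j\<le>m. real (m choose j) * ?G (Suc j)) + (\<Sum>j\<le>m. real (m choose Suc j) * ?G (Suc j))
       = (\<Sum>j\<le>m. real (m choose j) * ?G (Suc j)) + (\<Sum>j\<le>Suc m. real (m choose j) * ?G j)"
      by (simp add: sum.atMost_Suc_shift del: sum.atMost_Suc)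
    finally show ?thesis by simp
  qed
  then have "(\<Sum>j\<le>Suc m. real (Suc m choose j) / 2 ^ Suc m * ?G j)
      = ((\<Sum>j\<le>m. real (m choose j) * ?G (Suc j)) + (\<Sum>j\<le>m. real (m choose j) * ?G j)) / 2 ^ Suc m"
    by (simp add: sum_divide_distrib[symmetric] del: sum.atMost_Suc)
  also have "\<dots> = ((\<Sum>j\<le>m. real (m choose j) / 2 ^ m * ?G j) + (\<Sum>j\<le>m. real (m choose j) / 2 ^ m * ?G (Suc j))) / 2"
    by (simp add: sum_divide_distrib[symmetric] field_simps)
  also have "\<dots> = (avg z ^^ Suc m) g x"
    by (simp add: avg_def Suc.IH sh)
  finally show ?case by simp
qed

text \<open>The weights are Bernstein polynomials at \<open>1/2\<close>, whose moments of order 0, 1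
  and 2 are known. Since \<open>n - 2 j\<close> is twice the deviation from the mean, the value is
  \<open>n\<close> and not the variance \<open>n / 4\<close>.\<close>

lemma binomial_variance:
  "(\<Sum>j\<le>n. real (n choose j) / 2 ^ n * (real n - 2 * real j)\<^sup>2) = real n"
proof -
  let ?b = "\<lambda>j. real (n choose j) / 2 ^ n"
  have B: "Bernstein n j (1/2) = ?b j" if "j \<le> n" for j
    using that by (simp add: Bernstein_def power_divide power_add[symmetric] flip: power_divide)
      (simp add: power_one_over power_add[symmetric] divide_simps)
  have "(\<Sum>j\<le>n. ?b j * (real n - 2 * real j)\<^sup>2)
      = (\<Sum>j\<le>n. (real n)\<^sup>2 * Bernstein n j (1/2) + (4 - 4 * real n) * (real j * Bernstein n j (1/2))
           + 4 * (real j * (real j - 1) * Bernstein n j (1/2)))"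
    by (intro sum.cong) (auto simp: B power2_eq_square field_simps)
  also have "\<dots> = (real n)\<^sup>2 + (4 - 4 * real n) * (real n / 2) + 4 * (real n * (real n - 1) / 4)"
    using sum_Bernstein[of n "1/2"] sum_k_Bernstein[of n "1/2"] sum_kk_Bernstein[of n "1/2"]
    by (simp only: sum.distrib sum_distrib_left[symmetric]) (simp add: power2_eq_square)
  finally show ?thesis by (simp add: power2_eq_square field_simps)
qed

text \<open>Mean absolute deviation against standard deviation. In place of Cauchy-Schwarz,
  \<open>\<bar>d\<bar> \<le> (r + d^2 / r) / 2\<close> with \<open>r = sqrt (m + 1)\<close> is
  linear in the known moments.\<close>

lemma binomial_deviation:
  "(\<Sum>j\<le>Suc m. real (Suc m choose j) / 2 ^ Suc m * \<bar>real (Suc m) - 2 * real j\<bar>) \<le> sqrt (real (Suc m))"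
proof -
  let ?n = "Suc m" and ?r = "sqrt (real (Suc m))"
  let ?b = "\<lambda>j. real (?n choose j) / 2 ^ ?n"
  have r: "?r > 0" "?r * ?r = real ?n" by auto
  have amgm: "\<bar>d\<bar> \<le> (?r + d\<^sup>2 / ?r) / 2" for d :: real
  proof -
    have "0 \<le> (?r - \<bar>d\<bar>)\<^sup>2" by simp
    then have "2 * \<bar>d\<bar> * ?r \<le> ?r * ?r + d\<^sup>2"
      by (simp add: power2_eq_square algebra_simps)
    then show ?thesis using r(1) by (simp add: field_simps)
  qed
  have "(\<Sum>j\<le>?n. ?b j * \<bar>real ?n - 2 * real j\<bar>) \<le> (\<Sum>j\<le>?n. ?b j * ((?r + (real ?n - 2 * real j)\<^sup>2 / ?r) / 2))"
    by (intro sum_mono mult_left_mono amgm) auto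
  also have "\<dots> = (?r / 2) * (\<Sum>j\<le>?n. ?b j) + (1 / (2 * ?r)) * (\<Sum>j\<le>?n. ?b j * (real ?n - 2 * real j)\<^sup>2)"
    by (simp only: sum_distrib_left sum.distrib[symmetric]) (intro sum.cong, auto simp: field_simps)
  also have "(\<Sum>j\<le>?n. ?b j) = 1"
  proof -
    have "(\<Sum>j\<le>?n. ?b j) = real (\<Sum>j\<le>?n. ?n choose j) / 2 ^ ?n"
      by (simp only: of_nat_sum sum_divide_distrib)
    then show ?thesis by (simp only: choose_row_sum) simp
  qed
  also have "(?r / 2) * 1 + (1 / (2 * ?r)) * (\<Sum>j\<le>?n. ?b j * (real ?n - 2 * real j)\<^sup>2) = ?r"
    unfolding binomial_variance using r by (simp add: field_simps)
  finally show ?thesis .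
qed

text \<open>Summation by parts moves the difference from \<open>g\<close> to the binomial weights.
  With \<open>n = m + 1\<close>, consecutive coefficients of row \<open>m\<close> differ by
  \<open>(n choose j) * (n - 2 * j) / n\<close>, so the total variation of the weights is a mean
  absolute deviation for \<open>n\<close> tosses.\<close>

lemma avg_pow_difference:
  assumes g: "bdd_borel C g"
  shows "\<bar>(avg z ^^ m) (\<lambda>x. g x - g (x - z)) x\<bar> \<le> 2 * C / sqrt (real m + 1)"
proof -
  let ?n = "Suc m"
  let ?G = "\<lambda>j. g (x - real j *\<^sub>R z)"
  have sh: "x - real j *\<^sub>R z - z = x - real (Suc j) *\<^sub>R z" for j
    by (simp add: algebra_simps)
  have fld: "(c * (M - j) * G - c * j * G) / (M * P) = 2 / M * (c / (2 * P) * (M - 2 * j) * G)"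
    if "P \<noteq> 0" "M \<noteq> 0" for c M j G P :: real
    using that by (simp add: field_simps)
  have term_le: "\<bar>c / P * d * G\<bar> \<le> c / P * \<bar>d\<bar> * C" if "0 \<le> c" "0 < P" "\<bar>G\<bar> \<le> C" for c d G P :: real
    using that by (simp add: abs_mult mult_left_mono divide_right_mono)
  \<comment> \<open>\<open>A\<close> and \<open>B\<close> are the two absorption identities: they
    express row \<open>m\<close> of Pascal's triangle through row \<open>m + 1\<close>, once with
    the index kept and once with the index shifted.\<close>
  have A: "(\<Sum>j\<le>?n. real (?n choose j) * (real ?n - real j) * ?G j) = real ?n * (\<Sum>j\<le>m. real (m choose j) * ?G j)"
  proof -
    have e: "real (?n choose j) * (real ?n - real j) = real ?n * real (m choose j)" if "j \<le> m" for j
      using binomial_absorb_comp[of "?n" j] that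
      by (metis (no_types, lifting) diff_Suc_1 le_SucI mult.commute of_nat_diff of_nat_mult)
    have "(\<Sum>j\<le>?n. real (?n choose j) * (real ?n - real j) * ?G j) = (\<Sum>j\<le>m. real (?n choose j) * (real ?n - real j) * ?G j)"
      by simp
    also have "\<dots> = (\<Sum>j\<le>m. real ?n * (real (m choose j) * ?G j))"
      by (intro sum.cong refl) (auto simp only: atMost_iff e mult.assoc)
    finally show ?thesis by (simp only: sum_distrib_left)
  qed
  have B: "(\<Sum>j\<le>?n. real (?n choose j) * real j * ?G j) = real ?n * (\<Sum>j\<le>m. real (m choose j) * ?G (Suc j))"
  proof -
    have e: "real (?n choose Suc j) * real (Suc j) = real ?n * real (m choose j)" for j
      using Suc_times_binomial_eq[of m j] by (metis of_nat_mult)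
    have "(\<Sum>j\<le>?n. real (?n choose j) * real j * ?G j) = (\<Sum>j\<le>m. real (?n choose Suc j) * real (Suc j) * ?G (Suc j))"
      by (subst sum.atMost_Suc_shift) simp
    also have "\<dots> = (\<Sum>j\<le>m. real ?n * (real (m choose j) * ?G (Suc j)))"
      by (intro sum.cong refl) (simp only: e mult.assoc)
    finally show ?thesis by (simp only: sum_distrib_left)
  qed
  have "(avg z ^^ m) (\<lambda>x. g x - g (x - z)) x
      = ((\<Sum>j\<le>m. real (m choose j) * ?G j) - (\<Sum>j\<le>m. real (m choose j) * ?G (Suc j))) / 2 ^ m"
    unfolding avg_pow_binomial sh
    by (simp add: right_diff_distrib sum_subtractf sum_divide_distrib[symmetric] diff_divide_distrib)
  also have "\<dots> = ((\<Sum>j\<le>?n. real (?n choose j) * (real ?n - real j) * ?G j)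
        - (\<Sum>j\<le>?n. real (?n choose j) * real j * ?G j)) / (real ?n * 2 ^ m)"
    unfolding A B by (simp only: right_diff_distrib[symmetric]) simp
  also have "\<dots> = 2 / real ?n * (\<Sum>j\<le>?n. real (?n choose j) / 2 ^ ?n * (real ?n - 2 * real j) * ?G j)"
    by (simp only: sum_subtractf[symmetric] sum_distrib_left sum_divide_distrib)
      (intro sum.cong refl, simp only: power_Suc, rule fld, auto)
  finally have eq: "(avg z ^^ m) (\<lambda>x. g x - g (x - z)) x
      = 2 / real ?n * (\<Sum>j\<le>?n. real (?n choose j) / 2 ^ ?n * (real ?n - 2 * real j) * ?G j)" .
  have "\<bar>\<Sum>j\<le>?n. real (?n choose j) / 2 ^ ?n * (real ?n - 2 * real j) * ?G j\<bar>
      \<le> (\<Sum>j\<le>?n. real (?n choose j) / 2 ^ ?n * \<bar>real ?n - 2 * real j\<bar> * C)"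
    by (rule order_trans[OF sum_abs], intro sum_mono, rule term_le) (auto intro: bdd_borelD(2)[OF g] simp del: binomial_Suc_Suc)
  also have "\<dots> = (\<Sum>j\<le>?n. real (?n choose j) / 2 ^ ?n * \<bar>real ?n - 2 * real j\<bar>) * C"
    by (simp only: sum_distrib_right)
  also have "\<dots> \<le> sqrt (real ?n) * C"
    by (intro mult_right_mono binomial_deviation bdd_borelD(5)[OF g])
  finally have "\<bar>(avg z ^^ m) (\<lambda>x. g x - g (x - z)) x\<bar> \<le> 2 / real ?n * (sqrt (real ?n) * C)"
    unfolding eq abs_mult by (intro mult_mono) auto
  also have "\<dots> = 2 * C / sqrt (real m + 1)"
    using real_sqrt_mult_self[of "real m + 1"] by (simp add: field_simps)
  finally show ?thesis .
qed

text \<open>Here \<open>s\<close> is an effective count of tosses that grows by 1 with probability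
  \<open>a\<close>. As \<open>1 / sqrt\<close> is convex, the mean of its new value is at least
  \<open>1 / sqrt (s + a)\<close>, so the rate \<open>a\<close> itself is out of reach; the slower
  rate \<open>a / 4\<close> leaves enough room for all \<open>s \<ge> 1\<close>.\<close>

lemma inverse_sqrt_step:
  fixes s a :: real
  assumes s: "1 \<le> s" and a: "0 < a" "a \<le> 1"
  shows "(1 - a) / sqrt s + a / sqrt (s + 1) \<le> 1 / sqrt (s + a / 4)"
proof -
  define w where "w = sqrt s"
  have w: "1 \<le> w" "s = w\<^sup>2" using s by (auto simp: w_def)
  \<comment> \<open>The tangent value \<open>w + 1 / (2 w)\<close> overestimates the root; half of
    that increment gives a lower bound once \<open>w \<ge> 1\<close>.\<close>
  have "sqrt (w\<^sup>2 + 1) \<ge> w + 1 / (4 * w)"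
  proof (rule real_le_rsqrt)
    have "1 / (4 * w) \<le> 1/4" using w by (simp add: field_simps)
    then have "(1 / (4 * w))\<^sup>2 \<le> (1/4)\<^sup>2" using w by (intro power_mono) auto
    then have "(1 / (4 * w))\<^sup>2 \<le> 1/2" by (simp add: power2_eq_square)
    then show "(w + 1 / (4 * w))\<^sup>2 \<le> w\<^sup>2 + 1"
      using w by (simp add: power2_sum)
  qed
  then have "1 / sqrt (s + 1) \<le> 1 / (w + 1 / (4 * w))"
    using w by (intro divide_left_mono) (auto simp: add_pos_pos)
  also have "\<dots> = 4 * w / (4 * w\<^sup>2 + 1)"
    using w by (simp add: field_simps power2_eq_square)
  finally have 1: "a / sqrt (s + 1) \<le> a * (4 * w / (4 * w\<^sup>2 + 1))"
    using a by (metis (no_types, opaque_lifting) less_eq_real_def mult.right_neutral mult_left_mono times_divide_eq_right)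
  have "sqrt (s + a / 4) \<le> w + a / (8 * w)"
    using w a by (intro real_le_lsqrt) (auto simp: power2_eq_square field_simps)
  then have "1 / (w + a / (8 * w)) \<le> 1 / sqrt (s + a / 4)"
    using w a s by (intro divide_left_mono) (auto intro!: mult_pos_pos add_pos_pos)
  moreover have "1 / (w + a / (8 * w)) = 8 * w / (8 * w\<^sup>2 + a)"
    using w a by (simp add: field_simps power2_eq_square)
  moreover have "(1 - a) / w + a * (4 * w / (4 * w\<^sup>2 + 1)) \<le> 8 * w / (8 * w\<^sup>2 + a)"
  proof -
    have p: "0 < 4 * w\<^sup>2 + 1" "0 < 8 * w\<^sup>2 + a" using a by (auto intro: add_nonneg_pos)
    have "(1 - a) / w + a * (4 * w / (4 * w\<^sup>2 + 1)) = ((1 - a) * (4 * w\<^sup>2 + 1) + 4 * a * w\<^sup>2) / (w * (4 * w\<^sup>2 + 1))"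
      using w p by (simp add: field_simps power2_eq_square)
    also have "\<dots> = (4 * w\<^sup>2 + 1 - a) / (w * (4 * w\<^sup>2 + 1))" by (simp add: algebra_simps)
    also have "\<dots> \<le> 8 * w / (8 * w\<^sup>2 + a)"
    proof -
      have "(4 * w\<^sup>2 + 1 - a) * (8 * w\<^sup>2 + a) \<le> 8 * w * (w * (4 * w\<^sup>2 + 1))"
      proof -
        have "a * 1 \<le> a * w\<^sup>2" using a w by (intro mult_left_mono) auto
        moreover have "0 \<le> a * a" "0 \<le> a * w\<^sup>2" using a by auto
        ultimately have "a - a * a \<le> 4 * a * w\<^sup>2" by linarith
        then show ?thesis by (simp add: power2_eq_square algebra_simps)
      qed
      then show ?thesis using p w by (simp add: frac_le_eq divide_le_eq pos_le_divide_eq)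
    qed
    finally show ?thesis .
  qed
  ultimately show ?thesis using 1 by (simp add: w_def)
qed

text \<open>Each application of \<open>J\<close> tosses one more coin with weight \<open>a\<close>
  and none with weight \<open>1 - a\<close>. Carrying the number \<open>m\<close> of tosses already
  made through the induction avoids computing the law of the number of tosses after \<open>n\<close>
  steps: by \<open>inverse_sqrt_step\<close> the bound survives one step.\<close>

lemma avg_pow_iterate_decay:
  fixes J \<rho> \<sigma> :: "'a::euclidean_space \<Rightarrow> real"
  assumes J: "integrable lborel J" "\<And>y. 0 \<le> J y" "(LINT y|lborel. J y) = 1"
    and \<rho>: "integrable lborel \<rho>" "\<And>y. 0 \<le> \<rho> y" "(LINT y|lborel. \<rho> y) = 1 - a"
    and \<sigma>: "integrable lborel \<sigma>" "\<And>y. 0 \<le> \<sigma> y" "(LINT y|lborel. \<sigma> y) = a"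
    and a: "0 < a" "a \<le> 1"
    and dec: "\<And>C g x. bdd_borel C g \<Longrightarrow> kop J g x = kop \<rho> g x + kop \<sigma> (avg z g) x"
    and \<phi>: "bdd_borel D \<phi>" "\<And>m x. \<bar>(avg z ^^ m) \<phi> x\<bar> \<le> C / sqrt (real m + 1)"
  shows "\<bar>(avg z ^^ m) ((kop J ^^ n) \<phi>) x\<bar> \<le> C / sqrt (a / 4 * real n + real m + 1)"
proof (induction n arbitrary: m x)
  case 0 then show ?case using \<phi>(2) by simp
next
  case (Suc n)
  have C: "0 \<le> C" using \<phi>(2)[of 0] by (smt (verit) abs_ge_zero div_by_1 of_nat_0 real_sqrt_one)
  let ?\<psi> = "(kop J ^^ n) \<phi>" and ?s = "a / 4 * real n + real m + 1"
  have \<psi>: "bdd_borel D ?\<psi>"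
    using \<phi>(1) bdd_borel_kop[OF J(1,2)] J(3) by (induction n) auto
  have s: "1 \<le> ?s" using a by simp
  have b: "bdd_borel (C / sqrt (a / 4 * real n + real m + 1)) ((avg z ^^ m) ?\<psi>)" for m
    using bdd_borel_avg_pow[OF \<psi>] Suc.IH by (auto simp: bdd_borel_def)
  have 1: "(avg z ^^ m) ((kop J ^^ Suc n) \<phi>) x = kop \<rho> ((avg z ^^ m) ?\<psi>) x + kop \<sigma> ((avg z ^^ Suc m) ?\<psi>) x"
    using kop_avg_pow[OF J(1) \<psi>, where z = z and m = m] dec[OF b[of m], of x] by simp
  have "\<bar>kop \<rho> ((avg z ^^ m) ?\<psi>) x\<bar> \<le> (1 - a) * (C / sqrt ?s)"
    using bdd_borelD(2)[OF bdd_borel_kop[OF \<rho>(1,2) b[of m]]] \<rho>(3) by simp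
  moreover have "\<bar>kop \<sigma> ((avg z ^^ Suc m) ?\<psi>) x\<bar> \<le> a * (C / sqrt (?s + 1))"
    using bdd_borelD(2)[OF bdd_borel_kop[OF \<sigma>(1,2) b[of "Suc m"]]] \<sigma>(3) by (simp add: add_ac)
  ultimately have "\<bar>(avg z ^^ m) ((kop J ^^ Suc n) \<phi>) x\<bar> \<le> C * ((1 - a) / sqrt ?s + a / sqrt (?s + 1))"
    unfolding 1 by (simp add: distrib_left algebra_simps)
  also have "\<dots> \<le> C * (1 / sqrt (?s + a / 4))"
    by (intro mult_left_mono inverse_sqrt_step s a C)
  also have "?s + a / 4 = a / 4 * real (Suc n) + real m + 1" by (simp add: field_simps)
  finally show ?case by simp
qed

section \<open>Smoothing estimates for iterates of a symmetric probability kernel\<close>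

lemma lborel_integral_affine:
  fixes f :: "'a::euclidean_space \<Rightarrow> real" and t :: 'a and c :: real
  assumes f: "f \<in> borel_measurable borel" and c: "c \<noteq> 0"
  shows "(LINT x|lborel. f x) = \<bar>c\<bar> ^ DIM('a) * (LINT x|lborel. f (t + c *\<^sub>R x))"
proof -
  have [measurable]: "f \<in> borel_measurable borel" by fact
  have "(LINT x|lborel. f x)
      = (LINT x|density (distr lborel borel (\<lambda>x. t + c *\<^sub>R x)) (\<lambda>_. \<bar>c\<bar> ^ DIM('a)). f x)"
    using lborel_affine[OF c, of t] by simp
  also have "\<dots> = (LINT x|distr lborel borel (\<lambda>x. t + c *\<^sub>R x). \<bar>c\<bar> ^ DIM('a) *\<^sub>R f x)"
    by (intro integral_density) auto
  also have "\<dots> = (LINT x|lborel. \<bar>c\<bar> ^ DIM('a) *\<^sub>R f (t + c *\<^sub>R x))"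
    by (intro integral_distr) auto
  finally show ?thesis by simp
qed

lemma lborel_integrable_affine:
  fixes f :: "'a::euclidean_space \<Rightarrow> real" and t :: 'a and c :: real
  assumes f: "integrable lborel f" and c: "c \<noteq> 0"
  shows "integrable lborel (\<lambda>x. f (t + c *\<^sub>R x))"
proof -
  have [measurable]: "f \<in> borel_measurable borel" using f by auto
  have "integrable (density (distr lborel borel (\<lambda>x. t + c *\<^sub>R x)) (\<lambda>_. \<bar>c\<bar> ^ DIM('a))) f"
    using f lborel_affine[OF c, of t] by simp
  then have "integrable (distr lborel borel (\<lambda>x. t + c *\<^sub>R x)) (\<lambda>x. \<bar>c\<bar> ^ DIM('a) *\<^sub>R f x)"
    by (subst (asm) integrable_density) auto
  then have "integrable lborel (\<lambda>x. \<bar>c\<bar> ^ DIM('a) *\<^sub>R f (t + c *\<^sub>R x))"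
    by (subst (asm) integrable_distr_eq) auto
  then show ?thesis using c by simp
qed

lemma lborel_integral_translate:
  fixes f :: "'a::euclidean_space \<Rightarrow> real"
  assumes "f \<in> borel_measurable borel"
  shows "(LINT x|lborel. f (x + t)) = (LINT x|lborel. f x)" "(LINT x|lborel. f (x - t)) = (LINT x|lborel. f x)"
  using lborel_integral_affine[OF assms, of 1 t] lborel_integral_affine[OF assms, of 1 "- t"]
  by (simp_all add: add.commute)

lemma lborel_integral_reflect:
  fixes f :: "'a::euclidean_space \<Rightarrow> real"
  assumes "f \<in> borel_measurable borel"
  shows "(LINT x|lborel. f (t - x)) = (LINT x|lborel. f x)"
  using lborel_integral_affine[OF assms, of "-1" t] by simp

lemma lborel_integrable_reflect:
  fixes f :: "'a::euclidean_space \<Rightarrow> real"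
  assumes "integrable lborel f"
  shows "integrable lborel (\<lambda>x. f (t - x))" "integrable lborel (\<lambda>x. f (x - t))"
  using lborel_integrable_affine[OF assms, of "-1" t] lborel_integrable_affine[OF assms, of 1 "- t"] by simp_all

lemma kop_flip:
  assumes [measurable]: "k \<in> borel_measurable borel" "g \<in> borel_measurable borel"
  shows "kop k g x = (LINT y|lborel. k (x - y) * g y)"
  using lborel_integral_reflect[of "\<lambda>y. k (x - y) * g y" x] by (simp add: kop_def)

lemma kop_pair_integrable:
  fixes k v :: "'a::euclidean_space \<Rightarrow> real"
  assumes k: "integrable lborel k" and v: "integrable lborel v"
  shows "integrable (lborel \<Otimes>\<^sub>M lborel) (\<lambda>(y, x). k y * v (x - y))"
proof (rule lborel_pair.Fubini_integrable)
  have [measurable]: "k \<in> borel_measurable borel" "v \<in> borel_measurable borel" using k v by auto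
  show "(\<lambda>(y, x). k y * v (x - y)) \<in> borel_measurable (lborel \<Otimes>\<^sub>M lborel)" by measurable
  have "(\<lambda>y. LINT x|lborel. norm (case (y, x) of (y, x) \<Rightarrow> k y * v (x - y))) = (\<lambda>y. \<bar>k y\<bar> * (LINT x|lborel. \<bar>v x\<bar>))"
    using lborel_integral_translate(2)[of "\<lambda>x. \<bar>v x\<bar>"] by (auto simp: abs_mult)
  then show "integrable lborel (\<lambda>y. LINT x|lborel. norm (case (y, x) of (y, x) \<Rightarrow> k y * v (x - y)))"
    using k by simp
  show "AE y in lborel. integrable lborel (\<lambda>x. case (y, x) of (y, x) \<Rightarrow> k y * v (x - y))"
    using lborel_integrable_reflect(2)[OF v] by simp
qed

lemma kop_L1:
  fixes k v :: "'a::euclidean_space \<Rightarrow> real"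
  assumes k: "integrable lborel k" and v: "integrable lborel v"
  shows "integrable lborel (kop k v)" "(LINT x|lborel. kop k v x) = (LINT x|lborel. k x) * (LINT x|lborel. v x)"
proof -
  have [measurable]: "k \<in> borel_measurable borel" "v \<in> borel_measurable borel" using k v by auto
  note P = kop_pair_integrable[OF k v]
  show "integrable lborel (kop k v)"
    using lborel_pair.integrable_snd[OF P] by (simp add: kop_def[abs_def])
  have "(LINT x|lborel. kop k v x) = (LINT y|lborel. LINT x|lborel. k y * v (x - y))"
    using lborel_pair.Fubini_integral[OF P] by (simp add: kop_def)
  also have "\<dots> = (LINT y|lborel. k y * (LINT x|lborel. v x))"
    using lborel_integral_translate(2)[of v] by simp
  finally show "(LINT x|lborel. kop k v x) = (LINT x|lborel. k x) * (LINT x|lborel. v x)" by simp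
qed

section \<open>Differences and decay of the iterates of \<open>J\<close>\<close>

locale jump_kernel =
  fixes J :: "'a::euclidean_space \<Rightarrow> real"
  assumes J_continuous: "continuous_on UNIV J"
    and J_nonneg: "0 \<le> J x"
    and J_bounded_support: "\<exists>S. \<forall>x. J x \<noteq> 0 \<longrightarrow> norm x \<le> S"
    and J_integral: "(LINT x|lborel. J x) = 1"
    and J_even: "J (- x) = J x"
begin

lemma J_measurable [measurable]: "J \<in> borel_measurable borel"
  using J_continuous by (rule borel_measurable_continuous_onI)

lemma J_integrable: "integrable lborel J"
  using J_integral not_integrable_integral_eq by fastforce

lemma J_bounded: obtains B where "0 < B" "\<And>x. J x \<le> B"
proof -
  obtain S where S: "\<And>x. J x \<noteq> 0 \<Longrightarrow> norm x \<le> S" using J_bounded_support by blast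
  have "compact (J ` cball 0 S)"
    by (intro compact_continuous_image continuous_on_subset[OF J_continuous]) auto
  then have "bounded (J ` cball 0 S)" by (rule compact_imp_bounded)
  then obtain B where B: "0 < B" "\<And>x. x \<in> cball 0 S \<Longrightarrow> \<bar>J x\<bar> \<le> B"
    unfolding bounded_pos by auto
  have "J x \<le> B" for x
    using B(1) B(2)[of x] S[of x] by (cases "J x = 0") auto
  then show ?thesis using that B(1) by blast
qed

definition kpow :: "nat \<Rightarrow> ('a \<Rightarrow> real) \<Rightarrow> 'a \<Rightarrow> real" where
  "kpow n g = (kop J ^^ n) g"

lemma kpow_0 [simp]: "kpow 0 g = g" by (simp add: kpow_def)
lemma kpow_Suc: "kpow (Suc n) g = kop J (kpow n g)" by (simp add: kpow_def)
lemma kpow_add: "kpow (m + n) g = kpow m (kpow n g)" by (simp add: kpow_def funpow_add)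

lemma bdd_kpow: "bdd_borel C g \<Longrightarrow> bdd_borel C (kpow n g)"
  using bdd_borel_kop[OF J_integrable J_nonneg] J_integral by (induction n) (auto simp: kpow_Suc)

lemma kpow_nonneg: "bdd_borel C g \<Longrightarrow> (\<And>x. 0 \<le> g x) \<Longrightarrow> 0 \<le> kpow n g x"
  by (induction n arbitrary: x) (auto simp: kpow_Suc kop_def J_nonneg intro!: integral_nonneg_AE)

lemma kpow_diff:
  assumes g: "bdd_borel C g" and h: "bdd_borel D h"
  shows "kpow n (\<lambda>x. g x - h x) = (\<lambda>x. kpow n g x - kpow n h x)"
proof (induction n)
  case (Suc n)
  then show ?case
    using kop_diff[OF J_integrable bdd_kpow[OF g, of n] bdd_kpow[OF h, of n]] by (simp add: kpow_Suc)
qed simp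

lemma kpow_shift: "kpow n (\<lambda>x. g (x - z)) = (\<lambda>x. kpow n g (x - z))"
  by (induction n) (auto simp: kpow_Suc kop_shift)

lemma kpow_L1:
  assumes v: "integrable lborel v"
  shows "integrable lborel (kpow n v)" "(LINT x|lborel. kpow n v x) = (LINT x|lborel. v x)"
proof -
  have "integrable lborel (kpow n v) \<and> (LINT x|lborel. kpow n v x) = (LINT x|lborel. v x)"
    using kop_L1[OF J_integrable] J_integral v by (induction n) (auto simp: kpow_Suc)
  then show "integrable lborel (kpow n v)" "(LINT x|lborel. kpow n v x) = (LINT x|lborel. v x)" by auto
qed

text \<open>For \<open>norm z \<le> r\<close>, the ball of radius \<open>r\<close> about
  \<open>c\<close> and its translate by \<open>z\<close> both stay in the ball of radius
  \<open>2 r\<close> where \<open>J \<ge> e\<close>. Half of \<open>\<sigma>\<close> plus half of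
  its translate therefore lies below \<open>J\<close>, and the remainder \<open>\<rho>\<close> is
  nonnegative. The weight \<open>a\<close> of the coin does not depend on \<open>z\<close>.\<close>

lemma short_difference:
  obtains r C where "0 < r" "0 < C"
    "\<And>D g n x z. bdd_borel D g \<Longrightarrow> norm z \<le> r \<Longrightarrow> \<bar>kpow n g x - kpow n g (x - z)\<bar> \<le> C * D / sqrt (real n + 1)"
proof -
  have "\<exists>c. 0 < J c"
  proof (rule ccontr)
    assume "\<not> (\<exists>c. 0 < J c)"
    then have "J = (\<lambda>_. 0)" using J_nonneg by (auto simp: fun_eq_iff order.antisym not_less)
    then show False using J_integral by simp
  qed
  then obtain c where c: "0 < J c" by blast
  define e where "e = J c / 2"
  have e: "0 < e" using c by (simp add: e_def)
  have "isCont J c" using J_continuous by (simp add: continuous_on_eq_continuous_at)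
  then obtain s where s: "0 < s" "\<And>x. dist x c < s \<Longrightarrow> dist (J x) (J c) < e"
    using e unfolding continuous_at_eps_delta by (metis dist_commute)
  define r where "r = s / 2"
  have r: "0 < r" using s by (simp add: r_def)
  have low: "e \<le> J x" if "dist x c < 2 * r" for x
    using s(2)[of x] that unfolding r_def e_def dist_real_def by linarith
  define \<sigma> where "\<sigma> y = e * indicator (ball c r) y" for y
  define a where "a = e * measure lborel (ball c r)"
  have [measurable]: "\<sigma> \<in> borel_measurable borel" unfolding \<sigma>_def
    by (intro borel_measurable_times borel_measurable_const borel_measurable_indicator) auto
  have \<sigma>i: "integrable lborel \<sigma>"
    unfolding \<sigma>_def by (intro integrable_mult_right integrable_real_indicator) (auto simp: emeasure_lborel_ball_finite[unfolded infinity_ennreal_def])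
  have \<sigma>_int: "(LINT y|lborel. \<sigma> y) = a" unfolding \<sigma>_def a_def by simp
  have \<sigma>0: "0 \<le> \<sigma> y" for y using e by (simp add: \<sigma>_def)
  have \<sigma>J: "\<sigma> y \<le> J y" for y
    using low[of y] J_nonneg[of y] r by (auto simp: \<sigma>_def indicator_def dist_commute)
  have a0: "0 < a" using e r by (simp add: a_def)
  have a1: "a \<le> 1"
    using integral_mono[OF \<sigma>i J_integrable \<sigma>J] \<sigma>_int J_integral by simp
  \<comment> \<open>This is \<open>2 / sqrt (a / 4)\<close>: the summand \<open>1\<close> under the
    root is lowered to \<open>a / 4\<close>, which \<open>a \<le> 1\<close> allows, and
    \<open>n + 1\<close> factors out.\<close>
  define C where "C = 4 / sqrt a"
  have C0: "0 < C" using a0 by (simp add: C_def)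
  have main: "\<bar>kpow n g x - kpow n g (x - z)\<bar> \<le> C * D / sqrt (real n + 1)"
    if g: "bdd_borel D g" and z: "norm z \<le> r" for D g n x z
  proof -
    have [measurable]: "g \<in> borel_measurable borel" using bdd_borelD[OF g] by auto
    define \<rho> where "\<rho> y = J y - (\<sigma> y + \<sigma> (y - z)) / 2" for y
    have \<sigma>z: "integrable lborel (\<lambda>y. \<sigma> (y - z))" by (rule lborel_integrable_reflect(2)[OF \<sigma>i])
    have \<rho>i: "integrable lborel \<rho>" unfolding \<rho>_def using J_integrable \<sigma>i \<sigma>z by auto
    have "\<sigma> (y - z) \<le> J y" for y
    proof (cases "y - z \<in> ball c r")
      case True
      then have "dist y c < 2 * r"
        using z norm_triangle_ineq[of "y - z - c" z] by (auto simp: dist_norm norm_minus_commute)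
      then show ?thesis using low[of y] True by (simp add: \<sigma>_def)
    qed (use J_nonneg in \<open>simp add: \<sigma>_def\<close>)
    then have \<sigma>zJ: "\<sigma> (y - z) \<le> J y" for y .
    have \<rho>0: "0 \<le> \<rho> y" for y using \<sigma>J[of y] \<sigma>zJ[of y] unfolding \<rho>_def by (auto simp: field_simps)
    have \<rho>_int: "(LINT y|lborel. \<rho> y) = 1 - a"
      unfolding \<rho>_def using J_integrable \<sigma>i \<sigma>z J_integral \<sigma>_int lborel_integral_translate(2)[of \<sigma> z] by simp
    \<comment> \<open>A change of variables in the translated copy of \<open>\<sigma>\<close> moves
      the translation onto \<open>f\<close>, which is how \<open>avg z f\<close> appears.\<close>
    have dec: "kop J f x = kop \<rho> f x + kop \<sigma> (avg z f) x" if f: "bdd_borel E f" for E f x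
    proof -
      have [measurable]: "f \<in> borel_measurable borel" using bdd_borelD[OF f] by auto
      have i1: "integrable lborel (\<lambda>y. J y * f (x - y))" "integrable lborel (\<lambda>y. \<sigma> y * f (x - y))"
          "integrable lborel (\<lambda>y. \<sigma> (y - z) * f (x - y))" "integrable lborel (\<lambda>y. \<sigma> y * f (x - z - y))"
        by (intro kop_integrable[OF _ f] J_integrable \<sigma>i \<sigma>z)+
      have sh: "(LINT y|lborel. \<sigma> (y - z) * f (x - y)) = (LINT y|lborel. \<sigma> y * f (x - z - y))"
        using lborel_integral_translate(2)[of "\<lambda>y. \<sigma> y * f (x - z - y)" z] by (simp add: algebra_simps)
      have "kop \<rho> f x = (LINT y|lborel. J y * f (x - y) - (\<sigma> y * f (x - y) + \<sigma> (y - z) * f (x - y)) / 2)"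
        unfolding kop_def \<rho>_def by (intro Bochner_Integration.integral_cong) (auto simp: field_simps)
      also have "\<dots> = kop J f x - (LINT y|lborel. \<sigma> y * f (x - y)) / 2 - (LINT y|lborel. \<sigma> y * f (x - z - y)) / 2"
        using i1 by (simp add: kop_def sh add_divide_distrib)
      finally have 1: "kop \<rho> f x = kop J f x - (LINT y|lborel. \<sigma> y * f (x - y)) / 2 - (LINT y|lborel. \<sigma> y * f (x - z - y)) / 2" .
      have "kop \<sigma> (avg z f) x = (kop \<sigma> f x + kop \<sigma> f (x - z)) / 2"
        unfolding kop_avg[OF \<sigma>i f] by (simp only: avg_def)
      then show ?thesis using 1[folded kop_def] by simp
    qed
    define \<phi> where "\<phi> = (\<lambda>x. g x - g (x - z))"
    have \<phi>b: "bdd_borel (D + D) \<phi>" unfolding \<phi>_def by (rule bdd_borel_diff[OF g bdd_borel_shift[OF g]])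
    have "\<bar>(avg z ^^ 0) ((kop J ^^ n) \<phi>) x\<bar> \<le> 2 * D / sqrt (a / 4 * real n + real 0 + 1)"
      using avg_pow_difference[OF g]
      by (intro avg_pow_iterate_decay[OF J_integrable J_nonneg J_integral \<rho>i \<rho>0 \<rho>_int \<sigma>i \<sigma>0 \<sigma>_int a0 a1 dec \<phi>b])
        (auto simp: \<phi>_def)
    also have "\<dots> \<le> 2 * D / sqrt (a / 4 * (real n + 1))"
    proof (intro divide_left_mono)
      show "sqrt (a / 4 * (real n + 1)) \<le> sqrt (a / 4 * real n + real 0 + 1)"
        using a0 a1 by (simp add: field_simps)
      have "0 < a / 4 * real n + 1" "0 < a / 4 * (real n + 1)" using a0 by (auto intro: add_nonneg_pos)
      then show "0 < sqrt (a / 4 * real n + real 0 + 1) * sqrt (a / 4 * (real n + 1))" by simp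
    qed (use bdd_borelD(5)[OF g] in simp)
    also have "\<dots> = C * D / sqrt (real n + 1)"
      by (simp add: C_def real_sqrt_mult real_sqrt_divide)
    finally have "\<bar>kpow n \<phi> x\<bar> \<le> C * D / sqrt (real n + 1)" by (simp add: kpow_def)
    then show ?thesis
      unfolding \<phi>_def kpow_diff[OF g bdd_borel_shift[OF g]] kpow_shift .
  qed
  show ?thesis using that[OF r C0 main] by blast
qed

text \<open>Cuts \<open>z\<close> into \<open>m\<close> steps of length at most \<open>r\<close> and
  telescopes. Rounding \<open>m\<close> up is the source of the \<open>+ 1\<close>: displacements
  shorter than \<open>r\<close> get no better bound than those of length \<open>r\<close>.\<close>

lemma first_difference:
  obtains C where "0 < C"
    "\<And>D g n x z. bdd_borel D g \<Longrightarrow> \<bar>kpow n g x - kpow n g (x - z)\<bar> \<le> C * (norm z + 1) * D / sqrt (real n + 1)"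
proof -
  obtain r C where r: "0 < r" and C: "0 < C"
    and short: "\<And>D g n x z. bdd_borel D g \<Longrightarrow> norm z \<le> r \<Longrightarrow> \<bar>kpow n g x - kpow n g (x - z)\<bar> \<le> C * D / sqrt (real n + 1)"
    using short_difference by metis
  have "\<bar>kpow n g x - kpow n g (x - z)\<bar> \<le> (C * (1 / r + 1)) * (norm z + 1) * D / sqrt (real n + 1)"
    if g: "bdd_borel D g" for D g n x z
  proof -
    define m where "m = Suc (nat \<lfloor>norm z / r\<rfloor>)"
    have m: "norm z / r \<le> real m" "real m \<le> norm z / r + 1" "0 < m"
      using r by (auto simp: m_def) linarith+
    define w where "w = z /\<^sub>R real m"
    have zw: "z = real m *\<^sub>R w" using m by (simp add: w_def)
    have "norm w \<le> r" using m r by (simp add: w_def field_simps)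
    define b where "b = C * D / sqrt (real n + 1)"
    have b0: "0 \<le> b" unfolding b_def using C bdd_borelD(5)[OF g] by simp
    have "\<bar>kpow n g x - kpow n g (x - real j *\<^sub>R w)\<bar> \<le> real j * b" for j
    proof (induction j)
      case (Suc j)
      have "\<bar>kpow n g (x - real j *\<^sub>R w) - kpow n g (x - real j *\<^sub>R w - w)\<bar> \<le> b"
        unfolding b_def by (rule short[OF g \<open>norm w \<le> r\<close>])
      moreover have "x - real j *\<^sub>R w - w = x - real (Suc j) *\<^sub>R w" by (simp add: algebra_simps)
      ultimately show ?case using Suc.IH by (simp add: distrib_right)
    qed simp
    then have "\<bar>kpow n g x - kpow n g (x - z)\<bar> \<le> real m * b" unfolding zw .
    also have "\<dots> \<le> ((1 / r + 1) * (norm z + 1)) * b"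
    proof (intro mult_right_mono b0)
      have "norm z / r + 1 \<le> (1 / r + 1) * (norm z + 1)" using r by (simp add: field_simps)
      then show "real m \<le> (1 / r + 1) * (norm z + 1)" using m by linarith
    qed
    also have "\<dots> = (C * (1 / r + 1)) * (norm z + 1) * D / sqrt (real n + 1)" by (simp add: b_def)
    finally show ?thesis .
  qed
  moreover have "0 < C * (1 / r + 1)" using C r by (simp add: add_pos_pos)
  ultimately show ?thesis using that by blast
qed

text \<open>The iterations are shared between the two differences that make up a second difference:
  \<open>h\<close> of them damp the first, the remaining \<open>j\<close> the second, and each half
  yields a factor \<open>n^(-1/2)\<close>.\<close>

lemma time_difference:
  obtains C where "0 < C"
    "\<And>D g n x. bdd_borel D g \<Longrightarrow> \<bar>kpow (Suc n) g x - kpow n g x\<bar> \<le> C * D / (real n + 1)"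
proof -
  obtain C where C: "0 < C"
    and fd: "\<And>D g n x z. bdd_borel D g \<Longrightarrow> \<bar>kpow n g x - kpow n g (x - z)\<bar> \<le> C * (norm z + 1) * D / sqrt (real n + 1)"
    using first_difference by metis
  obtain S0 where S0: "\<And>x. J x \<noteq> 0 \<Longrightarrow> norm x \<le> S0" using J_bounded_support by blast
  define S where "S = max S0 0"
  have S: "0 \<le> S" "\<And>x. J x \<noteq> 0 \<Longrightarrow> norm x \<le> S" using S0 by (auto simp: S_def le_max_iff_disj)
  define C' where "C' = (C * (S + 1))\<^sup>2"
  have C': "0 < C'" unfolding C'_def using C S by simp
  have "\<bar>kpow (Suc n) g x - kpow n g x\<bar> \<le> C' * D / (real n + 1)"
    if g: "bdd_borel D g" for D g n x
  proof -
    define h j where "h = n div 2" and "j = n - h"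
    have n: "n = j + h" "(real n + 1) / 2 \<le> real h + 1" "(real n + 1) / 2 \<le> real j + 1"
      by (auto simp: h_def j_def)
    let ?G = "kpow n g"
    have G: "bdd_borel D ?G" by (rule bdd_kpow[OF g])
    define E where "E = C * (S + 1) * D / sqrt (real h + 1)"
    \<comment> \<open>The factor 2 is the product of two losses \<open>sqrt 2\<close> from halving
      \<open>n\<close>; it cancels at the end against the 2 on the left of
      \<open>eq\<close>.\<close>
    define K where "K = 2 * (C' * D / (real n + 1))"
    have second: "\<bar>2 * ?G x - ?G (x - y) - ?G (x + y)\<bar> \<le> K" if y: "norm y \<le> S" for y
    proof -
      define \<psi> where "\<psi> = (\<lambda>x. kpow h g x - kpow h g (x - y))"
      have "bdd_borel (D + D) \<psi>" unfolding \<psi>_def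
        by (rule bdd_borel_diff[OF bdd_kpow[OF g] bdd_borel_shift[OF bdd_kpow[OF g]]])
      moreover have "\<bar>\<psi> x\<bar> \<le> E" for x
      proof -
        have "C * (norm y + 1) * D / sqrt (real h + 1) \<le> E"
          unfolding E_def using y C bdd_borelD(5)[OF g] by (intro divide_right_mono mult_right_mono mult_left_mono) auto
        then show ?thesis using fd[OF g, of h x y] unfolding \<psi>_def by linarith
      qed
      \<comment> \<open>The a priori bound \<open>D + D\<close> is traded for \<open>E\<close>, so
        the second use of the first-difference estimate starts from a bound already of order
        \<open>n^(-1/2)\<close>.\<close>
      ultimately have \<psi>: "bdd_borel E \<psi>" by (auto simp: bdd_borel_def)
      have J\<psi>: "kpow j \<psi> = (\<lambda>x. ?G x - ?G (x - y))"
        unfolding \<psi>_def kpow_diff[OF bdd_kpow[OF g] bdd_borel_shift[OF bdd_kpow[OF g]]] kpow_shift by (simp add: kpow_add n(1))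
      have E: "0 \<le> E" using bdd_borelD(5)[OF \<psi>] .
      have "\<bar>kpow j \<psi> x - kpow j \<psi> (x - (- y))\<bar> \<le> C * (norm (- y) + 1) * E / sqrt (real j + 1)"
        by (rule fd[OF \<psi>])
      also have "\<dots> \<le> C * (S + 1) * E / sqrt (real j + 1)"
        using y C E by (intro divide_right_mono mult_right_mono mult_left_mono) auto
      also have "\<dots> = C' * D / (sqrt (real h + 1) * sqrt (real j + 1))"
        unfolding E_def C'_def by (simp add: power2_eq_square)
      also have "\<dots> \<le> C' * D / (sqrt ((real n + 1) / 2) * sqrt ((real n + 1) / 2))"
        using n C' bdd_borelD(5)[OF g]
        by (intro divide_left_mono mult_mono real_sqrt_le_mono) (auto intro!: mult_pos_pos)
      also have "\<dots> = K" by (simp add: K_def)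
      finally show ?thesis unfolding J\<psi> by (simp add: algebra_simps)
    qed
    have [measurable]: "?G \<in> borel_measurable borel" using bdd_borelD[OF G] by auto
    have i: "integrable lborel (\<lambda>y. J y * ?G (x - y))" by (rule kop_integrable[OF J_integrable G])
    have i': "integrable lborel (\<lambda>y. J y * ?G (x + y))"
      using lborel_integrable_reflect(1)[OF i, of 0] by (simp add: J_even)
    have e1: "kpow (Suc n) g x = (LINT y|lborel. J y * ?G (x - y))" by (simp add: kpow_Suc kop_def)
    \<comment> \<open>Evenness gives a second formula for the same value; adding the two formulas
      pairs \<open>y\<close> with \<open>- y\<close> and leaves a second difference.\<close>
    have e2: "kpow (Suc n) g x = (LINT y|lborel. J y * ?G (x + y))"
      using lborel_integral_reflect[of "\<lambda>y. J y * ?G (x - y)" 0] unfolding e1 by (simp add: J_even)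
    have e3: "?G x = (LINT y|lborel. J y * ?G x)" using J_integral by simp
    have iJ: "integrable lborel (\<lambda>y. J y * ?G x)" using J_integrable by simp
    have dist3: "a * (2 * b - c - d) = 2 * (a * b) - a * c - a * d" for a b c d :: real
      by (simp add: algebra_simps)
    have ii: "integrable lborel (\<lambda>y. J y * (2 * ?G x - ?G (x - y) - ?G (x + y)))"
      unfolding dist3 by (intro Bochner_Integration.integrable_diff integrable_mult_right i i' iJ)
    have eq: "2 * (?G x - kpow (Suc n) g x) = (LINT y|lborel. J y * (2 * ?G x - ?G (x - y) - ?G (x + y)))"
    proof -
      have "(LINT y|lborel. J y * (2 * ?G x - ?G (x - y) - ?G (x + y)))
          = (LINT y|lborel. 2 * (J y * ?G x)) - (LINT y|lborel. J y * ?G (x - y)) - (LINT y|lborel. J y * ?G (x + y))"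
        unfolding dist3 using i i' iJ by (simp only: Bochner_Integration.integral_diff Bochner_Integration.integrable_diff integrable_mult_right)
      also have "\<dots> = 2 * ?G x - kpow (Suc n) g x - kpow (Suc n) g x"
        unfolding e1[symmetric] e2[symmetric] using e3 by (simp only: integral_mult_right_zero)
      finally show ?thesis by simp
    qed
    have "norm (2 * (?G x - kpow (Suc n) g x)) \<le> (LINT y|lborel. J y * K)"
    proof -
      have "norm (2 * (?G x - kpow (Suc n) g x))
          \<le> (LINT y|lborel. norm (J y * (2 * ?G x - ?G (x - y) - ?G (x + y))))"
        unfolding eq by (rule integral_norm_bound)
      also have "\<dots> \<le> (LINT y|lborel. J y * K)"
      proof (intro integral_mono integrable_norm ii)
        show "integrable lborel (\<lambda>y. J y * K)" using J_integrable by simp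
        show "norm (J y * (2 * ?G x - ?G (x - y) - ?G (x + y))) \<le> J y * K" for y
          using second[of y] S(2)[of y] J_nonneg[of y] by (cases "J y = 0") (auto simp: abs_mult intro: mult_left_mono)
      qed
      finally show ?thesis .
    qed
    also have "\<dots> = K" using J_integral by simp
    finally have "\<bar>2 * (?G x - kpow (Suc n) g x)\<bar> \<le> K" by simp
    moreover have "\<bar>2 * (?G x - kpow (Suc n) g x)\<bar> = 2 * \<bar>kpow (Suc n) g x - ?G x\<bar>" by (simp add: abs_if)
    ultimately show ?thesis unfolding K_def by simp
  qed
  then show ?thesis using that C' by blast
qed

text \<open>One factor \<open>J\<close> turns mass into a sup bound at the cost of \<open>B\<close>;
  the other \<open>n\<close> preserve the mass.\<close>

lemma kpow_sup_bound:
  assumes B: "\<And>x. J x \<le> B" and v: "bdd_borel D v" "\<And>x. 0 \<le> v x" "integrable lborel v"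
  shows "kpow (Suc n) v x \<le> B * (LINT x|lborel. v x)"
proof -
  let ?w = "kpow n v"
  have w: "bdd_borel D ?w" by (rule bdd_kpow[OF v(1)])
  have [measurable]: "?w \<in> borel_measurable borel" using bdd_borelD[OF w] by auto
  have "kpow (Suc n) v x \<le> (LINT y|lborel. B * ?w (x - y))"
    unfolding kpow_Suc kop_def
    using lborel_integrable_reflect(1)[OF kpow_L1(1)[OF v(3)]] kpow_nonneg[OF v(1,2)]
    by (intro integral_mono kop_integrable[OF J_integrable w] mult_right_mono B) auto
  also have "\<dots> = B * (LINT x|lborel. v x)"
    using lborel_integral_reflect[of ?w x] kpow_L1(2)[OF v(3)] by simp
  finally show ?thesis .
qed

text \<open>Multiplied by \<open>sqrt n ^ N\<close>, the supremum is halved each time \<open>n\<close> doubles, up to the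
  contribution of the average over a ball of radius \<open>\<epsilon> sqrt n\<close>, because \<open>J^n g\<close> varies little on such a ball.\<close>

lemma kpow_on_diagonal_decay:
  obtains C where "0 < C"
    "\<And>D v n x. bdd_borel D v \<Longrightarrow> (\<And>x. 0 \<le> v x) \<Longrightarrow> integrable lborel v \<Longrightarrow> 1 \<le> n \<Longrightarrow>
       kpow n v x \<le> C / sqrt (real n) ^ DIM('a) * (LINT x|lborel. v x)"
proof -
  let ?N = "DIM('a)"
  obtain C1 where C1: "0 < C1"
    and fd: "\<And>D g n x z. bdd_borel D g \<Longrightarrow> \<bar>kpow n g x - kpow n g (x - z)\<bar> \<le> C1 * (norm z + 1) * D / sqrt (real n + 1)"
    using first_difference by metis
  obtain B where B: "0 < B" "\<And>x. J x \<le> B" using J_bounded by metis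
  \<comment> \<open>So small that the oscillation of the iterate on a ball of radius
    \<open>e * sqrt n\<close> uses at most half of the claimed bound; \<open>sqrt 3 ^ N\<close> is
    the price of passing from \<open>h \<ge> n / 3\<close> back to \<open>n\<close>.\<close>
  define e where "e = 1 / (8 * C1 * sqrt 3 ^ ?N + 1)"
  have p: "0 < 8 * C1 * sqrt 3 ^ ?N" using C1 by simp
  have e: "0 < e" "e < 1" "8 * C1 * sqrt 3 ^ ?N * e \<le> 1" using p unfolding e_def by (auto simp: field_simps)
  have u: "0 < unit_ball_vol (real ?N)" by simp
  \<comment> \<open>The first summand fits the average over the ball into the other half of the
    bound; the second covers the start of the induction, where
    \<open>e * sqrt n \<le> 1\<close>.\<close>
  define C where "C = 2 / (unit_ball_vol (real ?N) * e ^ ?N) + B / e ^ ?N"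
  have C: "0 < C" "B / e ^ ?N \<le> C" "1 / (unit_ball_vol (real ?N) * e ^ ?N) \<le> C / 2"
    unfolding C_def using e u B by (auto intro!: add_pos_pos)
  have "kpow n v x \<le> C / sqrt (real n) ^ ?N * (LINT x|lborel. v x)"
    if v: "bdd_borel D v" "\<And>x. 0 \<le> v x" "integrable lborel v" and n: "1 \<le> n" for D v n x
    using n
  proof (induction n arbitrary: x rule: less_induct)
    case (less n)
    define I where "I = (LINT x|lborel. v x)"
    have I: "0 \<le> I" unfolding I_def using v by (intro integral_nonneg_AE) auto
    show ?case
    proof (cases "e * sqrt (real n) \<le> 1")
      case True
      obtain n' where n': "n = Suc n'" using less.prems by (cases n) auto
      have "(e * sqrt (real n)) ^ ?N \<le> 1 ^ ?N"
        using True e by (intro power_mono) auto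
      then have "1 \<le> 1 / (e ^ ?N * sqrt (real n) ^ ?N)"
        using e less.prems by (simp add: power_mult_distrib)
      then have "B * 1 \<le> B * (1 / (e ^ ?N * sqrt (real n) ^ ?N))" using B by (intro mult_left_mono) auto
      also have "\<dots> = (B / e ^ ?N) / sqrt (real n) ^ ?N" by simp
      also have "\<dots> \<le> C / sqrt (real n) ^ ?N" using C by (intro divide_right_mono) auto
      finally have "B * I \<le> C / sqrt (real n) ^ ?N * I" using I by (intro mult_right_mono) auto
      then show ?thesis using kpow_sup_bound[OF B(2) v, of n' x] unfolding n' I_def by linarith
    next
      case False
      define R where "R = e * sqrt (real n)"
      have R: "1 < R" using False by (simp add: R_def)
      have n2: "2 \<le> n"
      proof (rule ccontr)
        assume "\<not> 2 \<le> n"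
        then have "n = 1" using less.prems by simp
        then show False using False e by simp
      qed
      define h j where "h = n div 2" and "j = n - h"
      \<comment> \<open>For odd \<open>n\<close> the factor 2 would fail; 3 is attained at
        \<open>n = 3\<close>, \<open>h = 1\<close>.\<close>
      have "n \<le> 3 * h" "n \<le> 2 * (j + 1)"
        using n2 unfolding h_def j_def by presburger+
      then have "real n \<le> real (3 * h)" "real n \<le> real (2 * (j + 1))" by (simp_all only: of_nat_le_iff)
      then have hj: "n = j + h" "1 \<le> h" "h < n" "real n \<le> 3 * real h" "real n \<le> 2 * (real j + 1)"
        using n2 unfolding h_def j_def by auto
      define K where "K = C / sqrt (real h) ^ ?N * I"
      have K0: "0 \<le> K" unfolding K_def using C I by simp
      have w: "bdd_borel K (kpow h v)"
        using bdd_borelD(1)[OF bdd_kpow[OF v(1)]] kpow_nonneg[OF v(1,2)] less.IH[OF hj(3,2)]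
        by (auto simp: bdd_borel_def K_def I_def)
      define E where "E = C1 * (R + 1) * K / sqrt (real j + 1)"
      let ?G = "kpow n v"
      have near: "?G x - E \<le> ?G (x - z)" if z: "norm z < R" for z
      proof -
        have "\<bar>kpow j (kpow h v) x - kpow j (kpow h v) (x - z)\<bar> \<le> C1 * (norm z + 1) * K / sqrt (real j + 1)"
          by (rule fd[OF w])
        also have "\<dots> \<le> E"
          unfolding E_def using z C1 K0 by (intro divide_right_mono mult_right_mono mult_left_mono) auto
        finally show ?thesis unfolding hj(1) kpow_add by linarith
      qed
      have G: "bdd_borel D ?G" "integrable lborel ?G" "\<And>y. 0 \<le> ?G y"
        using bdd_kpow[OF v(1)] kpow_L1(1)[OF v(3)] kpow_nonneg[OF v(1,2)] by auto
      have [measurable]: "?G \<in> borel_measurable borel" using G by auto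
      \<comment> \<open>A large value at \<open>x\<close> would make the iterate large on the whole
        ball, which its total mass \<open>I\<close> forbids.\<close>
      have "measure lborel (ball (0::'a) R) * (?G x - E) = (LINT z|lborel. indicator (ball (0::'a) R) z * (?G x - E))"
        by simp
      also have "\<dots> \<le> (LINT z|lborel. ?G (x - z))"
      proof (intro integral_mono lborel_integrable_reflect(1) G)
        show "integrable lborel (\<lambda>z. indicator (ball (0::'a) R) z * (?G x - E))"
          by (intro integrable_mult_left integrable_real_indicator) (auto simp: emeasure_lborel_ball_finite[unfolded infinity_ennreal_def])
        show "indicator (ball 0 R) z * (?G x - E) \<le> ?G (x - z)" for z
          using near[of z] G(3) by (simp add: indicator_def)
      qed
      also have "\<dots> = I"
        using lborel_integral_reflect[of ?G x] kpow_L1(2)[OF v(3)] by (simp add: I_def)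
      finally have "unit_ball_vol (real ?N) * R ^ ?N * (?G x - E) \<le> I"
        using R by (simp add: content_ball)
      moreover have vR: "0 < unit_ball_vol (real ?N) * R ^ ?N" using u R by simp
      ultimately have "?G x - E \<le> I / (unit_ball_vol (real ?N) * R ^ ?N)"
        by (simp only: pos_le_divide_eq mult.commute)
      also have "\<dots> = (1 / (unit_ball_vol (real ?N) * e ^ ?N)) * (I / sqrt (real n) ^ ?N)"
        by (simp add: R_def power_mult_distrib)
      also have "\<dots> \<le> C / 2 * (I / sqrt (real n) ^ ?N)"
        using C I by (intro mult_right_mono) auto
      finally have 1: "?G x \<le> E + C / 2 * (I / sqrt (real n) ^ ?N)" by simp
      have "K \<le> C * sqrt 3 ^ ?N * (I / sqrt (real n) ^ ?N)"
      proof -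
        have "sqrt (real n) ^ ?N \<le> sqrt (3 * real h) ^ ?N"
          using hj by (intro power_mono real_sqrt_le_mono) auto
        then have "1 / sqrt (real h) ^ ?N \<le> sqrt 3 ^ ?N / sqrt (real n) ^ ?N"
          using hj n2 by (simp add: real_sqrt_mult power_mult_distrib field_simps)
        then have "(C * I) * (1 / sqrt (real h) ^ ?N) \<le> (C * I) * (sqrt 3 ^ ?N / sqrt (real n) ^ ?N)"
          using C I by (intro mult_left_mono) auto
        then show ?thesis by (simp add: K_def mult_ac)
      qed
      moreover have "E \<le> 4 * C1 * e * K"
      proof -
        have sqrt_double_le: "sqrt (2 * r) \<le> 2 * sqrt r" if "0 \<le> r" for r :: real
          using that by (intro real_le_lsqrt) (auto simp: power_mult_distrib)
        have "sqrt (real n) \<le> sqrt (2 * (real j + 1))" using hj by (intro real_sqrt_le_mono) auto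
        also have "\<dots> \<le> 2 * sqrt (real j + 1)"
          by (rule sqrt_double_le) simp
        finally have "e * sqrt (real n) \<le> e * (2 * sqrt (real j + 1))" using e by (intro mult_left_mono) auto
        then have "R + 1 \<le> 4 * e * sqrt (real j + 1)" using R unfolding R_def by linarith
        then have "C1 * (R + 1) * K / sqrt (real j + 1) \<le> C1 * (4 * e * sqrt (real j + 1)) * K / sqrt (real j + 1)"
          using C1 K0 by (intro divide_right_mono mult_right_mono mult_left_mono) auto
        also have "\<dots> = 4 * C1 * e * K" by simp
        finally show ?thesis by (simp add: E_def)
      qed
      moreover have "4 * C1 * e * (C * sqrt 3 ^ ?N * (I / sqrt (real n) ^ ?N)) \<le> C / 2 * (I / sqrt (real n) ^ ?N)"
      proof -
        have "4 * C1 * e * (C * sqrt 3 ^ ?N * (I / sqrt (real n) ^ ?N)) = (8 * C1 * sqrt 3 ^ ?N * e) * (C / 2 * (I / sqrt (real n) ^ ?N))"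
          by simp
        also have "\<dots> \<le> 1 * (C / 2 * (I / sqrt (real n) ^ ?N))"
          using e(3) C I by (intro mult_right_mono) auto
        finally show ?thesis by simp
      qed
      ultimately have "E \<le> C / 2 * (I / sqrt (real n) ^ ?N)"
        using C1 e(1) by (smt (verit) mult_left_mono mult_nonneg_nonneg)
      then show ?thesis using 1 by (simp add: I_def)
    qed
  qed
  then show ?thesis using that C by blast
qed

end

section \<open>The semigroup as a Poisson average of the iterates\<close>

definition pois :: "real \<Rightarrow> nat \<Rightarrow> real" where
  "pois t n = exp (- t) * (t ^ n / fact n)"

lemma exp_series_sums: "(\<lambda>n. t ^ n / fact n) sums exp (t::real)"
  using exp_converges[of t] by (simp add: divide_inverse mult.commute)

lemma pois_sums: "pois t sums 1"
  using sums_mult[OF exp_series_sums[of t], of "exp (- t)"]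
  by (simp add: pois_def[abs_def] exp_minus)

lemma pois_nonneg: "0 \<le> t \<Longrightarrow> 0 \<le> pois t n"
  by (simp add: pois_def)

lemma summable_bounded_exp_series:
  fixes a :: "nat \<Rightarrow> real"
  assumes a: "\<And>n. \<bar>a n\<bar> \<le> D"
  shows "summable (\<lambda>n. a n / fact n * t ^ n)"
proof (rule summable_comparison_test)
  show "summable (\<lambda>n. D * (\<bar>t\<bar> ^ n / fact n))"
    using exp_series_sums[of "\<bar>t\<bar>"] by (intro summable_mult) (auto simp: sums_iff)
  have "norm (a n / fact n * t ^ n) \<le> D * (\<bar>t\<bar> ^ n / fact n)" for n
    using mult_right_mono[OF a[of n], of "\<bar>t\<bar> ^ n / fact n"]
    by (simp add: abs_mult power_abs)
  then show "\<exists>N. \<forall>n\<ge>N. norm (a n / fact n * t ^ n) \<le> D * (\<bar>t\<bar> ^ n / fact n)" by blast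
qed

lemma summable_pois:
  fixes a :: "nat \<Rightarrow> real"
  assumes a: "\<And>n. \<bar>a n\<bar> \<le> D"
  shows "summable (\<lambda>n. pois t n * a n)"
proof -
  have "summable (\<lambda>n. a n / fact n * t ^ n)"
    by (rule summable_bounded_exp_series) (rule a)
  then have "summable (\<lambda>n. exp (- t) * (a n / fact n * t ^ n))" by (rule summable_mult)
  then show ?thesis by (simp add: pois_def mult_ac)
qed

text \<open>\<open>pois t n / (n + 1) = pois t (n + 1) / t\<close>, so the inverse moment is a
  shifted Poisson sum and misses \<open>1 / t\<close> only by the zeroth weight.\<close>

lemma pois_inverse_moment:
  assumes t: "0 < t"
  shows "summable (\<lambda>n. pois t n / (real n + 1))" "(\<Sum>n. pois t n / (real n + 1)) \<le> 1 / t"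
proof -
  have eq: "pois t n / (real n + 1) = pois t (Suc n) / t" for n
    using t by (simp add: pois_def divide_divide_eq_left mult_ac add.commute)
  have s: "summable (\<lambda>n. pois t (Suc n))"
    using pois_sums[of t] by (subst summable_Suc_iff) (auto simp: sums_iff)
  have "(\<Sum>n. pois t (Suc n)) = 1 - pois t 0"
    using suminf_split_head[of "pois t"] pois_sums[of t] by (auto simp: sums_iff)
  then have "(\<Sum>n. pois t (Suc n)) \<le> 1" using pois_nonneg[of t 0] t by simp
  then show "summable (\<lambda>n. pois t n / (real n + 1))" "(\<Sum>n. pois t n / (real n + 1)) \<le> 1 / t"
    unfolding eq using s t by (auto simp: suminf_divide divide_right_mono summable_divide)
qed

text \<open>Shaped so that the inverse moment is the only input: bounds involving square roots are
  first linearised into the form \<open>\<alpha> / (n + 1) + \<beta>\<close>.\<close>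

lemma pois_average_le:
  fixes b :: "nat \<Rightarrow> real"
  assumes t: "0 < t" and b: "\<And>n. \<bar>b n\<bar> \<le> \<alpha> / (real n + 1) + \<beta>" and \<alpha>: "0 \<le> \<alpha>"
  shows "\<bar>\<Sum>n. pois t n * b n\<bar> \<le> \<alpha> / t + \<beta>"
proof -
  have s: "(\<lambda>n. \<alpha> * (pois t n / (real n + 1)) + \<beta> * pois t n) sums (\<alpha> * (\<Sum>n. pois t n / (real n + 1)) + \<beta> * 1)"
    using pois_inverse_moment(1)[OF t] by (intro sums_add sums_mult pois_sums summable_sums)
  have le: "norm (pois t n * b n) \<le> \<alpha> * (pois t n / (real n + 1)) + \<beta> * pois t n" for n
    using mult_left_mono[OF b[of n] pois_nonneg[of t n]] t pois_nonneg[of t n]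
    by (simp add: abs_mult algebra_simps)
  have sn: "summable (\<lambda>n. norm (pois t n * b n))"
    by (rule summable_comparison_test'[OF sums_summable[OF s], of 0]) (use le in auto)
  have "\<bar>\<Sum>n. pois t n * b n\<bar> \<le> (\<Sum>n. norm (pois t n * b n))"
    using summable_norm[OF sn] by simp
  also have "\<dots> \<le> \<alpha> * (\<Sum>n. pois t n / (real n + 1)) + \<beta> * 1"
    unfolding sums_unique[OF s] using s by (intro suminf_le le sn) (auto simp: sums_iff)
  also have "\<dots> \<le> \<alpha> * (1 / t) + \<beta>"
    using mult_left_mono[OF pois_inverse_moment(2)[OF t] \<alpha>] by simp
  finally show ?thesis by simp
qed

lemma fact_add_le: "fact (n + m) \<le> fact n * (real n + real m) ^ m"
proof (induction m)
  case (Suc m)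
  have "fact (n + Suc m) = (real n + real (Suc m)) * fact (n + m)" by simp
  also have "\<dots> \<le> (real n + real (Suc m)) * (fact n * (real n + real m) ^ m)"
    by (intro mult_left_mono Suc.IH) auto
  also have "\<dots> \<le> (real n + real (Suc m)) * (fact n * (real n + real (Suc m)) ^ m)"
    by (intro mult_left_mono power_mono) auto
  finally show ?case by (simp add: mult_ac)
qed simp

text \<open>Odd \<open>N\<close> produces half-integer powers. With \<open>q = (n + 1)^(N/2)\<close>
  and \<open>S = t^(N/2)\<close>, the inequality \<open>1 / q \<le> S / q^2 + 1 / S\<close> reduces
  them to the inverse moment of order \<open>N\<close>, which in turn follows by shifting the index
  by \<open>N\<close> inside the factorials.\<close>

lemma pois_sqrt_power_moment:
  assumes t: "0 < t"
  shows "summable (\<lambda>n. pois t (Suc n) / sqrt (real (Suc n)) ^ N)"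
    and "(\<Sum>n. pois t (Suc n) / sqrt (real (Suc n)) ^ N) \<le> (real (N + 1) ^ N + 1) / sqrt t ^ N"
proof -
  define s where "s = sqrt t"
  have s: "0 < s" "s * s = t" using t by (auto simp: s_def)
  have tN: "t ^ N = s ^ N * s ^ N" unfolding s(2)[symmetric] by (simp add: power_mult_distrib)
  define u where "u n = real (N + 1) ^ N / s ^ N * pois t (n + Suc N) + 1 / s ^ N * pois t (Suc n)" for n
  have shift: "summable (\<lambda>n. pois t (n + k))" "(\<Sum>n. pois t (n + k)) \<le> 1" for k
  proof -
    show "summable (\<lambda>n. pois t (n + k))" using pois_sums[of t] by (subst summable_iff_shift) (auto simp: sums_iff)
    have "(\<Sum>n. pois t (n + k)) = 1 - (\<Sum>i<k. pois t i)"
      using pois_sums[of t] by (subst suminf_minus_initial_segment) (auto simp: sums_iff)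
    then show "(\<Sum>n. pois t (n + k)) \<le> 1" using sum_nonneg[of "{..<k}" "pois t"] pois_nonneg[of t] t by auto
  qed
  have su: "summable u" unfolding u_def using shift(1)[of "Suc N"] shift(1)[of 1] by (intro summable_add summable_mult) auto
  have le: "pois t (Suc n) / sqrt (real (Suc n)) ^ N \<le> u n" for n
  proof -
    let ?m = "Suc n"
    define q where "q = sqrt (real ?m) ^ N"
    have q: "0 < q" "q * q = real ?m ^ N" by (auto simp: q_def power_mult_distrib[symmetric])
    have "1 / q \<le> S / (q * q) + 1 / S" if "0 < S" for S
    proof -
      have "0 \<le> (S / q - 1)\<^sup>2 / S" using that by simp
      also have "\<dots> = S / (q * q) + 1 / S - 2 / q"
        using that q by (simp add: power2_eq_square field_simps)
      finally have "2 / q \<le> S / (q * q) + 1 / S" by simp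
      moreover have "1 / q \<le> 2 / q" using q by (intro divide_right_mono) auto
      ultimately show ?thesis by linarith
    qed
    then have amgm: "1 / q \<le> s ^ N / (q * q) + 1 / s ^ N" using s by simp
    have frac: "1 / b \<le> p / a" if "a \<le> b * p" "0 < a" "0 < b" for a b p :: real
      using that by (simp add: field_simps)
    have "pois t ?m / real ?m ^ N \<le> real (N + 1) ^ N * (pois t (?m + N) / t ^ N)"
    proof -
      have "fact (?m + N) \<le> fact ?m * (real ?m + real N) ^ N" by (rule fact_add_le)
      \<comment> \<open>\<open>m + N \<le> (N + 1) * m\<close> because \<open>m \<ge> 1\<close>;
        this is where the constant \<open>(N + 1)^N\<close> comes from.\<close>
      also have "\<dots> \<le> fact ?m * (real (N + 1) * real ?m) ^ N"
        by (intro mult_left_mono power_mono) (auto simp: algebra_simps)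
      finally have "1 / (fact ?m * real ?m ^ N) \<le> real (N + 1) ^ N / fact (?m + N)"
        using frac[of "fact (?m + N)" "fact ?m * real ?m ^ N" "real (N + 1) ^ N"]
        by (simp only: power_mult_distrib mult_ac) simp
      then have "exp (- t) * t ^ ?m * (1 / (fact ?m * real ?m ^ N)) \<le> exp (- t) * t ^ ?m * (real (N + 1) ^ N / fact (?m + N))"
        using t by (intro mult_left_mono) auto
      moreover have "exp (- t) * t ^ ?m * (real (N + 1) ^ N / fact (?m + N)) = real (N + 1) ^ N * (pois t (?m + N) / t ^ N)"
        using t by (simp add: pois_def power_add del: fact_Suc of_nat_Suc add_Suc add_Suc_right power_Suc)
      ultimately show ?thesis by (simp add: pois_def del: fact_Suc of_nat_Suc)
    qed
    then have "s ^ N * (pois t ?m / real ?m ^ N) \<le> s ^ N * (real (N + 1) ^ N * (pois t (?m + N) / t ^ N))"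
      using s by (intro mult_left_mono) auto
    also have "\<dots> = real (N + 1) ^ N / s ^ N * pois t (n + Suc N)"
      using s by (simp add: tN add.commute)
    finally have 1: "pois t ?m * (s ^ N / (q * q)) \<le> real (N + 1) ^ N / s ^ N * pois t (n + Suc N)"
      unfolding q(2) by (simp add: mult_ac)
    have "pois t ?m * (1 / q) \<le> pois t ?m * (s ^ N / (q * q) + 1 / s ^ N)"
      using t by (intro mult_left_mono amgm pois_nonneg) auto
    then show ?thesis using 1 unfolding u_def q_def[symmetric] by (simp add: distrib_left)
  qed
  show sm: "summable (\<lambda>n. pois t (Suc n) / sqrt (real (Suc n)) ^ N)"
    by (rule summable_comparison_test'[OF su, of 0]) (use le pois_nonneg[of t] t in auto)
  have "(\<Sum>n. pois t (Suc n) / sqrt (real (Suc n)) ^ N) \<le> (\<Sum>n. u n)"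
    by (intro suminf_le le sm su)
  also have "\<dots> = real (N + 1) ^ N / s ^ N * (\<Sum>n. pois t (n + Suc N)) + 1 / s ^ N * (\<Sum>n. pois t (n + 1))"
    unfolding u_def using shift(1)[of "Suc N"] shift(1)[of 1]
    by (intro sums_unique[symmetric] sums_add sums_mult summable_sums) auto
  also have "\<dots> \<le> real (N + 1) ^ N / s ^ N * 1 + 1 / s ^ N * 1"
    using s by (intro add_mono mult_left_mono shift) auto
  finally show "(\<Sum>n. pois t (Suc n) / sqrt (real (Suc n)) ^ N) \<le> (real (N + 1) ^ N + 1) / sqrt t ^ N"
    by (simp add: s_def add_divide_distrib)
qed

section \<open>The semigroup of \<open>v_t = J * v - v\<close>\<close>

context jump_kernel
begin

text \<open>The operator exponential of \<open>t\<close> times convolution with \<open>J\<close>,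
  applied to \<open>g\<close>. Without the factor \<open>exp (- t)\<close>, differentiation in
  \<open>t\<close> merely replaces \<open>g\<close> by \<open>kop J g\<close>.\<close>

definition egf :: "('a \<Rightarrow> real) \<Rightarrow> 'a \<Rightarrow> real \<Rightarrow> real" where
  "egf g x t = (\<Sum>n. kpow n g x / fact n * t ^ n)"

text \<open>Convolution of \<open>g\<close> with the full fundamental solution
  \<open>e^(-t) \<delta> + W\<close>; the link to the given \<open>W\<close> is made only in
  \<open>kop_W\<close>.\<close>

definition flow :: "('a \<Rightarrow> real) \<Rightarrow> 'a \<Rightarrow> real \<Rightarrow> real" where
  "flow g x t = exp (- t) * egf g x t"

lemma kpow_le: "bdd_borel D g \<Longrightarrow> \<bar>kpow n g x\<bar> \<le> D"
  using bdd_kpow bdd_borelD(2) by blast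

lemma flow_pois:
  assumes g: "bdd_borel D g"
  shows "flow g x t = (\<Sum>n. pois t n * kpow n g x)"
proof -
  have "summable (\<lambda>n. kpow n g x / fact n * t ^ n)"
    by (rule summable_bounded_exp_series) (rule kpow_le[OF g])
  from suminf_mult[OF this, of "exp (- t)"] show ?thesis
    by (simp add: flow_def egf_def pois_def mult_ac)
qed

lemma egf_kop: "egf (kop J g) x t = (\<Sum>n. kpow (Suc n) g x / fact n * t ^ n)"
  using kpow_add[of _ 1 g] by (simp add: egf_def kpow_Suc)

lemma egf_deriv:
  assumes g: "bdd_borel D g"
  shows "(egf g x has_real_derivative egf (kop J g) x t) (at t)"
proof -
  let ?c = "\<lambda>n. kpow n g x / fact n"
  have "((\<lambda>t. \<Sum>n. ?c n * t ^ n) has_field_derivative (\<Sum>n. diffs ?c n * t ^ n)) (at t)"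
    by (rule termdiffs_strong_converges_everywhere) (rule summable_bounded_exp_series[OF kpow_le[OF g]])
  moreover have "diffs ?c n = kpow (Suc n) g x / fact n" for n
    by (simp add: diffs_def field_simps del: of_nat_Suc)
  ultimately show ?thesis unfolding egf_kop unfolding egf_def[abs_def] by simp
qed

lemma egf_0: "egf g x 0 = g x"
  unfolding egf_def using powser_zero[of "\<lambda>n. kpow n g x / fact n"] by simp

lemma flow_le: assumes g: "bdd_borel D g" and t: "0 \<le> t" shows "\<bar>flow g x t\<bar> \<le> D"
proof (cases "t = 0")
  case True then show ?thesis using bdd_borelD(2)[OF g] by (simp add: flow_def egf_0)
next
  case False
  then show ?thesis
    using pois_average_le[of t "\<lambda>n. kpow n g x" 0 D] kpow_le[OF g] t unfolding flow_pois[OF g] by simp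
qed

lemma flow_deriv:
  assumes g: "bdd_borel D g"
  shows "(flow g x has_real_derivative flow (kop J g) x t - flow g x t) (at t)"
  unfolding flow_def[abs_def]
  by (rule derivative_eq_intros egf_deriv[OF g] refl | simp)+

text \<open>With \<open>r = sqrt (n + 1)\<close> and \<open>s = sqrt t\<close>, the linearisation
  \<open>1 / r \<le> s / (2 r^2) + 1 / (2 s)\<close> is sharp at \<open>n + 1 = t\<close>, where the
  Poisson law concentrates, so no power of \<open>t\<close> is lost.\<close>

lemma flow_translation:
  obtains C where "0 < C"
    "\<And>D g x x' t. bdd_borel D g \<Longrightarrow> 0 < t \<Longrightarrow> \<bar>flow g x t - flow g x' t\<bar> \<le> C * (norm (x - x') + 1) * D / sqrt t"
proof -
  obtain C where C: "0 < C"
    and fd: "\<And>D g n x z. bdd_borel D g \<Longrightarrow> \<bar>kpow n g x - kpow n g (x - z)\<bar> \<le> C * (norm z + 1) * D / sqrt (real n + 1)"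
    using first_difference by metis
  have "\<bar>flow g x t - flow g x' t\<bar> \<le> C * (norm (x - x') + 1) * D / sqrt t"
    if g: "bdd_borel D g" and t: "0 < t" for D g x x' t
  proof -
    define K where "K = C * (norm (x - x') + 1) * D"
    have K: "0 \<le> K" unfolding K_def using C bdd_borelD(5)[OF g] by simp
    define s where "s = sqrt t"
    have s: "0 < s" "t = s * s" using t by (auto simp: s_def)
    have "\<bar>kpow n g x - kpow n g x'\<bar> \<le> (K * s / 2) / (real n + 1) + K / (2 * s)" for n
    proof -
      define r where "r = sqrt (real n + 1)"
      have r: "0 < r" "real n + 1 = r * r" by (auto simp: r_def)
      have "\<bar>kpow n g x - kpow n g x'\<bar> \<le> K * (1 / r)"
        using fd[OF g, of n x "x - x'"] by (simp add: K_def r_def)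
      also have "1 / r \<le> (s / 2) / (r * r) + 1 / (2 * s)"
      proof -
        have "0 \<le> (s / r - 1)\<^sup>2 / (2 * s)" using s by simp
        also have "\<dots> = (s / 2) / (r * r) + 1 / (2 * s) - 1 / r"
          using r s by (simp add: power2_eq_square field_simps)
        finally show ?thesis by simp
      qed
      then have "K * (1 / r) \<le> K * ((s / 2) / (r * r) + 1 / (2 * s))" using K by (intro mult_left_mono)
      finally show ?thesis unfolding r(2) by (simp add: distrib_left)
    qed
    then have "\<bar>\<Sum>n. pois t n * (kpow n g x - kpow n g x')\<bar> \<le> (K * s / 2) / t + K / (2 * s)"
      using K s t by (intro pois_average_le) auto
    also have "\<dots> = K / s" using s by (simp add: field_simps)
    also have "(\<Sum>n. pois t n * (kpow n g x - kpow n g x')) = flow g x t - flow g x' t"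
      unfolding flow_pois[OF g] right_diff_distrib
      by (intro suminf_diff[symmetric] summable_pois[OF kpow_le[OF g]])
    finally show ?thesis by (simp add: K_def s_def)
  qed
  then show ?thesis using that C by blast
qed

text \<open>The time derivative of the flow is the Poisson average of
  \<open>J^(n+1) g - J^n g\<close>, hence \<open>O(1/s)\<close> at time \<open>s\<close>; the mean
  value theorem does the rest.\<close>

lemma flow_time:
  obtains C where "0 < C"
    "\<And>D g x t t'. bdd_borel D g \<Longrightarrow> 0 < t \<Longrightarrow> t \<le> t' \<Longrightarrow> \<bar>flow g x t' - flow g x t\<bar> \<le> C * D * (t' - t) / t"
proof -
  obtain C where C: "0 < C"
    and td: "\<And>D g n x. bdd_borel D g \<Longrightarrow> \<bar>kpow (Suc n) g x - kpow n g x\<bar> \<le> C * D / (real n + 1)"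
    using time_difference by metis
  have "\<bar>flow g x t' - flow g x t\<bar> \<le> C * D * (t' - t) / t"
    if g: "bdd_borel D g" and t: "0 < t" "t \<le> t'" for D g x t t'
  proof -
    have D: "0 \<le> D" using bdd_borelD(5)[OF g] .
    have kg: "bdd_borel D (kop J g)" using bdd_kpow[OF g, of 1] by (simp add: kpow_Suc)
    have der: "\<bar>flow (kop J g) x s - flow g x s\<bar> \<le> C * D / t" if s: "t \<le> s" for s
    proof -
      have "\<bar>\<Sum>n. pois s n * (kpow (Suc n) g x - kpow n g x)\<bar> \<le> C * D / s + 0"
        using td[OF g] C D s t by (intro pois_average_le) auto
      also have "(\<Sum>n. pois s n * (kpow (Suc n) g x - kpow n g x)) = flow (kop J g) x s - flow g x s"
        unfolding flow_pois[OF g] flow_pois[OF kg] right_diff_distrib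
        using kpow_add[of _ 1 g] summable_pois[OF kpow_le[OF g]] summable_pois[OF kpow_le[OF kg]]
        by (subst suminf_diff) (auto simp: kpow_Suc)
      also have "C * D / s + 0 \<le> C * D / t" using C D s t by (auto intro: divide_left_mono)
      finally show ?thesis .
    qed
    show ?thesis
    proof (cases "t = t'")
      case False
      then have "t < t'" using t by simp
      then obtain s where "t < s" "s < t'" "flow g x t' - flow g x t = (t' - t) * (flow (kop J g) x s - flow g x s)"
        using MVT2[of t t' "flow g x" "\<lambda>s. flow (kop J g) x s - flow g x s"] flow_deriv[OF g] by metis
      then show ?thesis using mult_left_mono[OF der[of s], of "t' - t"] t by (simp add: abs_mult mult_ac)
    qed simp
  qed
  then show ?thesis using that C by blast
qed

text \<open>The term \<open>n = 0\<close> is \<open>v\<close> itself and decays only through its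
  weight \<open>exp (- t)\<close>. It is paid for in sup norm, all other terms in mass.\<close>

lemma flow_smoothing:
  obtains C where "0 < C"
    "\<And>D v x t. bdd_borel D v \<Longrightarrow> (\<And>x. 0 \<le> v x) \<Longrightarrow> integrable lborel v \<Longrightarrow> 0 < t \<Longrightarrow>
       flow v x t \<le> exp (- t) * D + C / sqrt t ^ DIM('a) * (LINT x|lborel. v x)"
proof -
  let ?N = "DIM('a)"
  obtain C where C: "0 < C"
    and dec: "\<And>D v n x. bdd_borel D v \<Longrightarrow> (\<And>x. 0 \<le> v x) \<Longrightarrow> integrable lborel v \<Longrightarrow> 1 \<le> n \<Longrightarrow>
       kpow n v x \<le> C / sqrt (real n) ^ ?N * (LINT x|lborel. v x)"
    using kpow_on_diagonal_decay by metis
  define K where "K = real (?N + 1) ^ ?N + 1"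
  have K: "0 < K" by (simp add: K_def add_nonneg_pos)
  have "flow v x t \<le> exp (- t) * D + C * K / sqrt t ^ ?N * (LINT x|lborel. v x)"
    if v: "bdd_borel D v" "\<And>x. 0 \<le> v x" "integrable lborel v" and t: "0 < t" for D v x t
  proof -
    define I where "I = (LINT x|lborel. v x)"
    have I: "0 \<le> I" unfolding I_def using v by (intro integral_nonneg_AE) auto
    have s: "summable (\<lambda>n. pois t n * kpow n v x)" by (rule summable_pois[OF kpow_le[OF v(1)]])
    then have s': "summable (\<lambda>n. pois t (Suc n) * kpow (Suc n) v x)"
      using summable_Suc_iff[of "\<lambda>n. pois t n * kpow n v x"] by simp
    have le: "pois t (Suc n) * kpow (Suc n) v x \<le> (C * I) * (pois t (Suc n) / sqrt (real (Suc n)) ^ ?N)" for n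
      using mult_left_mono[OF dec[OF v, of "Suc n" x] pois_nonneg[of t "Suc n"]] t
      by (simp add: I_def mult_ac del: of_nat_Suc)
    have "(\<Sum>n. pois t (Suc n) * kpow (Suc n) v x) \<le> (\<Sum>n. (C * I) * (pois t (Suc n) / sqrt (real (Suc n)) ^ ?N))"
      by (intro suminf_le le s' summable_mult pois_sqrt_power_moment t)
    also have "\<dots> = (C * I) * (\<Sum>n. pois t (Suc n) / sqrt (real (Suc n)) ^ ?N)"
      by (intro suminf_mult pois_sqrt_power_moment t)
    also have "\<dots> \<le> (C * I) * (K / sqrt t ^ ?N)"
      unfolding K_def using C I by (intro mult_left_mono pois_sqrt_power_moment t) auto
    finally have "(\<Sum>n. pois t (Suc n) * kpow (Suc n) v x) \<le> C * K / sqrt t ^ ?N * I" by (simp add: mult_ac)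
    moreover have "pois t 0 * kpow 0 v x \<le> exp (- t) * D"
      using bdd_borelD(3)[OF v(1)] by (simp add: pois_def)
    moreover have "flow v x t = (\<Sum>n. pois t (Suc n) * kpow (Suc n) v x) + pois t 0 * kpow 0 v x"
      unfolding flow_pois[OF v(1)] using suminf_split_head[OF s] by simp
    ultimately show ?thesis by (simp add: I_def)
  qed
  moreover have "0 < C * K" using C K by simp
  ultimately show ?thesis using that by blast
qed

lemma flow_diff:
  assumes g: "bdd_borel C g" and h: "bdd_borel D h"
  shows "flow (\<lambda>x. g x - h x) x t = flow g x t - flow h x t"
  unfolding flow_pois[OF bdd_borel_diff[OF g h]] flow_pois[OF g] flow_pois[OF h] kpow_diff[OF g h] right_diff_distrib
  by (intro suminf_diff[symmetric] summable_pois[OF kpow_le[OF g]] summable_pois[OF kpow_le[OF h]])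

end

section \<open>The smooth part of the fundamental solution\<close>

lemma conv_eq_kop:
  assumes [measurable]: "k \<in> borel_measurable borel" "g \<in> borel_measurable borel"
  shows "conv k g x = kop k g x"
  unfolding conv_def kop_flip[OF assms] by (intro integral_completion) simp

text \<open>One Picard step for a one-sided differential inequality. The mean value theorem stands
  in for the integral of \<open>f'\<close>, about which neither measurability nor integrability is
  assumed. It drives both the series of \<open>W\<close> and the comparison for
  \<open>u\<close>.\<close>

lemma derivative_power_bound:
  fixes f f' :: "real \<Rightarrow> real"
  assumes cont: "continuous_on {0..T} f"
    and der: "\<And>t. 0 < t \<Longrightarrow> t < T \<Longrightarrow> (f has_real_derivative f' t) (at t)"
    and le: "\<And>t. 0 < t \<Longrightarrow> t < T \<Longrightarrow> f' t \<le> M * (t ^ m / fact m)"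
    and f0: "f 0 \<le> 0" and t: "0 \<le> t" "t \<le> T"
  shows "f t \<le> M * (t ^ Suc m / fact (Suc m))"
proof (cases "t = 0")
  case True then show ?thesis using f0 by simp
next
  case False
  define g where "g s = f s - M * (s ^ Suc m / fact (Suc m))" for s
  have g': "(g has_real_derivative f' s - M * (s ^ m / fact m)) (at s)" if "0 < s" "s < T" for s
  proof -
    have "((\<lambda>s. M * (s ^ Suc m / fact (Suc m))) has_real_derivative M * (real (Suc m) * s ^ m / fact (Suc m))) (at s)"
      by (rule derivative_eq_intros refl | simp)+
    moreover have "M * (real (Suc m) * s ^ m / fact (Suc m)) = M * (s ^ m / fact m)"
      by (simp del: of_nat_Suc)
    ultimately show ?thesis unfolding g_def[abs_def] using der[OF that] by (auto intro: DERIV_diff)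
  qed
  have "continuous_on {0..t} g"
    unfolding g_def by (intro continuous_intros continuous_on_subset[OF cont]) (use t in auto)
  moreover have "g differentiable (at s)" if "0 < s" "s < t" for s
    using g'[of s] that t real_differentiable_def by force
  ultimately obtain l z where z: "0 < z" "z < t" "(g has_real_derivative l) (at z)" "g t - g 0 = (t - 0) * l"
    using MVT[of 0 t g] False t by auto
  have "l = f' z - M * (z ^ m / fact m)"
    using DERIV_unique[OF z(3) g'] z t by auto
  then have "l \<le> 0" using le[of z] z t by simp
  then have "t * l \<le> 0" using t by (simp add: mult_nonneg_nonpos)
  then have "g t \<le> g 0" using z(4) by simp
  then show ?thesis using f0 by (simp add: g_def)
qed

lemma kop_assoc:
  fixes k K g :: "'a::euclidean_space \<Rightarrow> real"
  assumes k: "integrable lborel k" and K: "integrable lborel K" and g: "bdd_borel C g"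
  shows "kop (kop k K) g x = kop k (kop K g) x"
proof -
  have [measurable]: "k \<in> borel_measurable borel" "K \<in> borel_measurable borel" "g \<in> borel_measurable borel"
    using k K g by (auto simp: bdd_borel_def)
  let ?f = "\<lambda>(y, z). k y * K (z - y) * g (x - z)"
  have "integrable (lborel \<Otimes>\<^sub>M lborel) (\<lambda>p. C * norm (case p of (y, z) \<Rightarrow> k y * K (z - y)))"
    by (intro integrable_mult_right integrable_norm kop_pair_integrable k K)
  then have f: "integrable (lborel \<Otimes>\<^sub>M lborel) ?f"
  proof (rule Bochner_Integration.integrable_bound)
    show "?f \<in> borel_measurable (lborel \<Otimes>\<^sub>M lborel)" by measurable
    have "norm (?f (y, z)) \<le> norm (C * norm (k y * K (z - y)))" for y z
      using mult_left_mono[OF bdd_borelD(2)[OF g, of "x - z"], of "\<bar>k y * K (z - y)\<bar>"] bdd_borelD(5)[OF g]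
      by (simp add: abs_mult mult_ac)
    then show "AE p in lborel \<Otimes>\<^sub>M lborel. norm (?f p) \<le> norm (C * norm (case p of (y, z) \<Rightarrow> k y * K (z - y)))"
      by auto
  qed
  have "kop (kop k K) g x = (LINT z|lborel. LINT y|lborel. k y * K (z - y) * g (x - z))"
    by (simp add: kop_def)
  also have "\<dots> = (LINT y|lborel. LINT z|lborel. k y * K (z - y) * g (x - z))"
    using lborel_pair.Fubini_integral[OF f] by simp
  also have "\<dots> = kop k (kop K g) x"
  proof -
    have "(LINT z|lborel. k y * K (z - y) * g (x - z)) = k y * kop K g (x - y)" for y
      using lborel_integral_translate(2)[of "\<lambda>z. K z * g (x - y - z)" y]
      by (simp add: kop_def mult.assoc algebra_simps)
    then show ?thesis by (simp add: kop_def[of k])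
  qed
  finally show ?thesis .
qed

context jump_kernel
begin

lemma integrable_kpow_J: "integrable lborel (kpow n J)"
  by (rule kpow_L1(1)[OF J_integrable])

lemma integral_kpow_J: "(LINT x|lborel. kpow n J x) = 1"
  using kpow_L1(2)[OF J_integrable] J_integral by simp

text \<open>\<open>kpow n J\<close> is the convolution power of \<open>J\<close> with
  \<open>n + 1\<close> factors, hence the shift of the index.\<close>

lemma kop_kpow_J:
  assumes g: "bdd_borel D g"
  shows "kop (kpow n J) g x = kpow (Suc n) g x"
proof (induction n arbitrary: x)
  case 0 then show ?case by (simp add: kpow_Suc)
next
  case (Suc n)
  have "kop (kpow (Suc n) J) g x = kop J (kop (kpow n J) g) x"
    unfolding kpow_Suc by (rule kop_assoc[OF J_integrable integrable_kpow_J g])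
  also have "kop (kpow n J) g = kpow (Suc n) g" using Suc.IH by (simp add: fun_eq_iff)
  finally show ?case by (simp add: kpow_Suc)
qed

lemma bdd_borel_J: obtains B where "bdd_borel B J"
proof -
  obtain B where "0 < B" "\<And>x. J x \<le> B" using J_bounded by metis
  then have "bdd_borel B J" using J_nonneg by (auto simp: bdd_borel_def)
  then show ?thesis using that by blast
qed

lemma kop_sum:
  assumes "\<And>n. n \<in> I \<Longrightarrow> bdd_borel (C n) (g n)"
  shows "kop J (\<lambda>y. \<Sum>n\<in>I. c n * g n y) x = (\<Sum>n\<in>I. c n * kop J (g n) x)"
proof -
  have "kop J (\<lambda>y. \<Sum>n\<in>I. c n * g n y) x = (LINT y|lborel. (\<Sum>n\<in>I. c n * (J y * g n (x - y))))"
    unfolding kop_def by (simp add: sum_distrib_left mult_ac)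
  also have "\<dots> = (\<Sum>n\<in>I. LINT y|lborel. c n * (J y * g n (x - y)))"
    by (intro Bochner_Integration.integral_sum integrable_mult_right kop_integrable[OF J_integrable assms])
  finally show ?thesis by (simp add: kop_def)
qed

lemma bdd_borel_sum:
  assumes "\<And>n. n \<in> I \<Longrightarrow> bdd_borel (C n) (g n)"
  shows "bdd_borel (\<Sum>n\<in>I. \<bar>c n\<bar> * C n) (\<lambda>y. \<Sum>n\<in>I. c n * g n y)"
proof -
  have "(\<lambda>y. \<Sum>n\<in>I. c n * g n y) \<in> borel_measurable borel"
    using bdd_borelD(1)[OF assms] by (intro borel_measurable_sum borel_measurable_times) auto
  moreover have "\<bar>\<Sum>n\<in>I. c n * g n y\<bar> \<le> (\<Sum>n\<in>I. \<bar>c n\<bar> * C n)" for y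
    using bdd_borelD(2)[OF assms]
    by (intro order_trans[OF sum_abs] sum_mono) (auto simp: abs_mult intro!: mult_left_mono)
  ultimately show ?thesis by (auto simp: bdd_borel_def)
qed

end

locale heat_kernel = jump_kernel J for J :: "'a::euclidean_space \<Rightarrow> real" +
  fixes W :: "'a \<Rightarrow> real \<Rightarrow> real"
  assumes W_continuous_space: "0 \<le> t \<Longrightarrow> continuous_on UNIV (\<lambda>x. W x t)"
    and W_continuous_time: "continuous_on {0..} (W x)"
    and W_bounded: "\<exists>M. \<forall>x. \<forall>t\<in>{0..T}. \<bar>W x t\<bar> \<le> M"
    and W_initial: "W x 0 = 0"
    and W_deriv: "0 < t \<Longrightarrow>
      (W x has_real_derivative kop J (\<lambda>y. W y t) x - W x t + exp (- t) * J x) (at t)"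
begin

lemma W_measurable: "0 \<le> t \<Longrightarrow> (\<lambda>x. W x t) \<in> borel_measurable borel"
  using W_continuous_space by (rule borel_measurable_continuous_onI)

text \<open>Duhamel's formula, iterated \<open>m\<close> times; the remainder is an \<open>m\<close>-fold time integral.\<close>

lemma W_truncation:
  assumes M: "\<And>x t. 0 \<le> t \<Longrightarrow> t \<le> T \<Longrightarrow> \<bar>exp t * W x t\<bar> \<le> M"
  shows "0 \<le> t \<Longrightarrow> t \<le> T \<Longrightarrow>
    \<bar>exp t * W x t - (\<Sum>n<m. t ^ Suc n / fact (Suc n) * kpow n J x)\<bar> \<le> M * (t ^ m / fact m)"
proof (induction m arbitrary: x t)
  case 0 then show ?case using M by simp
next
  case (Suc m)
  define S where "S m x t = (\<Sum>n<m. t ^ Suc n / fact (Suc n) * kpow n J x)" for m x and t :: real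
  \<comment> \<open>Multiplied by \<open>exp t\<close>, the equation becomes
    \<open>w_t = J * w + J\<close>. The error \<open>d\<close> after \<open>m + 1\<close> terms
    therefore has as derivative \<open>J\<close> convolved with the error after \<open>m\<close>
    terms, which is \<open>d'\<close>.\<close>
  define d where "d x t = exp t * W x t - S (Suc m) x t" for x and t :: real
  define d' where "d' x t = kop J (\<lambda>y. exp t * W y t - S m y t) x" for x and t :: real
  obtain B where B: "bdd_borel B J" using bdd_borel_J by blast
  have Wb: "bdd_borel M (\<lambda>y. exp t * W y t)" if "0 \<le> t" "t \<le> T" for t
    using M[OF that] W_measurable[OF that(1)] by (auto simp: bdd_borel_def)
  have Sb: "bdd_borel (\<Sum>n<m. \<bar>t ^ Suc n / fact (Suc n)\<bar> * B) (\<lambda>y. S m y t)" for t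
    unfolding S_def by (intro bdd_borel_sum bdd_kpow B)
  have S': "((\<lambda>t. S (Suc m) x t) has_real_derivative J x + kop J (\<lambda>y. S m y t) x) (at t)" for x t
  proof -
    have "((\<lambda>t. S (Suc m) x t) has_real_derivative (\<Sum>n<Suc m. t ^ n / fact n * kpow n J x)) (at t)"
      unfolding S_def
    proof (rule DERIV_sum)
      fix n
      have "((\<lambda>t. t ^ Suc n / fact (Suc n) * kpow n J x) has_real_derivative real (Suc n) * t ^ n / fact (Suc n) * kpow n J x) (at t)"
        by (rule derivative_eq_intros refl | simp)+
      moreover have "real (Suc n) * t ^ n / fact (Suc n) * kpow n J x = t ^ n / fact n * kpow n J x"
        by (simp del: of_nat_Suc)
      ultimately show "((\<lambda>t. t ^ Suc n / fact (Suc n) * kpow n J x) has_real_derivative t ^ n / fact n * kpow n J x) (at t)"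
        by simp
    qed
    moreover have "(\<Sum>n<Suc m. t ^ n / fact n * kpow n J x) = J x + kop J (\<lambda>y. S m y t) x"
      unfolding S_def kop_sum[OF bdd_kpow[OF B]] by (subst sum.lessThan_Suc_shift) (simp add: kpow_Suc)
    ultimately show ?thesis by simp
  qed
  have der: "((\<lambda>t. d x t) has_real_derivative d' x t) (at t)" if t: "0 < t" "t < T" for x t
  proof -
    have "((\<lambda>t. exp t * W x t) has_real_derivative
        exp t * W x t + (kop J (\<lambda>y. W y t) x - W x t + exp (- t) * J x) * exp t) (at t)"
      by (rule derivative_eq_intros W_deriv[OF t(1)] refl | simp)+
    moreover have "exp t * W x t + (kop J (\<lambda>y. W y t) x - W x t + exp (- t) * J x) * exp t
        = kop J (\<lambda>y. exp t * W y t) x + J x"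
    proof -
      have "kop J (\<lambda>y. exp t * W y t) x = exp t * kop J (\<lambda>y. W y t) x"
        unfolding kop_def by (simp only: mult.left_commute[of "J _"] integral_mult_right_zero)
      then show ?thesis by (simp add: algebra_simps exp_minus)
    qed
    ultimately have "((\<lambda>t. d x t) has_real_derivative (kop J (\<lambda>y. exp t * W y t) x + J x) - (J x + kop J (\<lambda>y. S m y t) x)) (at t)"
      unfolding d_def by (intro DERIV_diff S') simp
    moreover have "d' x t = kop J (\<lambda>y. exp t * W y t) x - kop J (\<lambda>y. S m y t) x"
      unfolding d'_def using t by (intro kop_diff[OF J_integrable Wb Sb]) auto
    ultimately show ?thesis by simp
  qed
  have bnd: "\<bar>d' x t\<bar> \<le> M * (t ^ m / fact m)" if t: "0 < t" "t < T" for x t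
  proof -
    have "bdd_borel (M * (t ^ m / fact m)) (\<lambda>y. exp t * W y t - S m y t)"
      using Suc.IH[of t] t bdd_borelD(1)[OF bdd_borel_diff[OF Wb Sb]] unfolding S_def by (auto simp: bdd_borel_def)
    from bdd_borelD(2)[OF bdd_borel_kop[OF J_integrable J_nonneg this]] show ?thesis
      unfolding d'_def J_integral by simp
  qed
  have cont: "continuous_on {0..T} (\<lambda>t. d x t)" for x
    unfolding d_def S_def
    by (intro continuous_intros continuous_on_subset[OF W_continuous_time]) auto
  have d0: "d x 0 = 0" for x by (simp add: d_def S_def W_initial)
  have "d x t \<le> M * (t ^ Suc m / fact (Suc m))"
    using bnd d0 Suc.prems by (intro derivative_power_bound[OF cont der]) (auto simp: abs_le_iff)
  moreover have "- d x t \<le> M * (t ^ Suc m / fact (Suc m))"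
    using bnd d0 Suc.prems cont[of x]
    by (intro derivative_power_bound[where f = "\<lambda>t. - d x t" and f' = "\<lambda>t. - d' x t"] continuous_on_minus cont DERIV_minus der)
      (auto simp: abs_le_iff)
  ultimately show ?case unfolding d_def S_def by simp
qed

lemma minus_exp_cancel: "exp (- t) * (exp t * r) = (r::real)"
  by (simp add: mult.assoc[symmetric] exp_minus)

text \<open>The remainder \<open>M * t^m / m!\<close>, up to a constant factor, vanishes as
  \<open>m\<close> grows. So boundedness on strips leaves the Poisson series without its zeroth term
  as the only candidate for \<open>W\<close>.\<close>

lemma W_sums:
  assumes t: "0 \<le> t"
  shows "(\<lambda>n. pois t (Suc n) * kpow n J x) sums W x t"
proof -
  obtain M where M: "\<And>x s. 0 \<le> s \<Longrightarrow> s \<le> t \<Longrightarrow> \<bar>W x s\<bar> \<le> M"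
    using W_bounded[of t] by (meson atLeastAtMost_iff)
  have M0: "0 \<le> M" using M[of t x] t by simp
  have M': "\<bar>exp s * W x s\<bar> \<le> exp t * M" if "0 \<le> s" "s \<le> t" for x s
    using M[OF that, of x] that M0 by (simp add: abs_mult) (intro mult_mono, auto)
  have lim0: "(\<lambda>m. exp t * M * (t ^ m / fact m)) \<longlonglongrightarrow> 0"
    using tendsto_mult_left[OF summable_LIMSEQ_zero[OF sums_summable[OF exp_series_sums[of t]]], of "exp t * M"] by simp
  have "(\<lambda>m. exp t * W x t - (\<Sum>n<m. t ^ Suc n / fact (Suc n) * kpow n J x)) \<longlonglongrightarrow> 0"
    by (rule Lim_null_comparison[OF always_eventually lim0])
      (use W_truncation[where T = t and M = "exp t * M" and t = t and x = x, OF M'] t in auto)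
  then have "(\<lambda>m. exp t * W x t - (exp t * W x t - (\<Sum>n<m. t ^ Suc n / fact (Suc n) * kpow n J x))) \<longlonglongrightarrow> exp t * W x t - 0"
    by (intro tendsto_diff tendsto_const)
  then have "(\<lambda>n. t ^ Suc n / fact (Suc n) * kpow n J x) sums (exp t * W x t)"
    by (simp add: sums_def)
  from sums_mult[OF this, of "exp (- t)"] show ?thesis
    by (simp add: pois_def mult.assoc minus_exp_cancel del: fact_Suc)
qed

lemma kpow_J_nonneg: "0 \<le> kpow n J x"
proof -
  obtain B where B: "bdd_borel B J" using bdd_borel_J by blast
  show ?thesis by (rule kpow_nonneg[OF B J_nonneg])
qed

lemma W_nonneg: assumes t: "0 \<le> t" shows "0 \<le> W x t"
  using sums_le[OF _ sums_zero W_sums[OF t]] kpow_J_nonneg pois_nonneg[OF t] by simp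

text \<open>As a power series in \<open>t\<close>, \<open>exp t * W x t\<close> has nonnegative
  coefficients. Its value at a final time thus dominates \<open>W\<close> on the whole time
  interval, which supplies an integrable majorant for limits in time.\<close>

lemma W_exp_mono:
  assumes s: "0 \<le> s" "s \<le> t"
  shows "exp s * W x s \<le> exp t * W x t"
proof (rule sums_le[OF _ sums_mult[OF W_sums] sums_mult[OF W_sums]])
  fix n
  have "exp s * pois s (Suc n) = s ^ Suc n / fact (Suc n)" "exp t * pois t (Suc n) = t ^ Suc n / fact (Suc n)"
    by (simp_all only: pois_def mult.assoc[symmetric] exp_minus_inverse mult_1)
  moreover have "s ^ Suc n / fact (Suc n) \<le> t ^ Suc n / (fact (Suc n) :: real)"
    using s by (intro divide_right_mono power_mono) auto
  ultimately have "exp s * pois s (Suc n) \<le> exp t * pois t (Suc n)" by simp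
  then show "exp s * (pois s (Suc n) * kpow n J x) \<le> exp t * (pois t (Suc n) * kpow n J x)"
    unfolding mult.assoc[symmetric] by (rule mult_right_mono[OF _ kpow_J_nonneg])
qed (use s in auto)

lemma pois_Suc_summable: "summable (\<lambda>n. pois t (Suc n))"
  using pois_sums[of t] by (subst summable_Suc_iff) (auto simp: sums_iff)

lemma W_integrable:
  assumes t: "0 \<le> t"
  shows "integrable lborel (\<lambda>x. W x t)"
proof -
  have eq: "(\<lambda>x. W x t) = (\<lambda>x. \<Sum>n. pois t (Suc n) * kpow n J x)"
    using sums_unique[OF W_sums[OF t]] by (simp add: fun_eq_iff)
  have nn: "norm (pois t (Suc n) * kpow n J x) = pois t (Suc n) * kpow n J x" for n x
    using kpow_J_nonneg pois_nonneg[OF t] by (simp add: abs_mult)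
  show ?thesis unfolding eq
  proof (rule integrable_suminf)
    show "integrable lborel (\<lambda>x. pois t (Suc n) * kpow n J x)" for n
      using integrable_kpow_J by simp
    show "AE x in lborel. summable (\<lambda>n. norm (pois t (Suc n) * kpow n J x))"
      unfolding nn using W_sums[OF t] by (auto simp: sums_iff)
    show "summable (\<lambda>n. LINT x|lborel. norm (pois t (Suc n) * kpow n J x))"
      unfolding nn using pois_Suc_summable by (simp add: integral_kpow_J)
  qed
qed

text \<open>Makes the estimates on iterates available for \<open>W\<close>: convolution with
  \<open>W\<close> is the flow without its unsmoothed zeroth term. Sum and integral are exchanged
  under the majorant \<open>D * pois t (Suc n) * kpow n J y\<close>.\<close>

lemma kop_W:
  assumes t: "0 \<le> t" and g: "bdd_borel D g"
  shows "kop (\<lambda>x. W x t) g x = flow g x t - exp (- t) * g x"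
proof -
  let ?f = "\<lambda>n y. pois t (Suc n) * (kpow n J y * g (x - y))"
  have D: "0 \<le> D" using bdd_borelD(5)[OF g] .
  have nn: "norm (?f n y) \<le> D * (pois t (Suc n) * kpow n J y)" for n y
    using mult_left_mono[OF bdd_borelD(2)[OF g, of "x - y"], of "pois t (Suc n) * kpow n J y"] kpow_J_nonneg[of n y] pois_nonneg[OF t, of "Suc n"]
    by (simp add: abs_mult mult_ac)
  have fi: "integrable lborel (?f n)" for n
    by (intro integrable_mult_right kop_integrable[OF integrable_kpow_J g])
  have A: "(\<lambda>n. LINT y|lborel. ?f n y) sums (LINT y|lborel. (\<Sum>n. ?f n y))"
  proof (rule sums_integral[OF fi])
    show "AE y in lborel. summable (\<lambda>n. norm (?f n y))"
    proof (intro AE_I2)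
      fix y
      have "summable (\<lambda>n. D * (pois t (Suc n) * kpow n J y))"
        using W_sums[OF t, of y] by (intro summable_mult) (auto simp: sums_iff)
      then show "summable (\<lambda>n. norm (?f n y))"
        by (rule summable_comparison_test'[where N = 0]) (use nn in auto)
    qed
    have "summable (\<lambda>n. D * pois t (Suc n))" by (intro summable_mult pois_Suc_summable)
    then show "summable (\<lambda>n. LINT y|lborel. norm (?f n y))"
    proof (rule summable_comparison_test'[where N = 0])
      fix n
      have "(LINT y|lborel. norm (?f n y)) \<le> (LINT y|lborel. D * (pois t (Suc n) * kpow n J y))"
        using integrable_kpow_J by (intro integral_mono nn integrable_norm fi) auto
      then show "norm (LINT y|lborel. norm (?f n y)) \<le> D * pois t (Suc n)"
        by (simp add: integral_kpow_J)
    qed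
  qed
  have B1: "(\<Sum>n. ?f n y) = W y t * g (x - y)" for y
    using sums_unique[OF sums_mult2[OF W_sums[OF t, of y], of "g (x - y)"]] by (simp add: mult.assoc)
  have B2: "(LINT y|lborel. ?f n y) = pois t (Suc n) * kpow (Suc n) g x" for n
    using kop_kpow_J[OF g, of n x] by (simp add: kop_def)
  have "(\<lambda>n. pois t (Suc n) * kpow (Suc n) g x) sums kop (\<lambda>x. W x t) g x"
    using A unfolding B1 B2 kop_def .
  then have "kop (\<lambda>x. W x t) g x = (\<Sum>n. pois t (Suc n) * kpow (Suc n) g x)" by (rule sums_unique)
  also have "\<dots> = flow g x t - pois t 0 * kpow 0 g x"
  proof -
    have "summable (\<lambda>n. pois t n * kpow n g x)" by (rule summable_pois) (rule kpow_le[OF g])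
    from suminf_split_head[OF this] show ?thesis unfolding flow_pois[OF g] by simp
  qed
  finally show ?thesis by (simp add: pois_def)
qed

end

section \<open>Comparison with the linear equation\<close>

context jump_kernel
begin

lemma conv_J_integrable:
  assumes "U \<in> borel_measurable lebesgue" "AE x in lebesgue. \<bar>U x\<bar> \<le> M"
  shows "integrable lebesgue (\<lambda>y. J (x - y) * U y)"
proof -
  have i: "integrable lborel (\<lambda>y. J (x - y) * \<bar>M\<bar>)"
    using lborel_integrable_reflect(1)[OF J_integrable] by simp
  have m: "(\<lambda>y. J (x - y)) \<in> borel_measurable lebesgue"
    by (rule measurable_completion) simp
  have "integrable lebesgue (\<lambda>y. J (x - y) * \<bar>M\<bar>)"
    using i by (subst integrable_completion) auto
  then show ?thesis
  proof (rule Bochner_Integration.integrable_bound)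
    show "(\<lambda>y. J (x - y) * U y) \<in> borel_measurable lebesgue"
      using m assms(1) by (rule borel_measurable_times)
    show "AE y in lebesgue. norm (J (x - y) * U y) \<le> norm (J (x - y) * \<bar>M\<bar>)"
      using assms(2)
    proof eventually_elim
      case (elim y)
      then have "\<bar>U y\<bar> \<le> \<bar>M\<bar>" by linarith
      then show ?case using mult_left_mono[of "\<bar>U y\<bar>" "\<bar>M\<bar>" "J (x - y)"] J_nonneg by (simp add: abs_mult)
    qed
  qed
qed

text \<open>The differential inequality is iterated from the crude bound \<open>M\<close>: after
  \<open>m\<close> rounds \<open>exp t * U\<close> lies below a partial sum of \<open>egf v\<close>
  plus \<open>exp T * M * t^m / m!\<close>. Convolution with \<open>J\<close> does not see null
  sets, so a bound valid almost everywhere improves at every \<open>x\<close> where the equation,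
  the continuity and the initial bound hold.\<close>

lemma subsolution_le_flow:
  fixes U :: "'a \<Rightarrow> real \<Rightarrow> real"
  assumes U: "\<And>t. 0 \<le> t \<Longrightarrow> (\<lambda>x. U x t) \<in> borel_measurable lebesgue"
    and U0: "AE x in lebesgue. \<forall>t\<ge>0. 0 \<le> U x t \<and> U x t \<le> M"
    and init: "AE x in lebesgue. U x 0 \<le> v x" and v: "bdd_borel D v"
    and cont: "AE x in lebesgue. continuous_on {0..} (U x)"
    and sub: "AE x in lebesgue. \<forall>t>0. \<exists>c\<ge>0. (U x has_real_derivative conv J (\<lambda>y. U y t) x - U x t - c) (at t)"
  shows "AE x in lebesgue. \<forall>t\<ge>0. U x t \<le> flow v x t"
proof -
  define S where "S m x t = (\<Sum>n<m. t ^ n / fact n * kpow n v x)" for m x and t :: real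
  have Sb: "bdd_borel (\<Sum>n<m. \<bar>t ^ n / fact n\<bar> * D) (\<lambda>y. S m y t)" for m t
    unfolding S_def by (intro bdd_borel_sum bdd_kpow v)
  have S': "((\<lambda>t. S (Suc m) x t) has_real_derivative kop J (\<lambda>y. S m y t) x) (at t)" for m x t
  proof -
    have "((\<lambda>t. S (Suc m) x t) has_real_derivative (\<Sum>n<Suc m. real n * t ^ (n - 1) / fact n * kpow n v x)) (at t)"
      unfolding S_def by (rule DERIV_sum) (rule derivative_eq_intros refl | simp)+
    moreover have "(\<Sum>n<Suc m. real n * t ^ (n - 1) / fact n * kpow n v x) = (\<Sum>n<m. t ^ n / fact n * kpow (Suc n) v x)"
      by (subst sum.lessThan_Suc_shift) (simp del: of_nat_Suc)
    ultimately show ?thesis unfolding S_def kop_sum[OF bdd_kpow[OF v]] by (simp add: kpow_Suc)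
  qed
  \<comment> \<open>One null set serves all \<open>t\<close> in the interval; the argument in time
    runs along a fixed \<open>x\<close> and needs this order of quantifiers.\<close>
  have step: "AE x in lebesgue. \<forall>t\<in>{0..T}. exp t * U x t \<le> S m x t + exp T * M * (t ^ m / fact m)" for m T
  proof (induction m)
    case 0
    show ?case using U0
    proof eventually_elim
      case (elim x)
      then have "exp t * U x t \<le> exp T * M" if "t \<in> {0..T}" for t
        using that by (intro mult_mono) auto
      then show ?case by (simp add: S_def)
    qed
  next
    case (Suc m)
    define R where "R t = exp T * M * (t ^ m / fact m)" for t :: real
    have le: "exp t * conv J (\<lambda>y. U y t) x \<le> kop J (\<lambda>y. S m y t) x + R t" if t: "0 < t" "t < T" for x t
    proof -
      have Sm [measurable]: "(\<lambda>y. S m y t) \<in> borel_measurable borel" using bdd_borelD(1)[OF Sb] .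
      have SR: "bdd_borel ((\<Sum>n<m. \<bar>t ^ n / fact n\<bar> * D) + \<bar>R t\<bar>) (\<lambda>y. S m y t - (- R t))"
        by (intro bdd_borel_diff Sb) (simp add: bdd_borel_def)
      have UM: "AE y in lebesgue. \<bar>U y t\<bar> \<le> M" using U0 t by (auto elim!: AE_mp)
      have "exp t * conv J (\<lambda>y. U y t) x = (LINT y|lebesgue. exp t * (J (x - y) * U y t))"
        by (simp add: conv_def)
      also have "\<dots> \<le> (LINT y|lebesgue. J (x - y) * (S m y t - (- R t)))"
      proof (rule integral_mono_AE)
        show "integrable lebesgue (\<lambda>y. exp t * (J (x - y) * U y t))"
          using t by (intro integrable_mult_right conv_J_integrable[OF U UM]) simp
        show "integrable lebesgue (\<lambda>y. J (x - y) * (S m y t - (- R t)))"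
          using SR by (intro conv_J_integrable[where M = "(\<Sum>n<m. \<bar>t ^ n / fact n\<bar> * D) + \<bar>R t\<bar>"])
            (auto simp: bdd_borel_def intro!: measurable_completion)
        show "AE y in lebesgue. exp t * (J (x - y) * U y t) \<le> J (x - y) * (S m y t - (- R t))"
          using Suc.IH
        proof eventually_elim
          case (elim y)
          then have "exp t * U y t \<le> S m y t - (- R t)" using t by (auto simp: R_def)
          from mult_left_mono[OF this J_nonneg[of "x - y"]] show ?case by (simp add: mult.left_commute)
        qed
      qed
      also have "\<dots> = kop J (\<lambda>y. S m y t - (- R t)) x"
        using conv_eq_kop[OF J_measurable, of "\<lambda>y. S m y t - (- R t)" x] by (simp add: conv_def)
      also have "\<dots> = kop J (\<lambda>y. S m y t) x - kop J (\<lambda>_. - R t) x"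
        by (rule kop_diff[OF J_integrable Sb, where D = "\<bar>R t\<bar>"]) (simp add: bdd_borel_def)
      finally show ?thesis by (simp add: kop_const J_integral)
    qed
    show ?case using init cont sub
    proof eventually_elim
      case (elim x)
      define d where "d t = exp t * U x t - S (Suc m) x t" for t
      obtain c where c: "\<And>t. 0 < t \<Longrightarrow> 0 \<le> c t"
        "\<And>t. 0 < t \<Longrightarrow> (U x has_real_derivative conv J (\<lambda>y. U y t) x - U x t - c t) (at t)"
        using elim(3) by metis
      define d' where "d' t = exp t * U x t + (conv J (\<lambda>y. U y t) x - U x t - c t) * exp t - kop J (\<lambda>y. S m y t) x" for t
      have der: "(d has_real_derivative d' t) (at t)" if "0 < t" "t < T" for t
      proof -
        have "((\<lambda>t. exp t * U x t) has_real_derivative exp t * U x t + (conv J (\<lambda>y. U y t) x - U x t - c t) * exp t) (at t)"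
          by (rule derivative_eq_intros c(2)[OF that(1)] refl | simp)+
        then show ?thesis unfolding d_def[abs_def] d'_def by (intro DERIV_diff S')
      qed
      have le': "d' t \<le> exp T * M * (t ^ m / fact m)" if "0 < t" "t < T" for t
      proof -
        have "d' t = exp t * conv J (\<lambda>y. U y t) x - exp t * c t - kop J (\<lambda>y. S m y t) x"
          by (simp add: d'_def algebra_simps)
        moreover have "0 \<le> exp t * c t" using c(1)[OF that(1)] by simp
        ultimately show ?thesis using le[OF that, of x] unfolding R_def by linarith
      qed
      have "continuous_on {0..T} d"
        unfolding d_def S_def by (intro continuous_intros continuous_on_subset[OF elim(2)]) auto
      moreover have "d 0 \<le> 0"
        using elim(1) unfolding d_def S_def by (subst sum.lessThan_Suc_shift) simp
      ultimately have "d t \<le> exp T * M * (t ^ Suc m / fact (Suc m))" if "t \<in> {0..T}" for t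
        using that by (intro derivative_power_bound[of T d d'] der le') auto
      then show ?case unfolding d_def by force
    qed
  qed
  \<comment> \<open>Integer values of \<open>T\<close> and of \<open>m\<close> keep the union of the
    exceptional sets null.\<close>
  have "AE x in lebesgue. \<forall>T m. \<forall>t\<in>{0..real T}. exp t * U x t \<le> S m x t + exp (real T) * M * (t ^ m / fact m)" (is "AE x in _. ?P x")
    unfolding AE_all_countable using step by blast
  then show ?thesis
  proof (rule AE_mp, intro AE_I2 impI allI)
    fix x and t :: real
    assume P: "?P x" and t: "0 \<le> t"
    obtain T where T: "t \<le> real T" using real_arch_simple by blast
    have lim0: "(\<lambda>m. exp (real T) * M * (t ^ m / fact m)) \<longlonglongrightarrow> 0"
      using tendsto_mult_left[OF summable_LIMSEQ_zero[OF sums_summable[OF exp_series_sums[of t]]], of "exp (real T) * M"] by simp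
    have "summable (\<lambda>n. kpow n v x / fact n * t ^ n)"
      by (rule summable_bounded_exp_series) (rule kpow_le[OF v])
    then have "(\<lambda>n. t ^ n / fact n * kpow n v x) sums egf v x t"
      unfolding egf_def by (simp add: sums_iff mult.commute)
    then have "(\<lambda>m. S m x t) \<longlonglongrightarrow> egf v x t" by (simp add: sums_def S_def)
    from tendsto_add[OF this lim0]
    have "(\<lambda>m. S m x t + exp (real T) * M * (t ^ m / fact m)) \<longlonglongrightarrow> egf v x t" by simp
    then have "exp t * U x t \<le> egf v x t"
      using P t T by (intro Lim_bounded2[where N = 0]) auto
    from mult_left_mono[OF this, of "exp (- t)"]
    show "U x t \<le> flow v x t" by (simp add: flow_def mult.assoc[symmetric] exp_minus)
  qed
qed

end

section \<open>Auxiliary facts on compactness and Lebesgue integrals\<close>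

text \<open>The classical proof survives when each \<open>\<delta>\<close> is valid only from some
  index on, since a uniform Cauchy condition concerns late indices. The bound may depend on the
  point and the modulus on the bounded region, so one diagonal subsequence serves all compact
  subsets at once.\<close>

lemma asymptotic_Arzela_Ascoli:
  fixes f :: "nat \<Rightarrow> 'b::euclidean_space \<Rightarrow> real"
  assumes bound: "\<And>n z. z \<in> S \<Longrightarrow> \<bar>f n z\<bar> \<le> H z"
    and equi: "\<And>\<rho> \<epsilon>. 0 < \<epsilon> \<Longrightarrow> \<exists>\<delta>>0. \<exists>n0. \<forall>n\<ge>n0. \<forall>z\<in>S. \<forall>z'\<in>S.
      norm z \<le> \<rho> \<and> norm z' \<le> \<rho> \<and> dist z z' < \<delta> \<longrightarrow> \<bar>f n z - f n z'\<bar> < \<epsilon>"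
  obtains r :: "nat \<Rightarrow> nat" where "strict_mono r"
    "\<And>K. compact K \<Longrightarrow> K \<subseteq> S \<Longrightarrow> uniformly_convergent_on K (\<lambda>n. f (r n))"
proof -
  obtain R where R: "countable R" "R \<subseteq> S" "S \<subseteq> closure R"
    using separable by metis
  \<comment> \<open>Normalisation by the pointwise bound: the selection on the countable dense set
    expects one common bound.\<close>
  define g where "g n z = f n z / (1 + \<bar>H z\<bar>)" for n z
  have pos: "0 < 1 + \<bar>H z\<bar>" for z by (simp add: add_pos_nonneg)
  have "norm (g n z) \<le> 1" if "z \<in> R" for n z
    using bound[of z n] that R(2) pos[of z] unfolding g_def by (simp add: abs_of_pos) (smt (verit) subsetD)
  then obtain r where r: "strict_mono (r :: nat \<Rightarrow> nat)" "\<And>z. z \<in> R \<Longrightarrow> \<exists>l. (\<lambda>n. g (r n) z) \<longlonglongrightarrow> l"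
    using function_convergent_subsequence[OF R(1), of g 1] by metis
  have conv: "Cauchy (\<lambda>n. f (r n) z)" if zR: "z \<in> R" for z
  proof -
    obtain l where "(\<lambda>n. g (r n) z) \<longlonglongrightarrow> l" using r(2)[OF zR] by blast
    then have "(\<lambda>n. (1 + \<bar>H z\<bar>) * g (r n) z) \<longlonglongrightarrow> (1 + \<bar>H z\<bar>) * l" by (intro tendsto_mult_left)
    then have "(\<lambda>n. f (r n) z) \<longlonglongrightarrow> (1 + \<bar>H z\<bar>) * l" using pos[of z] by (simp add: g_def)
    then show ?thesis by (intro LIMSEQ_imp_Cauchy)
  qed
  have "uniformly_convergent_on K (\<lambda>n. f (r n))" if K: "compact K" "K \<subseteq> S" for K
    unfolding uniformly_convergent_eq_Cauchy uniformly_Cauchy_on_def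
  proof (intro allI impI)
    fix e :: real assume e: "0 < e"
    obtain \<rho> where \<rho>: "\<And>z. z \<in> K \<Longrightarrow> norm z \<le> \<rho>"
      using compact_imp_bounded[OF K(1)] unfolding bounded_iff by blast
    \<comment> \<open>\<open>\<rho> + 1\<close> leaves room for centres from the dense set, which
      are close to \<open>K\<close> but need not lie in it.\<close>
    obtain \<delta>' n0 where \<delta>': "0 < \<delta>'" and n0: "\<And>n z z'. n \<ge> n0 \<Longrightarrow> z \<in> S \<Longrightarrow> z' \<in> S \<Longrightarrow>
        norm z \<le> \<rho> + 1 \<Longrightarrow> norm z' \<le> \<rho> + 1 \<Longrightarrow> dist z z' < \<delta>' \<Longrightarrow> \<bar>f n z - f n z'\<bar> < e / 3"
      using equi[of "e / 3" "\<rho> + 1"] e by (metis divide_pos_pos zero_less_numeral)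
    define \<delta> where "\<delta> = min \<delta>' 1"
    have \<delta>: "0 < \<delta>" "\<delta> \<le> \<delta>'" "\<delta> \<le> 1" using \<delta>' by (auto simp: \<delta>_def)
    have "K \<subseteq> (\<Union>c\<in>R. ball c \<delta>)"
    proof
      fix z assume "z \<in> K"
      then have "z \<in> closure R" using K R by auto
      then obtain c where "c \<in> R" "dist c z < \<delta>" using \<delta>(1) closure_approachable by blast
      then show "z \<in> (\<Union>c\<in>R. ball c \<delta>)" by auto
    qed
    then obtain T where T: "T \<subseteq> R" "finite T" "K \<subseteq> (\<Union>c\<in>T. ball c \<delta>)"
      using compactE_image[OF K(1), of R "\<lambda>c. ball c \<delta>"] by auto
    have "\<forall>c\<in>T. \<exists>M. \<forall>m\<ge>M. \<forall>n\<ge>M. dist (f (r m) c) (f (r n) c) < e / 3"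
      using conv T(1) e unfolding Cauchy_def by (meson divide_pos_pos subsetD zero_less_numeral)
    then obtain M where M: "\<And>c m n. c \<in> T \<Longrightarrow> M c \<le> m \<Longrightarrow> M c \<le> n \<Longrightarrow> dist (f (r m) c) (f (r n) c) < e / 3"
      by metis
    \<comment> \<open>The sum is an upper bound for the finitely many thresholds;
      \<open>r j \<ge> j\<close> carries \<open>n0\<close> over to the subsequence.\<close>
    define N where "N = n0 + (\<Sum>c\<in>T. M c)"
    have MN: "M c \<le> N" if "c \<in> T" for c
      using member_le_sum[OF that, of M] T(2) by (simp add: N_def)
    have "dist (f (r m) z) (f (r n) z) < e" if z: "z \<in> K" and mn: "N \<le> m" "N \<le> n" for z m n
    proof -
      obtain c where c: "c \<in> T" "dist c z < \<delta>" using T(3) z by auto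
      have "norm c \<le> norm z + dist c z" by (simp add: dist_norm norm_triangle_sub)
      then have nc: "norm c \<le> \<rho> + 1" "norm z \<le> \<rho> + 1" using \<rho>[OF z] c(2) \<delta> by linarith+
      have S: "c \<in> S" "z \<in> S" using c T R K z by auto
      have near: "\<bar>f (r j) c - f (r j) z\<bar> < e / 3" if "N \<le> j" for j
        using seq_suble[OF r(1), of j] that c(2) \<delta>(2) by (intro n0 S nc) (auto simp: N_def)
      have "dist (f (r m) c) (f (r n) c) < e / 3" using M[OF c(1)] MN[OF c(1)] mn by auto
      then show ?thesis using near[OF mn(1)] near[OF mn(2)] unfolding dist_real_def by linarith
    qed
    then show "\<exists>M. \<forall>x\<in>K. \<forall>m\<ge>M. \<forall>n\<ge>M. dist (f (r m) x) (f (r n) x) < e" by blast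
  qed
  then show ?thesis using that r(1) by blast
qed

section \<open>Borel versions and dilations of Lebesgue measurable functions\<close>

lemma bounded_borel_version:
  fixes g :: "'a::euclidean_space \<Rightarrow> real"
  assumes g: "g \<in> borel_measurable lebesgue" "AE x in lebesgue. 0 \<le> g x \<and> g x \<le> D" and D: "0 \<le> D"
  obtains g' where "bdd_borel D g'" "\<And>x. 0 \<le> g' x" "AE x in lebesgue. g x = g' x"
proof -
  obtain h where h: "h \<in> borel_measurable lborel" "AE x in lborel. g x = h x"
    using completion_ex_borel_measurable_real[OF g(1)] by blast
  \<comment> \<open>Clipping to \<open>[0, D]\<close> makes the bounds hold everywhere and changes
    the function on a null set only.\<close>
  have "bdd_borel D (\<lambda>x. max 0 (min D (h x)))"
    using h D by (auto simp: bdd_borel_def)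
  moreover have "AE x in lebesgue. g x = max 0 (min D (h x))"
    using g(2) AE_completion[OF h(2)] by eventually_elim auto
  ultimately show ?thesis using that by fastforce
qed

lemma borel_measurable_lebesgue: "k \<in> borel_measurable borel \<Longrightarrow> k \<in> borel_measurable lebesgue"
  by (rule measurable_completion) simp

lemma lebesgue_convolution_version:
  fixes k g g' :: "'a::euclidean_space \<Rightarrow> real"
  assumes k [measurable]: "k \<in> borel_measurable borel" and g: "g \<in> borel_measurable lebesgue"
    and g' [measurable]: "g' \<in> borel_measurable borel" and eq: "AE x in lebesgue. g x = g' x"
  shows "(LINT y|lebesgue. k (x - y) * g y) = kop k g' x"
proof -
  have "(LINT y|lebesgue. k (x - y) * g y) = (LINT y|lebesgue. k (x - y) * g' y)"
  proof (rule integral_cong_AE)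
    have k': "(\<lambda>y. k (x - y)) \<in> borel_measurable lebesgue" by (rule borel_measurable_lebesgue) simp
    show "(\<lambda>y. k (x - y) * g y) \<in> borel_measurable lebesgue" "(\<lambda>y. k (x - y) * g' y) \<in> borel_measurable lebesgue"
      by (intro borel_measurable_times k' g borel_measurable_lebesgue[OF g'])+
    show "AE y in lebesgue. k (x - y) * g y = k (x - y) * g' y" using eq by eventually_elim simp
  qed
  then show ?thesis using conv_eq_kop[OF k g', of x] by (simp add: conv_def)
qed

text \<open>The new exceptional set lies in the image of a null set under the inverse dilation, and
  differentiable maps of the space into itself preserve null sets.\<close>

lemma AE_lebesgue_scale:
  fixes P :: "'a::euclidean_space \<Rightarrow> bool"
  assumes P: "AE x in lebesgue. P x" and k: "k \<noteq> 0"
  shows "AE x in lebesgue. P (k *\<^sub>R x)"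
proof -
  obtain N where N: "negligible N" "{x. \<not> P x} \<subseteq> N" using P eventually_ae_filter_negligible by blast
  have "negligible ((\<lambda>x. (1 / k) *\<^sub>R x) ` N)"
    by (rule negligible_differentiable_image_negligible[OF order_refl N(1)])
      (auto intro!: derivative_intros linear_imp_differentiable_on linear_scale_self)
  moreover have "{x. \<not> P (k *\<^sub>R x)} \<subseteq> (\<lambda>x. (1 / k) *\<^sub>R x) ` N"
  proof
    fix x assume "x \<in> {x. \<not> P (k *\<^sub>R x)}"
    then have "k *\<^sub>R x \<in> N" using N(2) by auto
    then have "(1 / k) *\<^sub>R (k *\<^sub>R x) \<in> (\<lambda>x. (1 / k) *\<^sub>R x) ` N" by (rule imageI)
    then show "x \<in> (\<lambda>x. (1 / k) *\<^sub>R x) ` N" using k by simp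
  qed
  ultimately show ?thesis using eventually_ae_filter_negligible by blast
qed

lemma lebesgue_integral_scale:
  fixes f :: "'a::euclidean_space \<Rightarrow> real"
  assumes f: "f \<in> borel_measurable lebesgue" and k: "0 < k"
  shows "(LINT y|lebesgue. k ^ DIM('a) * f (k *\<^sub>R y)) = (LINT y|lebesgue. f y)"
proof -
  obtain h where h: "h \<in> borel_measurable borel" "AE x in lborel. f x = h x"
    using completion_ex_borel_measurable_real[OF f] by auto
  have fh: "AE x in lebesgue. f x = h x" by (rule AE_completion[OF h(2)])
  have [measurable]: "h \<in> borel_measurable borel" by (rule h)
  have m1: "(\<lambda>y. f (k *\<^sub>R y)) \<in> borel_measurable lebesgue"
    by (rule measurable_compose[OF lebesgue_measurable_scaling f])
  have m2: "(\<lambda>y. h (k *\<^sub>R y)) \<in> borel_measurable borel" by measurable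
  have "(LINT y|lebesgue. k ^ DIM('a) * f (k *\<^sub>R y)) = (LINT y|lebesgue. k ^ DIM('a) * h (k *\<^sub>R y))"
    using m1 borel_measurable_lebesgue[OF m2] AE_lebesgue_scale[OF fh, of k] k
    by (intro integral_cong_AE borel_measurable_times) auto
  also have "\<dots> = (LINT y|lborel. k ^ DIM('a) * h (k *\<^sub>R y))"
    by (intro integral_completion) simp
  also have "\<dots> = (LINT y|lborel. h y)"
    using lborel_integral_affine[OF h(1), of k 0] k by simp
  also have "\<dots> = (LINT y|lebesgue. h y)"
    by (intro integral_completion[symmetric]) simp
  also have "\<dots> = (LINT y|lebesgue. f y)"
    using fh f borel_measurable_lebesgue[OF h(1)] by (intro integral_cong_AE) auto
  finally show ?thesis .
qed

section \<open>Time integrals and exponential errors\<close>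

lemma set_lebesgue_integral_continuous:
  fixes f :: "real \<Rightarrow> real"
  assumes "continuous_on {a..b} f"
  shows "(LINT s:{a..b}|lebesgue. f s) = integral {a..b} f"
  by (rule set_lebesgue_integral_eq_integral(2)[OF absolutely_integrable_continuous_real[OF assms]])

lemma integral_bound_split:
  fixes f :: "real \<Rightarrow> real"
  assumes ab: "a \<le> b" and f: "continuous_on {a..b} f" and \<eta>: "0 \<le> \<eta>"
    and small: "\<And>s. a \<le> s \<Longrightarrow> s \<le> b - \<eta> \<Longrightarrow> \<bar>f s\<bar> \<le> E"
    and all: "\<And>s. a \<le> s \<Longrightarrow> s \<le> b \<Longrightarrow> \<bar>f s\<bar> \<le> D" and E: "0 \<le> E"
  shows "\<bar>integral {a..b} f\<bar> \<le> E * (b - a) + D * \<eta>"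
proof -
  \<comment> \<open>The maximum covers the case of \<open>\<eta>\<close> exceeding the length of the
    interval, where the trivial bound alone is used.\<close>
  define c where "c = max a (b - \<eta>)"
  have c: "a \<le> c" "c \<le> b" using ab \<eta> by (auto simp: c_def)
  have D: "0 \<le> D" using all[of a] ab by simp
  have "norm (integral {a..c} f) \<le> E * (c - a)"
  proof (cases "b - \<eta> \<le> a")
    case True then have "c = a" by (simp add: c_def)
    then show ?thesis by simp
  next
    case False
    then show ?thesis
      using small c by (intro integral_bound continuous_on_subset[OF f]) (auto simp: c_def)
  qed
  also have "\<dots> \<le> E * (b - a)" using E c by (intro mult_left_mono) auto
  finally have 1: "\<bar>integral {a..c} f\<bar> \<le> E * (b - a)" by simp
  have "norm (integral {c..b} f) \<le> D * (b - c)"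
    using all c by (intro integral_bound continuous_on_subset[OF f]) auto
  also have "\<dots> \<le> D * \<eta>" using D by (intro mult_left_mono) (auto simp: c_def)
  finally have 2: "\<bar>integral {c..b} f\<bar> \<le> D * \<eta>" by simp
  have "integral {a..b} f = integral {a..c} f + integral {c..b} f"
    using Henstock_Kurzweil_Integration.integral_combine[OF c integrable_continuous_real[OF f]] by simp
  then show ?thesis using 1 2 by linarith
qed

lemma exp_minus_le_inverse:
  assumes "0 < t" shows "exp (- t) \<le> 1 / (t::real)"
proof -
  have "t \<le> exp t" using exp_ge_add_one_self[of t] by linarith
  then show ?thesis using assms by (simp add: exp_minus divide_inverse le_imp_inverse_le)
qed

text \<open>The left side is the Poisson probability of at most one jump by time \<open>t\<close>;
  it will bound the unsmoothed remainder of the first term.\<close>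

lemma exp_minus_affine_le: "0 < t \<Longrightarrow> exp (- t) * (1 + t) \<le> 2 / (t::real)"
proof -
  assume t: "0 < t"
  have "1 + t + t\<^sup>2 / 2 \<le> exp t" using exp_lower_Taylor_quadratic[of t] t by simp
  then have "(1 + t) * t \<le> 2 * exp t" using t by (simp add: power2_eq_square algebra_simps)
  from mult_left_mono[OF this, of "exp (- t)"] have "exp (- t) * (1 + t) * t \<le> exp (- t) * exp t * 2"
    by (simp add: mult_ac)
  also have "\<dots> = 2" by (simp add: exp_minus)
  finally show ?thesis using t by (simp add: pos_le_divide_eq)
qed

section \<open>Moduli of continuity of the two Duhamel terms\<close>

context heat_kernel
begin

text \<open>\<open>k^2 * exp (- k^2 * (s - t0))\<close> is the density of the first jump time,
  \<open>kop J\<close> performs that jump and \<open>W\<close> records at least one more. The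
  integral is therefore the flow without its terms \<open>n = 0\<close> and \<open>n = 1\<close>.
  Analytically, \<open>egf (kop J g)\<close> is the derivative of \<open>egf g\<close>, which gives
  an explicit primitive.\<close>

lemma first_duhamel_term:
  assumes g: "bdd_borel D g" and k: "0 < k" and t: "t0 \<le> t"
  shows "k\<^sup>2 * (LINT s:{t0..t}|lebesgue.
      exp (- k\<^sup>2 * (s - t0)) * kop (\<lambda>x. W x (k\<^sup>2 * (t - s))) (kop J g) X)
    = flow g X (k\<^sup>2 * (t - t0)) - exp (- (k\<^sup>2 * (t - t0))) * (g X + k\<^sup>2 * (t - t0) * kop J g X)"
proof -
  define T where "T = k\<^sup>2 * (t - t0)"
  have Jg: "bdd_borel D (kop J g)" using bdd_kpow[OF g, of 1] by (simp add: kpow_Suc)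
  \<comment> \<open>The exponential weight and the one hidden in \<open>W\<close> multiply to
    \<open>exp (- T)\<close>, which no longer depends on \<open>s\<close>.\<close>
  define q where "q s = exp (- T) * (egf (kop J g) X (k\<^sup>2 * (t - s)) - kop J g X)" for s
  have q: "exp (- k\<^sup>2 * (s - t0)) * kop (\<lambda>x. W x (k\<^sup>2 * (t - s))) (kop J g) X = q s" if "s \<le> t" for s
  proof -
    define \<tau> where "\<tau> = k\<^sup>2 * (t - s)"
    have \<tau>0: "0 \<le> \<tau>" using that by (simp add: \<tau>_def)
    have "kop (\<lambda>x. W x \<tau>) (kop J g) X = exp (- \<tau>) * (egf (kop J g) X \<tau> - kop J g X)"
      unfolding kop_W[OF \<tau>0 Jg] flow_def by (simp add: algebra_simps)
    moreover have "exp (- k\<^sup>2 * (s - t0)) * exp (- \<tau>) = exp (- T)"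
      unfolding exp_add[symmetric] \<tau>_def T_def by (simp add: algebra_simps)
    ultimately show ?thesis unfolding q_def \<tau>_def[symmetric] by (simp only: mult.assoc[symmetric])
  qed
  have egf_chain: "((\<lambda>s. egf g X (k\<^sup>2 * (t - s))) has_real_derivative egf (kop J g) X (k\<^sup>2 * (t - s)) * (- k\<^sup>2)) (at s)"
    if "bdd_borel D g" for s g
    by (rule DERIV_chain2[OF egf_deriv[OF that]]) (rule derivative_eq_intros refl | simp)+
  have "continuous_on {t0..t} (\<lambda>s. egf (kop J g) X (k\<^sup>2 * (t - s)))"
    by (intro continuous_at_imp_continuous_on ballI) (rule DERIV_isCont[OF egf_chain[OF Jg]])
  then have qc: "continuous_on {t0..t} q"
    unfolding q_def by (intro continuous_intros)
  define G where "G s = - exp (- T) * (egf g X (k\<^sup>2 * (t - s)) / k\<^sup>2 + s * kop J g X)" for s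
  have "(G has_real_derivative q s) (at s)" for s
  proof -
    have "((\<lambda>s. egf g X (k\<^sup>2 * (t - s)) / k\<^sup>2 + s * kop J g X) has_real_derivative
        egf (kop J g) X (k\<^sup>2 * (t - s)) * (- k\<^sup>2) / k\<^sup>2 + 1 * kop J g X) (at s)"
      by (intro DERIV_add DERIV_cdivide egf_chain[OF g] DERIV_cmult_right DERIV_ident)
    from DERIV_cmult[OF this, of "- exp (- T)"] show ?thesis
      unfolding G_def[abs_def] q_def using k by (simp add: right_diff_distrib)
  qed
  then have "(q has_integral (G t - G t0)) {t0..t}"
    by (intro fundamental_theorem_of_calculus t)
      (auto simp: has_real_derivative_iff_has_vector_derivative[symmetric] intro: has_field_derivative_at_within)
  then have "(LINT s:{t0..t}|lebesgue. q s) = G t - G t0"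
    using set_lebesgue_integral_continuous[OF qc] by (simp add: integral_unique)
  moreover have "(LINT s:{t0..t}|lebesgue. exp (- k\<^sup>2 * (s - t0)) * kop (\<lambda>x. W x (k\<^sup>2 * (t - s))) (kop J g) X)
      = (LINT s:{t0..t}|lebesgue. q s)"
    unfolding set_lebesgue_integral_def
  proof (intro Bochner_Integration.integral_cong refl)
    fix s
    show "indicator {t0..t} s *\<^sub>R (exp (- k\<^sup>2 * (s - t0)) * kop (\<lambda>x. W x (k\<^sup>2 * (t - s))) (kop J g) X) = indicator {t0..t} s *\<^sub>R q s"
      using q[of s] by (cases "s \<in> {t0..t}") auto
  qed
  moreover have "k\<^sup>2 * (G t - G t0) = flow g X T - exp (- T) * (g X + T * kop J g X)"
  proof -
    have alg: "K * (- a * (b / K + t * c) - - a * (d / K + t0 * c)) = a * d - a * (b + K * (t - t0) * c)"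
      if "K \<noteq> 0" for K a b c d :: real
      using that by (simp add: field_simps)
    have G: "G t = - exp (- T) * (g X / k\<^sup>2 + t * kop J g X)" "G t0 = - exp (- T) * (egf g X T / k\<^sup>2 + t0 * kop J g X)"
      by (simp_all add: G_def egf_0 T_def)
    have "k\<^sup>2 * (G t - G t0) = exp (- T) * egf g X T - exp (- T) * (g X + k\<^sup>2 * (t - t0) * kop J g X)"
      unfolding G by (rule alg) (use k in simp)
    then show ?thesis unfolding flow_def by (simp only: T_def)
  qed
  ultimately show ?thesis by (simp add: T_def)
qed

text \<open>From \<open>2 * t0\<close> on the flow has run for at least \<open>k^2 * t0\<close>,
  which bounds the denominators of the smoothing estimates. The last summand consists of the two
  tails with at most one jump; they are estimated in size, since \<open>g\<close> has no modulus of
  its own.\<close>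

lemma first_term_modulus:
  obtains C where "0 < C"
    "\<And>D g k t0 t t' X X'. bdd_borel D g \<Longrightarrow> 0 < k \<Longrightarrow> 0 < t0 \<Longrightarrow> 2 * t0 \<le> t \<Longrightarrow> t \<le> t' \<Longrightarrow>
      \<bar>(flow g X (k\<^sup>2 * (t - t0)) - exp (- (k\<^sup>2 * (t - t0))) * (g X + k\<^sup>2 * (t - t0) * kop J g X))
       - (flow g X' (k\<^sup>2 * (t' - t0)) - exp (- (k\<^sup>2 * (t' - t0))) * (g X' + k\<^sup>2 * (t' - t0) * kop J g X'))\<bar>
      \<le> C * D * ((norm (X - X') + 1) / (k * sqrt t0) + (t' - t) / t0) + 4 * D / (k\<^sup>2 * t0)"
proof -
  obtain C1 where C1: "0 < C1" and tr: "\<And>D g x x' t. bdd_borel D g \<Longrightarrow> 0 < t \<Longrightarrow>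
      \<bar>flow g x t - flow g x' t\<bar> \<le> C1 * (norm (x - x') + 1) * D / sqrt t"
    using flow_translation by metis
  obtain C2 where C2: "0 < C2" and tm: "\<And>D g x t t'. bdd_borel D g \<Longrightarrow> 0 < t \<Longrightarrow> t \<le> t' \<Longrightarrow>
      \<bar>flow g x t' - flow g x t\<bar> \<le> C2 * D * (t' - t) / t"
    using flow_time by metis
  have "\<bar>(flow g X (k\<^sup>2 * (t - t0)) - exp (- (k\<^sup>2 * (t - t0))) * (g X + k\<^sup>2 * (t - t0) * kop J g X))
       - (flow g X' (k\<^sup>2 * (t' - t0)) - exp (- (k\<^sup>2 * (t' - t0))) * (g X' + k\<^sup>2 * (t' - t0) * kop J g X'))\<bar>
      \<le> (C1 + C2) * D * ((norm (X - X') + 1) / (k * sqrt t0) + (t' - t) / t0) + 4 * D / (k\<^sup>2 * t0)"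
    if g: "bdd_borel D g" and k: "0 < k" and t0: "0 < t0" and t: "2 * t0 \<le> t" "t \<le> t'" for D g k t0 t t' X X'
  proof -
    have Jg: "bdd_borel D (kop J g)" using bdd_kpow[OF g, of 1] by (simp add: kpow_Suc)
    have D: "0 \<le> D" using bdd_borelD(5)[OF g] .
    define T where "T t = k\<^sup>2 * (t - t0)" for t
    have T: "0 < T t" "k\<^sup>2 * t0 \<le> T t" "T t \<le> T t'" "k\<^sup>2 * t0 \<le> T t'"
      using k t0 t by (auto simp: T_def)
    have tail: "\<bar>exp (- T) * (g X + T * kop J g X)\<bar> \<le> 2 * D / (k\<^sup>2 * t0)" if T: "k\<^sup>2 * t0 \<le> T" for T X
    proof -
      have p: "0 < k\<^sup>2 * t0" using k t0 by simp
      then have T0: "0 < T" using T by linarith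
      have "\<bar>T * kop J g X\<bar> \<le> T * D"
        using bdd_borelD(2)[OF Jg, of X] T0 by (simp add: abs_mult mult_left_mono)
      then have "\<bar>g X + T * kop J g X\<bar> \<le> D * (1 + T)"
        using bdd_borelD(2)[OF g, of X] by (simp add: algebra_simps)
      then have "\<bar>exp (- T) * (g X + T * kop J g X)\<bar> \<le> exp (- T) * (D * (1 + T))"
        by (simp add: abs_mult)
      also have "\<dots> = D * (exp (- T) * (1 + T))" by simp
      also have "\<dots> \<le> D * (2 / T)" by (intro mult_left_mono exp_minus_affine_le T0 D)
      also have "\<dots> \<le> D * (2 / (k\<^sup>2 * t0))"
        using T p D T0 by (intro mult_left_mono divide_left_mono) auto
      finally show ?thesis by (simp add: mult_ac)
    qed
    have sp: "\<bar>flow g X (T t) - flow g X' (T t)\<bar> \<le> C1 * D * ((norm (X - X') + 1) / (k * sqrt t0))"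
    proof -
      have "sqrt (k\<^sup>2 * t0) \<le> sqrt (T t)" using T by simp
      then have "k * sqrt t0 \<le> sqrt (T t)" using k by (simp add: real_sqrt_mult)
      then have "C1 * (norm (X - X') + 1) * D / sqrt (T t) \<le> C1 * (norm (X - X') + 1) * D / (k * sqrt t0)"
        using k t0 C1 D T by (intro divide_left_mono) auto
      then show ?thesis using tr[OF g T(1), of X X'] by (simp add: mult_ac)
    qed
    have ti: "\<bar>flow g X' (T t') - flow g X' (T t)\<bar> \<le> C2 * D * ((t' - t) / t0)"
    proof -
      have "\<bar>flow g X' (T t') - flow g X' (T t)\<bar> \<le> C2 * D * (T t' - T t) / T t" by (rule tm[OF g T(1,3)])
      also have "\<dots> \<le> C2 * D * (T t' - T t) / (k\<^sup>2 * t0)"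
        using T C2 D k t0 by (intro divide_left_mono) auto
      also have "\<dots> = C2 * D * ((t' - t) / t0)"
        using k t0 by (simp add: T_def field_simps)
      finally show ?thesis .
    qed
    have "C1 * D * ((norm (X - X') + 1) / (k * sqrt t0)) + C2 * D * ((t' - t) / t0)
       \<le> (C1 + C2) * D * ((norm (X - X') + 1) / (k * sqrt t0) + (t' - t) / t0)"
    proof -
      have "0 \<le> C1 * D * ((t' - t) / t0)" "0 \<le> C2 * D * ((norm (X - X') + 1) / (k * sqrt t0))"
        using C1 C2 D t t0 k by auto
      then show ?thesis by (simp only: distrib_left distrib_right)
    qed
    then show ?thesis
      using sp ti tail[OF T(2), of X] tail[OF T(4), of X'] unfolding T_def[symmetric] by linarith
  qed
  then show ?thesis using that[of "C1 + C2"] C1 C2 by simp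
qed

text \<open>Models \<open>(u^k)^p\<close>. Measurability is required at each time separately,
  whereas the bounds and the continuity in time hold off null sets common to all times; this is what
  dominated convergence in \<open>s\<close> consumes.\<close>

definition admissible_source :: "real \<Rightarrow> real \<Rightarrow> ('a \<Rightarrow> real \<Rightarrow> real) \<Rightarrow> bool" where
  "admissible_source D t0 v \<longleftrightarrow> 0 \<le> D \<and>
     (\<forall>s\<ge>t0. (\<lambda>y. v y s) \<in> borel_measurable lebesgue) \<and>
     (AE y in lebesgue. \<forall>s\<ge>t0. 0 \<le> v y s \<and> v y s \<le> D) \<and>
     (AE y in lebesgue. continuous_on {t0..} (v y))"

definition duhamel :: "real \<Rightarrow> ('a \<Rightarrow> real \<Rightarrow> real) \<Rightarrow> 'a \<Rightarrow> real \<Rightarrow> real \<Rightarrow> real" where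
  "duhamel k v X t s = (LINT y|lebesgue. W (X - y) (k\<^sup>2 * (t - s)) * v y s)"

text \<open>\<open>g\<close> depends on \<open>s\<close> but not on \<open>X\<close> or
  \<open>t\<close>: a single Borel version has to serve both points whose values are later
  compared.\<close>

lemma duhamel_flow:
  assumes v: "admissible_source D t0 v" and s: "t0 \<le> s"
  obtains g where "bdd_borel D g"
    "\<And>X t. s \<le> t \<Longrightarrow> duhamel k v X t s = flow g X (k\<^sup>2 * (t - s)) - exp (- (k\<^sup>2 * (t - s))) * g X"
proof -
  have D: "0 \<le> D" and vm: "(\<lambda>y. v y s) \<in> borel_measurable lebesgue"
    and ae: "AE y in lebesgue. \<forall>s\<ge>t0. 0 \<le> v y s \<and> v y s \<le> D"
    using v s by (auto simp: admissible_source_def)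
  have "AE y in lebesgue. 0 \<le> v y s \<and> v y s \<le> D"
    using ae by eventually_elim (use s in auto)
  then obtain g where g: "bdd_borel D g" "AE y in lebesgue. v y s = g y"
    using bounded_borel_version[OF vm _ D] by metis
  have "duhamel k v X t s = flow g X (k\<^sup>2 * (t - s)) - exp (- (k\<^sup>2 * (t - s))) * g X" if t: "s \<le> t" for X t
  proof -
    have \<tau>: "0 \<le> k\<^sup>2 * (t - s)" using t by simp
    have "duhamel k v X t s = kop (\<lambda>x. W x (k\<^sup>2 * (t - s))) g X"
      unfolding duhamel_def
      by (intro lebesgue_convolution_version W_measurable \<tau> bdd_borelD(1)[OF g(1)] g(2) vm)
    then show ?thesis using kop_W[OF \<tau> g(1)] by simp
  qed
  then show ?thesis using that g(1) by blast
qed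

text \<open>Gives the time integral a continuous integrand. Dominated convergence along sequences
  takes the place of measurability in space and time jointly.\<close>

lemma duhamel_continuous:
  assumes v: "admissible_source D t0 v"
  shows "continuous_on {t0..t} (duhamel k v X t)"
  unfolding continuous_on_sequentially comp_def
proof (intro allI ballI impI)
  fix \<sigma> :: "nat \<Rightarrow> real" and s
  assume s: "s \<in> {t0..t}" and \<sigma>: "(\<forall>n. \<sigma> n \<in> {t0..t}) \<and> \<sigma> \<longlonglongrightarrow> s"
  have D: "0 \<le> D" using v by (simp add: admissible_source_def)
  define T where "T = k\<^sup>2 * (t - t0)"
  have T: "0 \<le> T" using s by (simp add: T_def)
  have \<tau>: "0 \<le> k\<^sup>2 * (t - r)" "k\<^sup>2 * (t - r) \<le> T" if "r \<in> {t0..t}" for r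
    using that by (auto simp: T_def intro!: mult_left_mono)
  have m: "(\<lambda>y. W (X - y) (k\<^sup>2 * (t - r)) * v y r) \<in> borel_measurable lebesgue" if "r \<in> {t0..t}" for r
  proof -
    have "(\<lambda>y. W (X - y) (k\<^sup>2 * (t - r))) \<in> borel_measurable borel"
      by (rule measurable_compose[OF _ W_measurable[OF \<tau>(1)[OF that]]]) simp
    then show ?thesis
      using v that by (intro borel_measurable_times borel_measurable_lebesgue[OF \<open>_ \<in> borel_measurable borel\<close>]) (auto simp: admissible_source_def)
  qed
  show "(\<lambda>n. duhamel k v X t (\<sigma> n)) \<longlonglongrightarrow> duhamel k v X t s"
    unfolding duhamel_def
  \<comment> \<open>By monotonicity of \<open>exp \<tau> * W (X - y) \<tau>\<close> in
    \<open>\<tau>\<close>, its value at the longest time \<open>T\<close> dominates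
    \<open>W (X - y) \<tau>\<close> for every time involved.\<close>
  proof (rule integral_dominated_convergence[where w = "\<lambda>y. exp T * W (X - y) T * D"])
    show "(\<lambda>y. W (X - y) (k\<^sup>2 * (t - s)) * v y s) \<in> borel_measurable lebesgue" by (rule m[OF s])
    show "(\<lambda>y. W (X - y) (k\<^sup>2 * (t - \<sigma> n)) * v y (\<sigma> n)) \<in> borel_measurable lebesgue" for n
      using \<sigma> by (intro m) auto
    have "integrable lborel (\<lambda>y. exp T * W (X - y) T * D)"
      using lborel_integrable_reflect(1)[OF W_integrable[OF T]] by simp
    then show "integrable lebesgue (\<lambda>y. exp T * W (X - y) T * D)"
      by (subst integrable_completion) auto
    show "AE y in lebesgue. (\<lambda>n. W (X - y) (k\<^sup>2 * (t - \<sigma> n)) * v y (\<sigma> n)) \<longlonglongrightarrow> W (X - y) (k\<^sup>2 * (t - s)) * v y s"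
    proof -
      have "AE y in lebesgue. continuous_on {t0..} (v y)" using v by (simp add: admissible_source_def)
      then show ?thesis
      proof eventually_elim
        case (elim y)
        have "(\<lambda>n. v y (\<sigma> n)) \<longlonglongrightarrow> v y s"
          by (rule continuous_on_tendsto_compose[OF elim]) (use \<sigma> s in auto)
        moreover have "(\<lambda>n. W (X - y) (k\<^sup>2 * (t - \<sigma> n))) \<longlonglongrightarrow> W (X - y) (k\<^sup>2 * (t - s))"
          by (rule continuous_on_tendsto_compose[OF W_continuous_time]) (use \<sigma> s \<tau>(1) in \<open>auto intro!: tendsto_intros\<close>)
        ultimately show ?case by (intro tendsto_mult)
      qed
    qed
    show "AE y in lebesgue. norm (W (X - y) (k\<^sup>2 * (t - \<sigma> n)) * v y (\<sigma> n)) \<le> exp T * W (X - y) T * D" for n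
    proof -
      have "AE y in lebesgue. \<forall>s\<ge>t0. 0 \<le> v y s \<and> v y s \<le> D" using v by (simp add: admissible_source_def)
      then show ?thesis
      proof eventually_elim
        case (elim y)
        define \<tau>n where "\<tau>n = k\<^sup>2 * (t - \<sigma> n)"
        have n: "0 \<le> \<tau>n" "\<tau>n \<le> T" using \<tau>[of "\<sigma> n"] \<sigma> by (auto simp: \<tau>n_def)
        have "W (X - y) \<tau>n \<le> exp \<tau>n * W (X - y) \<tau>n"
          using W_nonneg[OF n(1), of "X - y"] n(1) mult_right_mono[of 1 "exp \<tau>n" "W (X - y) \<tau>n"] by simp
        also have "\<dots> \<le> exp T * W (X - y) T" by (rule W_exp_mono[OF n])
        finally have "W (X - y) \<tau>n \<le> exp T * W (X - y) T" .
        moreover have "0 \<le> v y (\<sigma> n)" "v y (\<sigma> n) \<le> D" using elim \<sigma> by auto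
        ultimately have "W (X - y) \<tau>n * v y (\<sigma> n) \<le> exp T * W (X - y) T * D"
          using W_nonneg[OF T, of "X - y"] by (intro mult_mono) auto
        then show ?case using \<open>0 \<le> v y (\<sigma> n)\<close> W_nonneg[OF n(1), of "X - y"] by (simp add: abs_mult \<tau>n_def)
      qed
    qed
  qed
qed

lemma duhamel_le:
  assumes v: "admissible_source D t0 v" and s: "t0 \<le> s" "s \<le> t"
  shows "\<bar>duhamel k v X t s\<bar> \<le> 2 * D"
proof -
  obtain g where g: "bdd_borel D g"
    "\<And>X t. s \<le> t \<Longrightarrow> duhamel k v X t s = flow g X (k\<^sup>2 * (t - s)) - exp (- (k\<^sup>2 * (t - s))) * g X"
    using duhamel_flow[OF v s(1)] by metis
  have "\<bar>exp (- (k\<^sup>2 * (t - s))) * g X\<bar> \<le> 1 * D"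
    unfolding abs_mult using bdd_borelD(2,5)[OF g(1)] s by (intro mult_mono) auto
  moreover have "\<bar>flow g X (k\<^sup>2 * (t - s))\<bar> \<le> D" using s by (intro flow_le[OF g(1)]) simp
  ultimately show ?thesis unfolding g(2)[OF s(2)] by linarith
qed

text \<open>The gap \<open>\<eta>\<close> between \<open>s\<close> and \<open>t\<close> plays the
  part of \<open>t0\<close> in the first term: the elapsed time is at least
  \<open>k^2 * \<eta>\<close>. Only the zeroth term is missing from the flow here, so the tail is
  \<open>exp (- T) * D \<le> D / T\<close>.\<close>

lemma duhamel_modulus:
  obtains C where "0 < C"
    "\<And>D v k t0 s t t' \<eta> X X'. admissible_source D t0 v \<Longrightarrow> 0 < k \<Longrightarrow> t0 \<le> s \<Longrightarrow> 0 < \<eta> \<Longrightarrow> s \<le> t - \<eta> \<Longrightarrow> t \<le> t' \<Longrightarrow>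
      \<bar>duhamel k v X t s - duhamel k v X' t' s\<bar>
      \<le> C * D * ((norm (X - X') + 1) / (k * sqrt \<eta>) + (t' - t) / \<eta>) + 2 * D / (k\<^sup>2 * \<eta>)"
proof -
  obtain C1 where C1: "0 < C1" and tr: "\<And>D g x x' t. bdd_borel D g \<Longrightarrow> 0 < t \<Longrightarrow>
      \<bar>flow g x t - flow g x' t\<bar> \<le> C1 * (norm (x - x') + 1) * D / sqrt t"
    using flow_translation by metis
  obtain C2 where C2: "0 < C2" and tm: "\<And>D g x t t'. bdd_borel D g \<Longrightarrow> 0 < t \<Longrightarrow> t \<le> t' \<Longrightarrow>
      \<bar>flow g x t' - flow g x t\<bar> \<le> C2 * D * (t' - t) / t"
    using flow_time by metis
  have "\<bar>duhamel k v X t s - duhamel k v X' t' s\<bar>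
      \<le> (C1 + C2) * D * ((norm (X - X') + 1) / (k * sqrt \<eta>) + (t' - t) / \<eta>) + 2 * D / (k\<^sup>2 * \<eta>)"
    if v: "admissible_source D t0 v" and k: "0 < k" and s: "t0 \<le> s" and \<eta>: "0 < \<eta>" and t: "s \<le> t - \<eta>" "t \<le> t'"
    for D v k t0 s t t' \<eta> X X'
  proof -
    obtain g where g: "bdd_borel D g"
      "\<And>X t. s \<le> t \<Longrightarrow> duhamel k v X t s = flow g X (k\<^sup>2 * (t - s)) - exp (- (k\<^sup>2 * (t - s))) * g X"
      using duhamel_flow[OF v s] by metis
    have D: "0 \<le> D" using bdd_borelD(5)[OF g(1)] .
    define T where "T t = k\<^sup>2 * (t - s)" for t
    have T: "0 < T t" "k\<^sup>2 * \<eta> \<le> T t" "T t \<le> T t'" "k\<^sup>2 * \<eta> \<le> T t'"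
      using k \<eta> t by (auto simp: T_def)
    have p: "0 < k\<^sup>2 * \<eta>" using k \<eta> by simp
    have tail: "\<bar>exp (- T) * g X\<bar> \<le> D / (k\<^sup>2 * \<eta>)" if T: "k\<^sup>2 * \<eta> \<le> T" for T X
    proof -
      have T0: "0 < T" using T p by linarith
      have "\<bar>exp (- T) * g X\<bar> \<le> (1 / T) * D"
        unfolding abs_mult using bdd_borelD(2)[OF g(1), of X] exp_minus_le_inverse[OF T0] T0 by (intro mult_mono) auto
      also have "\<dots> \<le> (1 / (k\<^sup>2 * \<eta>)) * D"
        using T T0 p D by (intro mult_right_mono divide_left_mono) auto
      finally show ?thesis by simp
    qed
    have sp: "\<bar>flow g X (T t) - flow g X' (T t)\<bar> \<le> C1 * D * ((norm (X - X') + 1) / (k * sqrt \<eta>))"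
    proof -
      have "sqrt (k\<^sup>2 * \<eta>) \<le> sqrt (T t)" using T by simp
      then have "k * sqrt \<eta> \<le> sqrt (T t)" using k by (simp add: real_sqrt_mult)
      then have "C1 * (norm (X - X') + 1) * D / sqrt (T t) \<le> C1 * (norm (X - X') + 1) * D / (k * sqrt \<eta>)"
        using k \<eta> C1 D T by (intro divide_left_mono) auto
      then show ?thesis using tr[OF g(1) T(1), of X X'] by (simp add: mult_ac)
    qed
    have ti: "\<bar>flow g X' (T t') - flow g X' (T t)\<bar> \<le> C2 * D * ((t' - t) / \<eta>)"
    proof -
      have "\<bar>flow g X' (T t') - flow g X' (T t)\<bar> \<le> C2 * D * (T t' - T t) / T t" by (rule tm[OF g(1) T(1,3)])
      also have "\<dots> \<le> C2 * D * (T t' - T t) / (k\<^sup>2 * \<eta>)"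
        using T C2 D k \<eta> by (intro divide_left_mono) auto
      also have "\<dots> = C2 * D * ((t' - t) / \<eta>)"
        using k \<eta> by (simp add: T_def field_simps)
      finally show ?thesis .
    qed
    have "C1 * D * ((norm (X - X') + 1) / (k * sqrt \<eta>)) + C2 * D * ((t' - t) / \<eta>)
       \<le> (C1 + C2) * D * ((norm (X - X') + 1) / (k * sqrt \<eta>) + (t' - t) / \<eta>)"
    proof -
      have "0 \<le> C1 * D * ((t' - t) / \<eta>)" "0 \<le> C2 * D * ((norm (X - X') + 1) / (k * sqrt \<eta>))"
        using C1 C2 D t \<eta> k by auto
      then show ?thesis by (simp only: distrib_left distrib_right)
    qed
    moreover have "2 * D / (k\<^sup>2 * \<eta>) = D / (k\<^sup>2 * \<eta>) + D / (k\<^sup>2 * \<eta>)" by simp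
    moreover have "s \<le> t" "s \<le> t'" using t \<eta> by auto
    ultimately show ?thesis
      using sp ti tail[OF T(2), of X] tail[OF T(4), of X']
      unfolding g(2)[OF \<open>s \<le> t\<close>] g(2)[OF \<open>s \<le> t'\<close>] T_def[symmetric] by linarith
  qed
  then show ?thesis using that[of "C1 + C2"] C1 C2 by simp
qed

text \<open>The last time interval of length \<open>\<eta>\<close> is estimated trivially; before it the semigroup
  has had time \<open>k\<^sup>2 \<eta>\<close> to smooth the source.\<close>

lemma second_term_modulus:
  obtains C where "0 < C"
    "\<And>D v k t0 t t' \<eta> X X'. admissible_source D t0 v \<Longrightarrow> 0 < k \<Longrightarrow> 0 < \<eta> \<Longrightarrow> t0 \<le> t \<Longrightarrow> t \<le> t' \<Longrightarrow>
      \<bar>integral {t0..t} (duhamel k v X t) - integral {t0..t'} (duhamel k v X' t')\<bar>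
      \<le> (t - t0) * (C * D * ((norm (X - X') + 1) / (k * sqrt \<eta>) + (t' - t) / \<eta>) + 2 * D / (k\<^sup>2 * \<eta>))
        + 4 * D * \<eta> + 2 * D * (t' - t)"
proof -
  obtain C where C: "0 < C" and mo: "\<And>D v k t0 s t t' \<eta> X X'. admissible_source D t0 v \<Longrightarrow> 0 < k \<Longrightarrow> t0 \<le> s \<Longrightarrow> 0 < \<eta> \<Longrightarrow> s \<le> t - \<eta> \<Longrightarrow> t \<le> t' \<Longrightarrow>
      \<bar>duhamel k v X t s - duhamel k v X' t' s\<bar>
      \<le> C * D * ((norm (X - X') + 1) / (k * sqrt \<eta>) + (t' - t) / \<eta>) + 2 * D / (k\<^sup>2 * \<eta>)"
    using duhamel_modulus by metis
  have "\<bar>integral {t0..t} (duhamel k v X t) - integral {t0..t'} (duhamel k v X' t')\<bar>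
      \<le> (t - t0) * (C * D * ((norm (X - X') + 1) / (k * sqrt \<eta>) + (t' - t) / \<eta>) + 2 * D / (k\<^sup>2 * \<eta>))
        + 4 * D * \<eta> + 2 * D * (t' - t)"
    if v: "admissible_source D t0 v" and k: "0 < k" and \<eta>: "0 < \<eta>" and t: "t0 \<le> t" "t \<le> t'"
    for D v k t0 t t' \<eta> X X'
  proof -
    have D: "0 \<le> D" using v by (simp add: admissible_source_def)
    define E where "E = C * D * ((norm (X - X') + 1) / (k * sqrt \<eta>) + (t' - t) / \<eta>) + 2 * D / (k\<^sup>2 * \<eta>)"
    have E: "0 \<le> E" unfolding E_def using C D k \<eta> t by auto
    note c = duhamel_continuous[OF v]
    have c': "continuous_on {t0..t} (duhamel k v X' t')"
      by (rule continuous_on_subset[OF c]) (use t in auto)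
    have "\<bar>duhamel k v X t s - duhamel k v X' t' s\<bar> \<le> 4 * D" if "t0 \<le> s" "s \<le> t" for s
      using duhamel_le[OF v, of s t k X] duhamel_le[OF v, of s t' k X'] that t by linarith
    then have 1: "\<bar>integral {t0..t} (\<lambda>s. duhamel k v X t s - duhamel k v X' t' s)\<bar> \<le> E * (t - t0) + 4 * D * \<eta>"
      using mo[OF v k _ \<eta> _ t(2), of _ X X'] E \<eta> unfolding E_def
      by (intro integral_bound_split continuous_on_diff c c' t) auto
    have "integral {t0..t} (\<lambda>s. duhamel k v X t s - duhamel k v X' t' s)
        = integral {t0..t} (duhamel k v X t) - integral {t0..t} (duhamel k v X' t')"
      by (intro Henstock_Kurzweil_Integration.integral_diff integrable_continuous_real c c')
    \<comment> \<open>The integral up to \<open>t'\<close> has an extra piece of length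
      \<open>t' - t\<close>, for which the trivial bound \<open>2 * D\<close> on the integrand
      suffices.\<close>
    moreover have "integral {t0..t'} (duhamel k v X' t')
        = integral {t0..t} (duhamel k v X' t') + integral {t..t'} (duhamel k v X' t')"
      using Henstock_Kurzweil_Integration.integral_combine[OF t integrable_continuous_real[OF c]] by simp
    moreover have "norm (integral {t..t'} (duhamel k v X' t')) \<le> 2 * D * (t' - t)"
      using duhamel_le[OF v, of _ t' k X'] t
      by (intro integral_bound continuous_on_subset[OF c]) auto
    ultimately show ?thesis using 1 unfolding E_def[symmetric] by (simp add: mult.commute)
  qed
  then show ?thesis using that C by blast
qed

end

section \<open>The rescaled family\<close>

lemma admissible_kernel_jump_kernel:
  assumes J: "admissible_kernel J"
  shows "jump_kernel J"
proof
  have "Ck_on 0 UNIV J" using J unfolding admissible_kernel_def smooth_on_def by blast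
  then show cont: "continuous_on UNIV J" by simp
  show "0 \<le> J x" for x using J unfolding admissible_kernel_def by blast
  have "compact (closure {x. J x \<noteq> 0})" using J unfolding admissible_kernel_def by blast
  then have "bounded (closure {x. J x \<noteq> 0})" by (rule compact_imp_bounded)
  then obtain S where "\<And>x. x \<in> closure {x. J x \<noteq> 0} \<Longrightarrow> norm x \<le> S" unfolding bounded_iff by blast
  then show "\<exists>S. \<forall>x. J x \<noteq> 0 \<longrightarrow> norm x \<le> S"
    using closure_subset[of "{x. J x \<noteq> 0}"] by blast
  have "J \<in> borel_measurable lborel" using borel_measurable_continuous_onI[OF cont] by simp
  then have "(LINT x|lborel. J x) = (LINT x|lebesgue. J x)" by (rule integral_completion[symmetric])
  moreover have "(LINT x|lebesgue. J x) = 1" using J unfolding admissible_kernel_def by blast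
  ultimately show "(LINT x|lborel. J x) = 1" by (rule trans)
  show "J (- x) = J x" for x
  proof -
    have "norm (- x) = norm x" by simp
    then show ?thesis using J unfolding admissible_kernel_def by blast
  qed
qed

lemma fundamental_solution_heat_kernel:
  assumes J: "admissible_kernel J" and W: "fundamental_solution_smooth_part J W"
  shows "heat_kernel J W"
proof -
  interpret jump_kernel J by (rule admissible_kernel_jump_kernel[OF J])
  have cont: "continuous_on (UNIV \<times> {0..}) (\<lambda>(x, t). W x t)"
    using W by (simp add: fundamental_solution_smooth_part_def)
  have space: "continuous_on UNIV (\<lambda>x. W x t)" if "0 \<le> t" for t
  proof -
    have "continuous_on UNIV (\<lambda>x. (x, t))" by (intro continuous_intros)
    then have "continuous_on UNIV (\<lambda>x. case (x, t) of (x, t) \<Rightarrow> W x t)"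
      by (rule continuous_on_compose2[OF cont]) (use that in auto)
    then show ?thesis by simp
  qed
  show ?thesis
  proof
    show "continuous_on UNIV (\<lambda>x. W x t)" if "0 \<le> t" for t by (rule space[OF that])
    show "continuous_on {0..} (W x)" for x
    proof -
      have "continuous_on {0..} (\<lambda>t. (x, t))" by (intro continuous_intros)
      then have "continuous_on {0..} (\<lambda>t. case (x, t) of (x, t) \<Rightarrow> W x t)"
        by (rule continuous_on_compose2[OF cont]) auto
      then show ?thesis by simp
    qed
    show "\<exists>M. \<forall>x. \<forall>t\<in>{0..T}. \<bar>W x t\<bar> \<le> M" "W x 0 = 0" for T x
      using W by (auto simp: fundamental_solution_smooth_part_def)
    show "(W x has_real_derivative kop J (\<lambda>y. W y t) x - W x t + exp (- t) * J x) (at t)" if t: "0 < t" for x t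
    proof -
      have "(\<lambda>y. W y t) \<in> borel_measurable borel"
        using space[of t] t by (intro borel_measurable_continuous_onI) auto
      from conv_eq_kop[OF J_measurable this]
      have "conv J (\<lambda>y. W y t) x = kop J (\<lambda>y. W y t) x" .
      moreover have "(W x has_real_derivative conv J (\<lambda>y. W y t) x - W x t + exp (- t) * J x) (at t)"
        using W t unfolding fundamental_solution_smooth_part_def by blast
      ultimately show ?thesis by metis
    qed
  qed
qed

text \<open>The lower bound near 0 yields one ball of positive mass. Monotonicity keeps the mass
  above \<open>m\<close> for all larger radii, so there \<open>scale_f\<close> is positive and at
  most \<open>k^N / m\<close>.\<close>

lemma datum_mass:
  fixes u0 :: "'a::euclidean_space \<Rightarrow> real"
  assumes u0: "admissible_datum u0"
  obtains v M m a where "bdd_borel M v" "\<And>x. 0 \<le> v x" "AE x in lebesgue. u0 x = v x"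
    "0 < m" "0 < a" "\<And>k. a \<le> k \<Longrightarrow> m \<le> (LINT x|lborel. indicator (ball 0 k) x * v x)"
    "\<And>k. (LINT x:ball 0 k|lebesgue. u0 x) = (LINT x|lborel. indicator (ball 0 k) x * v x)"
    "\<And>k. integrable lborel (\<lambda>x. indicator (ball 0 k) x * v x)"
proof -
  obtain M0 where M0: "AE x in lebesgue. \<bar>u0 x\<bar> \<le> M0" using u0 unfolding admissible_datum_def by blast
  have um: "u0 \<in> borel_measurable lebesgue" and un: "AE x in lebesgue. 0 \<le> u0 x"
    using u0 by (auto simp: admissible_datum_def)
  have "AE x in lebesgue. 0 \<le> u0 x \<and> u0 x \<le> \<bar>M0\<bar>"
    using M0 un by eventually_elim auto
  then obtain v where v: "bdd_borel \<bar>M0\<bar> v" "\<And>x. 0 \<le> v x" "AE x in lebesgue. u0 x = v x"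
    using bounded_borel_version[OF um, of "\<bar>M0\<bar>"] by auto
  have vm [measurable]: "v \<in> borel_measurable borel" by (rule bdd_borelD(1)[OF v(1)])
  define \<mu> where "\<mu> k = (LINT x|lborel. indicator (ball 0 k) x * v x)" for k
  have int: "integrable lborel (\<lambda>x. indicator (ball 0 k) x * v x)" for k
  proof (rule Bochner_Integration.integrable_bound)
    show "integrable lborel (\<lambda>x. indicator (ball (0::'a) k) x * \<bar>M0\<bar>)"
      by (intro integrable_mult_left integrable_real_indicator)
        (auto simp: emeasure_lborel_ball_finite[unfolded infinity_ennreal_def])
    show "(\<lambda>x. indicator (ball 0 k) x * v x) \<in> borel_measurable lborel"
      by (intro borel_measurable_times borel_measurable_indicator) auto
    show "AE x in lborel. norm (indicator (ball 0 k) x * v x) \<le> norm (indicator (ball (0::'a) k) x * \<bar>M0\<bar>)"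
      using bdd_borelD(2)[OF v(1)] by (intro AE_I2) (auto simp: indicator_def)
  qed
  have eq: "(LINT x:ball 0 k|lebesgue. u0 x) = \<mu> k" for k
  proof -
    have im: "(\<lambda>x. indicator (ball (0::'a) k) x :: real) \<in> borel_measurable lebesgue"
      by (intro borel_measurable_lebesgue borel_measurable_indicator) auto
    have "(LINT x:ball 0 k|lebesgue. u0 x) = (LINT x|lebesgue. indicator (ball 0 k) x * v x)"
      unfolding set_lebesgue_integral_def real_scaleR_def
    proof (rule integral_cong_AE)
      show "(\<lambda>x. indicator (ball 0 k) x * u0 x) \<in> borel_measurable lebesgue"
        by (intro borel_measurable_times im um)
      show "(\<lambda>x. indicator (ball 0 k) x * v x) \<in> borel_measurable lebesgue"
        by (intro borel_measurable_times im borel_measurable_lebesgue[OF vm])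
      show "AE x in lebesgue. indicator (ball 0 k) x * u0 x = indicator (ball 0 k) x * v x"
        using v(3) by eventually_elim simp
    qed
    also have "\<dots> = \<mu> k" unfolding \<mu>_def using int[of k] by (intro integral_completion) auto
    finally show ?thesis .
  qed
  obtain \<kappa> where \<kappa>: "0 < \<kappa>" "\<forall>\<^sub>F k in at_right 0. \<kappa> * k ^ DIM('a) \<le> (LINT x:ball 0 k|lebesgue. u0 x)"
    using u0 unfolding admissible_datum_def by blast
  obtain b where b: "0 < b" "\<And>k. 0 < k \<Longrightarrow> k < b \<Longrightarrow> \<kappa> * k ^ DIM('a) \<le> \<mu> k"
    using \<kappa>(2) unfolding eventually_at_right_field eq by auto
  define a where "a = b / 2"
  have a: "0 < a" "a < b" using b by (auto simp: a_def)
  have ma: "0 < \<mu> a" using b(2)[OF a] \<kappa>(1) a by (smt (verit) mult_pos_pos zero_less_power)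
  have mono: "\<mu> a \<le> \<mu> k" if "a \<le> k" for k
    unfolding \<mu>_def using that v(2) by (intro integral_mono int mult_right_mono) (auto simp: indicator_def)
  show ?thesis
    using v ma a(1) mono eq int unfolding \<mu>_def by (rule that)
qed

text \<open>The numerator \<open>k^N\<close> of \<open>scale_f\<close> multiplies the unsmoothed
  part of the flow, whose factor \<open>exp (- k^2 * t0)\<close> absorbs it. A single term of the
  exponential series is enough.\<close>

lemma power_exp_bound:
  fixes k c :: real
  assumes k: "1 \<le> k" and c: "0 < c"
  shows "k ^ n * exp (- (k\<^sup>2 * c)) \<le> fact n / c ^ n"
proof -
  define y where "y = k\<^sup>2 * c"
  have y: "0 < y" using k c by (simp add: y_def)
  have "y ^ n / fact n \<le> exp y"
  proof -
    have "y ^ n / fact n \<le> (\<Sum>i. y ^ i / fact i)"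
      using sum_le_suminf[OF sums_summable[OF exp_series_sums[of y]], of "{n}"] y by auto
    then show ?thesis using sums_unique[OF exp_series_sums[of y]] by simp
  qed
  then have "y ^ n \<le> fact n * exp y" by (simp add: field_simps)
  from mult_left_mono[OF this, of "exp (- y)"] have "y ^ n * exp (- y) \<le> fact n"
    by (simp add: exp_minus mult_ac)
  moreover have "k ^ n * c ^ n \<le> y ^ n"
    unfolding y_def power_mult_distrib[symmetric] using k c
    by (intro power_mono mult_right_mono) (auto simp: power2_eq_square)
  ultimately have "k ^ n * c ^ n * exp (- y) \<le> fact n"
    by (meson exp_ge_zero mult_right_mono order_trans)
  then show ?thesis using c by (simp add: y_def field_simps)
qed

text \<open>The datum inside the ball of radius \<open>k\<close> has mass \<open>\<mu>\<close>,
  which the flow spreads to height \<open>C2 * \<mu> / (k * sqrt t0)^N\<close>; as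
  \<open>scale_f\<close> is \<open>k^N / \<mu>\<close>, both \<open>k\<close> and
  \<open>\<mu>\<close> cancel. Outside, the datum is at most \<open>C1 * B / scale_f k\<close>, and
  the flow preserves sup bounds.\<close>

lemma scaled_solution_bounded:
  fixes J u0 :: "'a::euclidean_space \<Rightarrow> real"
  assumes J: "admissible_kernel J" and u0: "admissible_datum u0"
    and F1: "\<exists>B>0. AE x in lebesgue. scale_f u0 (norm x) * u0 x \<le> B"
    and F2: "\<exists>k0>0. \<forall>\<delta>>0. \<exists>C>0. \<forall>k l.
               k0 \<le> k \<and> k \<le> l / \<delta> \<longrightarrow> scale_f u0 k \<le> C * scale_f u0 l"
    and u: "nonneg_bounded_solution J p u0 u" and t0: "0 < t0"
  obtains C k1 where "0 \<le> C" "1 \<le> k1"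
    "\<And>k. k1 \<le> k \<Longrightarrow> 0 < scale_f u0 k \<and>
       (AE z in lebesgue. \<forall>\<tau>\<ge>k\<^sup>2 * t0. 0 \<le> scale_f u0 k * u z \<tau> \<and> scale_f u0 k * u z \<tau> \<le> C)"
proof -
  let ?N = "DIM('a)" and ?f = "scale_f u0"
  interpret jump_kernel J by (rule admissible_kernel_jump_kernel[OF J])
  obtain v M m a where v: "bdd_borel M v" "\<And>x. 0 \<le> v x" "AE x in lebesgue. u0 x = v x"
    and m: "0 < m" and a: "0 < a" and mass: "\<And>k. a \<le> k \<Longrightarrow> m \<le> (LINT x|lborel. indicator (ball 0 k) x * v x)"
    and mass_eq: "\<And>k. (LINT x:ball 0 k|lebesgue. u0 x) = (LINT x|lborel. indicator (ball 0 k) x * v x)"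
    and ball_int: "\<And>k. integrable lborel (\<lambda>x. indicator (ball 0 k) x * v x)"
    by (rule datum_mass[OF u0], rule that)
  have vm [measurable]: "v \<in> borel_measurable borel" by (rule bdd_borelD(1)[OF v(1)])
  have M: "0 \<le> M" by (rule bdd_borelD(5)[OF v(1)])
  obtain B where B: "0 < B" "AE x in lebesgue. ?f (norm x) * u0 x \<le> B" using F1 by blast
  obtain k0 where k0: "0 < k0" "\<And>\<delta>. 0 < \<delta> \<Longrightarrow> \<exists>C>0. \<forall>k l. k0 \<le> k \<and> k \<le> l / \<delta> \<longrightarrow> ?f k \<le> C * ?f l"
    using F2 by blast
  \<comment> \<open>The choice \<open>\<delta> = 1\<close>: beyond radius \<open>k\<close>,
    \<open>scale_f\<close> stays above \<open>scale_f k / C1\<close>, which carries the pointwise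
    bound on the datum back to level \<open>k\<close>.\<close>
  obtain C1 where C1: "0 < C1" "\<And>k l. k0 \<le> k \<Longrightarrow> k \<le> l \<Longrightarrow> ?f k \<le> C1 * ?f l"
    using k0(2)[of 1] by auto
  obtain C2 where C2: "0 < C2" and smooth: "\<And>D v x t. bdd_borel D v \<Longrightarrow> (\<And>x. 0 \<le> v x) \<Longrightarrow> integrable lborel v \<Longrightarrow> 0 < t \<Longrightarrow>
       flow v x t \<le> exp (- t) * D + C2 / sqrt t ^ ?N * (LINT x|lborel. v x)"
    using flow_smoothing by metis
  define k1 where "k1 = max 1 (max a k0)"
  \<comment> \<open>In order: the unsmoothed part of the inner datum, its smoothed part, the outer
    datum.\<close>
  define C where "C = M / m * (fact ?N / t0 ^ ?N) + C2 / sqrt t0 ^ ?N + C1 * B"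
  have C: "0 \<le> C" unfolding C_def using M m t0 C2 C1 B by auto
  have main: "0 < ?f k \<and> (AE z in lebesgue. \<forall>\<tau>\<ge>k\<^sup>2 * t0. 0 \<le> ?f k * u z \<tau> \<and> ?f k * u z \<tau> \<le> C)" if k: "k1 \<le> k" for k
  proof -
    have k': "1 \<le> k" "a \<le> k" "k0 \<le> k" "0 < k" using k by (auto simp: k1_def)
    define \<mu> where "\<mu> = (LINT x|lborel. indicator (ball 0 k) x * v x)"
    have \<mu>: "m \<le> \<mu>" "0 < \<mu>" using mass[OF k'(2)] m by (auto simp: \<mu>_def)
    have f: "?f k = k ^ ?N / \<mu>" unfolding scale_f_def mass_eq \<mu>_def ..
    have f0: "0 < ?f k" unfolding f using \<mu> k' by simp
    define D where "D = C1 * B / ?f k"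
    have D: "0 \<le> D" unfolding D_def using C1 B f0 by simp
    define w1 where "w1 x = indicator (ball 0 k) x * v x" for x
    \<comment> \<open>The bound \<open>D\<close> on the outer datum holds almost everywhere only;
      the minimum enforces it everywhere.\<close>
    define w2 where "w2 x = indicator (- ball 0 k) x * min D (v x)" for x
    have [measurable]: "w1 \<in> borel_measurable borel" "w2 \<in> borel_measurable borel"
      unfolding w1_def w2_def
      by (intro borel_measurable_times borel_measurable_indicator borel_measurable_min; simp)+
    have w1: "bdd_borel M w1" "\<And>x. 0 \<le> w1 x"
      using v(2) bdd_borelD(3)[OF v(1)] M by (auto simp: bdd_borel_def w1_def indicator_def)
    have w2: "bdd_borel D w2" "\<And>x. 0 \<le> w2 x"
      using v(2) D by (auto simp: bdd_borel_def w2_def indicator_def min_def)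
    \<comment> \<open>The sum \<open>w1 + w2\<close> is written as a difference so that the lemmas
      on differences apply.\<close>
    have w: "bdd_borel (M + D) (\<lambda>x. w1 x - (- w2 x))"
      using w2 by (intro bdd_borel_diff w1) (auto simp: bdd_borel_def)
    have init: "AE x in lebesgue. u0 x \<le> w1 x - (- w2 x)"
      using v(3) B(2)
    proof eventually_elim
      case (elim x)
      show ?case
      proof (cases "norm x < k")
        case True then show ?thesis using elim by (simp add: w1_def w2_def)
      next
        case False
        then have "?f k \<le> C1 * ?f (norm x)" using C1(2)[OF k'(3)] by simp
        from mult_right_mono[OF this v(2)[of x]]
        have "?f k * v x \<le> C1 * (?f (norm x) * u0 x)" using elim(1) by simp
        also have "\<dots> \<le> C1 * B" using elim(2) C1(1) by simp
        finally have "v x \<le> D" unfolding D_def using f0 by (simp add: pos_le_divide_eq mult.commute)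
        then show ?thesis using False elim by (simp add: w1_def w2_def)
      qed
    qed
    obtain M' where M': "AE x in lebesgue. \<forall>t\<ge>0. 0 \<le> u x t \<and> u x t \<le> M'"
      using u unfolding nonneg_bounded_solution_def by blast
    have um: "(\<lambda>x. u x t) \<in> borel_measurable lebesgue" if "0 \<le> t" for t
      using u that unfolding nonneg_bounded_solution_def by blast
    have uM: "AE y in lebesgue. \<bar>u y t\<bar> \<le> M'" if "0 \<le> t" for t
      using M' by eventually_elim (use that in auto)
    have Jint: "integrable lebesgue (\<lambda>y. J (x - y))" "(LINT y|lebesgue. J (x - y)) = 1" for x
    proof -
      have "integrable lborel (\<lambda>y. J (x - y))" by (rule lborel_integrable_reflect(1)[OF J_integrable])
      then show "integrable lebesgue (\<lambda>y. J (x - y))" by (subst integrable_completion) auto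
      have "(LINT y|lebesgue. J (x - y)) = (LINT y|lborel. J (x - y))" by (intro integral_completion) simp
      then show "(LINT y|lebesgue. J (x - y)) = 1" using lborel_integral_reflect[OF J_measurable] J_integral by simp
    qed
    have eq: "(LINT y|lebesgue. J (x - y) * (u y t - u x t)) = conv J (\<lambda>y. u y t) x - u x t" if "0 \<le> t" for x t
      unfolding right_diff_distrib conv_def
      using conv_J_integrable[OF um[OF that] uM[OF that], of x] Jint[of x] by simp
    have "AE x in lebesgue. u x 0 = u0 x" using u by (simp add: nonneg_bounded_solution_def)
    then have init': "AE x in lebesgue. u x 0 \<le> w1 x - (- w2 x)"
      using init by eventually_elim simp
    have sub: "AE x in lebesgue. \<forall>t>0. \<exists>c\<ge>0. (u x has_real_derivative conv J (\<lambda>y. u y t) x - u x t - c) (at t)"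
    proof -
      have "AE x in lebesgue. \<forall>t>0. (u x has_real_derivative
           (LINT y|lebesgue. J (x - y) * (u y t - u x t)) - u x t powr p) (at t)"
        using u by (simp add: nonneg_bounded_solution_def)
      then show ?thesis
      proof eventually_elim
        case (elim x)
        show ?case
        proof (intro allI impI)
          fix t :: real assume t: "0 < t"
          then have "(u x has_real_derivative
              (LINT y|lebesgue. J (x - y) * (u y t - u x t)) - u x t powr p) (at t)"
            using elim by blast
          moreover have "(LINT y|lebesgue. J (x - y) * (u y t - u x t)) = conv J (\<lambda>y. u y t) x - u x t"
            using eq[of t x] t by linarith
          ultimately have "(u x has_real_derivative conv J (\<lambda>y. u y t) x - u x t - u x t powr p) (at t)"
            by metis
          moreover have "0 \<le> u x t powr p" by simp
          ultimately show "\<exists>c\<ge>0. (u x has_real_derivative conv J (\<lambda>y. u y t) x - u x t - c) (at t)"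
            by blast
        qed
      qed
    qed
    have uc: "AE x in lebesgue. continuous_on {0..} (u x)" using u by (simp add: nonneg_bounded_solution_def)
    have comp: "AE x in lebesgue. \<forall>t\<ge>0. u x t \<le> flow (\<lambda>x. w1 x - (- w2 x)) x t"
      by (rule subsolution_le_flow[OF um M' init' w uc sub])
    have bound: "?f k * flow (\<lambda>x. w1 x - (- w2 x)) x \<tau> \<le> C" if \<tau>: "k\<^sup>2 * t0 \<le> \<tau>" for x \<tau>
    proof -
      have p: "0 < k\<^sup>2 * t0" using k' t0 by simp
      have \<tau>0: "0 < \<tau>" using \<tau> p by linarith
      have w2': "bdd_borel D (\<lambda>x. - w2 x)" using w2 by (auto simp: bdd_borel_def)
      have "flow (\<lambda>x. w1 x - (- w2 x)) x \<tau> = flow w1 x \<tau> - flow (\<lambda>x. - w2 x) x \<tau>"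
        by (rule flow_diff[OF w1(1) w2'])
      also have "\<dots> \<le> (exp (- \<tau>) * M + C2 / sqrt \<tau> ^ ?N * \<mu>) + D"
        using smooth[OF w1 _ \<tau>0, of x] ball_int[of k] flow_le[OF w2', of \<tau> x] \<tau>0
        unfolding w1_def \<mu>_def by (simp add: abs_le_iff)
      also have "\<dots> \<le> (exp (- (k\<^sup>2 * t0)) * M + C2 / (k * sqrt t0) ^ ?N * \<mu>) + D"
      proof -
        have "sqrt (k\<^sup>2 * t0) \<le> sqrt \<tau>" using \<tau> by simp
        then have "k * sqrt t0 \<le> sqrt \<tau>" using k' by (simp add: real_sqrt_mult)
        then have "C2 / sqrt \<tau> ^ ?N \<le> C2 / (k * sqrt t0) ^ ?N"
          using C2 k' t0 \<tau>0 by (intro divide_left_mono power_mono mult_pos_pos zero_less_power) auto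
        then show ?thesis using \<tau> M \<mu> by (intro add_mono mult_right_mono) auto
      qed
      finally have "?f k * flow (\<lambda>x. w1 x - (- w2 x)) x \<tau>
          \<le> ?f k * ((exp (- (k\<^sup>2 * t0)) * M + C2 / (k * sqrt t0) ^ ?N * \<mu>) + D)"
        using f0 by (intro mult_left_mono) auto
      also have "\<dots> = (M / \<mu>) * (k ^ ?N * exp (- (k\<^sup>2 * t0))) + C2 / sqrt t0 ^ ?N + C1 * B"
      proof -
        have "?f k * D = C1 * B" using f0 by (simp add: D_def)
        moreover have "?f k * (C2 / (k * sqrt t0) ^ ?N * \<mu>) = C2 / sqrt t0 ^ ?N"
          using \<mu> k' by (simp add: f power_mult_distrib)
        moreover have "?f k * (exp (- (k\<^sup>2 * t0)) * M) = (M / \<mu>) * (k ^ ?N * exp (- (k\<^sup>2 * t0)))"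
          by (simp add: f)
        ultimately show ?thesis by (simp only: distrib_left)
      qed
      also have "\<dots> \<le> (M / m) * (fact ?N / t0 ^ ?N) + C2 / sqrt t0 ^ ?N + C1 * B"
        using M m \<mu> k' t0 power_exp_bound[OF k'(1) t0, of ?N]
        by (intro add_right_mono mult_mono divide_left_mono) auto
      finally show ?thesis by (simp add: C_def)
    qed
    have "AE z in lebesgue. \<forall>\<tau>\<ge>k\<^sup>2 * t0. 0 \<le> ?f k * u z \<tau> \<and> ?f k * u z \<tau> \<le> C"
      using comp M'
    proof eventually_elim
      case (elim z)
      show ?case
      proof (intro allI impI)
        fix \<tau> assume \<tau>: "k\<^sup>2 * t0 \<le> \<tau>"
        have "0 \<le> k\<^sup>2 * t0" using t0 by simp
        then have \<tau>0: "0 \<le> \<tau>" using \<tau> by linarith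
        have "?f k * u z \<tau> \<le> ?f k * flow (\<lambda>x. w1 x - (- w2 x)) z \<tau>"
          using elim(1) \<tau>0 f0 by (intro mult_left_mono) auto
        moreover have "0 \<le> u z \<tau>" using elim(2) \<tau>0 by blast
        then have "0 \<le> ?f k * u z \<tau>" using f0 by (intro mult_nonneg_nonneg) auto
        ultimately show "0 \<le> ?f k * u z \<tau> \<and> ?f k * u z \<tau> \<le> C"
          using bound[OF \<tau>, of z] by linarith
      qed
    qed
    then show ?thesis using f0 by blast
  qed
  have "1 \<le> k1" by (simp add: k1_def)
  from that[OF C this main] show ?thesis .
qed

section \<open>The family in unscaled variables\<close>

context heat_kernel
begin

text \<open>Substituting \<open>z = k y\<close> absorbs every factor \<open>k^N\<close>. What
  remains of \<open>k\<close> is the point \<open>k x\<close>, times multiplied by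
  \<open>k^2\<close> and the prefactor \<open>scale_F\<close>, so moduli with constants independent
  of \<open>k\<close> become applicable.\<close>

lemma h_family_eq:
  fixes u :: "'a \<Rightarrow> real \<Rightarrow> real"
  assumes k: "0 < k" and t0: "0 < t0" and t: "t0 \<le> t"
    and um: "\<And>t. 0 \<le> t \<Longrightarrow> (\<lambda>x. u x t) \<in> borel_measurable lebesgue"
    and g: "bdd_borel D g" "AE z in lebesgue. scale_f u0 k * u z (k\<^sup>2 * t0) = g z"
    and v: "admissible_source D' t0 v" and v_eq: "\<And>y s. v y s = (scale_f u0 k * u y (k\<^sup>2 * s)) powr p"
  shows "h_family J p u0 u W t0 k x t =
    (flow g (k *\<^sub>R x) (k\<^sup>2 * (t - t0))
      - exp (- (k\<^sup>2 * (t - t0))) * (g (k *\<^sub>R x) + k\<^sup>2 * (t - t0) * kop J g (k *\<^sub>R x)))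
    - scale_F p u0 k * integral {t0..t} (duhamel k v (k *\<^sub>R x) t)"
proof -
  let ?N = "DIM('a)" and ?f = "scale_f u0 k"
  have gm: "g \<in> borel_measurable borel" by (rule bdd_borelD(1)[OF g(1)])
  have Jgm: "kop J g \<in> borel_measurable borel"
    by (rule bdd_borelD(1)[OF bdd_borel_kop[OF J_integrable J_nonneg g(1)]])
  have c: "conv (scale_J J k) (\<lambda>z. scale_u u0 u k z t0) y = kop J g (k *\<^sub>R y)" for y
  proof -
    let ?\<phi> = "\<lambda>z. J (k *\<^sub>R y - z) * (?f * u z (k\<^sup>2 * t0))"
    have u0m: "(\<lambda>z. ?f * u z (k\<^sup>2 * t0)) \<in> borel_measurable lebesgue"
      using t0 by (intro borel_measurable_times um) auto
    have "(\<lambda>z. J (k *\<^sub>R y - z)) \<in> borel_measurable lebesgue"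
      by (intro borel_measurable_lebesgue) simp
    then have \<phi>: "?\<phi> \<in> borel_measurable lebesgue" using u0m by (rule borel_measurable_times)
    have "conv (scale_J J k) (\<lambda>z. scale_u u0 u k z t0) y = (LINT w|lebesgue. k ^ ?N * ?\<phi> (k *\<^sub>R w))"
      unfolding conv_def scale_J_def scale_u_def by (simp add: scaleR_right_diff_distrib mult.assoc)
    also have "\<dots> = (LINT z|lebesgue. ?\<phi> z)" by (rule lebesgue_integral_scale[OF \<phi> k])
    also have "\<dots> = kop J g (k *\<^sub>R y)"
      by (rule lebesgue_convolution_version[OF J_measurable u0m gm g(2)])
    finally show ?thesis .
  qed
  have Wm: "(\<lambda>z. W (k *\<^sub>R x - z) (k\<^sup>2 * (t - s))) \<in> borel_measurable lebesgue" if "s \<le> t" for s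
  proof -
    have "(\<lambda>z. W (k *\<^sub>R x - z) (k\<^sup>2 * (t - s))) \<in> borel_measurable borel"
      by (rule measurable_compose[OF _ W_measurable]) (use that in auto)
    then show ?thesis by (rule borel_measurable_lebesgue)
  qed
  have first: "(LINT y|lebesgue. scale_W W k (x - y) (t - s) * exp (- k\<^sup>2 * (s - t0))
         * conv (scale_J J k) (\<lambda>z. scale_u u0 u k z t0) y)
      = exp (- k\<^sup>2 * (s - t0)) * kop (\<lambda>x. W x (k\<^sup>2 * (t - s))) (kop J g) (k *\<^sub>R x)" if s: "s \<le> t" for s
  proof -
    let ?\<psi> = "\<lambda>z. W (k *\<^sub>R x - z) (k\<^sup>2 * (t - s)) * kop J g z"
    have \<psi>: "?\<psi> \<in> borel_measurable lebesgue"
      by (intro borel_measurable_times Wm s borel_measurable_lebesgue[OF Jgm])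
    have "(LINT y|lebesgue. scale_W W k (x - y) (t - s) * exp (- k\<^sup>2 * (s - t0))
         * conv (scale_J J k) (\<lambda>z. scale_u u0 u k z t0) y)
       = (LINT y|lebesgue. exp (- k\<^sup>2 * (s - t0)) * (k ^ ?N * ?\<psi> (k *\<^sub>R y)))"
      unfolding c scale_W_def by (simp add: scaleR_right_diff_distrib mult_ac)
    also have "\<dots> = exp (- k\<^sup>2 * (s - t0)) * (LINT y|lebesgue. k ^ ?N * ?\<psi> (k *\<^sub>R y))"
      by (rule integral_mult_right_zero)
    also have "(LINT y|lebesgue. k ^ ?N * ?\<psi> (k *\<^sub>R y)) = (LINT z|lebesgue. ?\<psi> z)"
      by (rule lebesgue_integral_scale[OF \<psi> k])
    also have "\<dots> = kop (\<lambda>x. W x (k\<^sup>2 * (t - s))) (kop J g) (k *\<^sub>R x)"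
      by (intro lebesgue_convolution_version W_measurable borel_measurable_lebesgue Jgm) (use s in auto)
    finally show ?thesis .
  qed
  have second: "(LINT y|lebesgue. scale_W W k (x - y) (t - s) * scale_u u0 u k y s powr p)
      = duhamel k v (k *\<^sub>R x) t s" if s: "t0 \<le> s" "s \<le> t" for s
  proof -
    let ?\<psi> = "\<lambda>z. W (k *\<^sub>R x - z) (k\<^sup>2 * (t - s)) * v z s"
    have "(\<lambda>z. v z s) \<in> borel_measurable lebesgue" using v s by (simp add: admissible_source_def)
    then have \<psi>: "?\<psi> \<in> borel_measurable lebesgue"
      by (rule borel_measurable_times[OF Wm[OF s(2)]])
    have "(LINT y|lebesgue. scale_W W k (x - y) (t - s) * scale_u u0 u k y s powr p)
       = (LINT y|lebesgue. k ^ ?N * ?\<psi> (k *\<^sub>R y))"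
      unfolding scale_W_def scale_u_def v_eq by (simp add: scaleR_right_diff_distrib mult_ac)
    also have "\<dots> = (LINT z|lebesgue. ?\<psi> z)" by (rule lebesgue_integral_scale[OF \<psi> k])
    finally show ?thesis by (simp add: duhamel_def)
  qed
  have "(LINT s:{t0..t}|lebesgue. LINT y|lebesgue. scale_W W k (x - y) (t - s) * exp (- k\<^sup>2 * (s - t0))
         * conv (scale_J J k) (\<lambda>z. scale_u u0 u k z t0) y)
     = (LINT s:{t0..t}|lebesgue. exp (- k\<^sup>2 * (s - t0)) * kop (\<lambda>x. W x (k\<^sup>2 * (t - s))) (kop J g) (k *\<^sub>R x))"
    unfolding set_lebesgue_integral_def
  proof (intro Bochner_Integration.integral_cong refl)
    fix s
    show "indicator {t0..t} s *\<^sub>R (LINT y|lebesgue. scale_W W k (x - y) (t - s) * exp (- k\<^sup>2 * (s - t0))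
         * conv (scale_J J k) (\<lambda>z. scale_u u0 u k z t0) y)
      = indicator {t0..t} s *\<^sub>R (exp (- k\<^sup>2 * (s - t0)) * kop (\<lambda>x. W x (k\<^sup>2 * (t - s))) (kop J g) (k *\<^sub>R x))"
    proof (cases "s \<in> {t0..t}")
      case True
      then show ?thesis using first[of s] by simp
    qed simp
  qed
  moreover have "(LINT s:{t0..t}|lebesgue. LINT y|lebesgue. scale_W W k (x - y) (t - s) * scale_u u0 u k y s powr p)
     = (LINT s:{t0..t}|lebesgue. duhamel k v (k *\<^sub>R x) t s)"
    unfolding set_lebesgue_integral_def
  proof (intro Bochner_Integration.integral_cong refl)
    fix s
    show "indicator {t0..t} s *\<^sub>R (LINT y|lebesgue. scale_W W k (x - y) (t - s) * scale_u u0 u k y s powr p)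
      = indicator {t0..t} s *\<^sub>R duhamel k v (k *\<^sub>R x) t s"
      using second[of s] by (cases "s \<in> {t0..t}") auto
  qed
  moreover have "(LINT s:{t0..t}|lebesgue. duhamel k v (k *\<^sub>R x) t s) = integral {t0..t} (duhamel k v (k *\<^sub>R x) t)"
    by (rule set_lebesgue_integral_continuous[OF duhamel_continuous[OF v]])
  ultimately show ?thesis
    unfolding h_family_def using first_duhamel_term[OF g(1) k t, of "k *\<^sub>R x"] by simp
qed

end

section \<open>Bounds and moduli after rescaling\<close>

context heat_kernel
begin

lemma first_term_le:
  assumes g: "bdd_borel D g" and T: "0 \<le> T"
  shows "\<bar>flow g X T - exp (- T) * (g X + T * kop J g X)\<bar> \<le> 2 * D"
proof -
  have Jg: "bdd_borel D (kop J g)" using bdd_kpow[OF g, of 1] by (simp add: kpow_Suc)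
  have "\<bar>T * kop J g X\<bar> \<le> T * D"
    using bdd_borelD(2)[OF Jg, of X] T by (simp add: abs_mult mult_left_mono)
  then have "\<bar>g X + T * kop J g X\<bar> \<le> (1 + T) * D"
    using bdd_borelD(2)[OF g, of X] by (simp add: algebra_simps)
  also have "\<dots> \<le> exp T * D"
    using exp_ge_add_one_self[of T] bdd_borelD(5)[OF g] by (intro mult_right_mono) auto
  finally have "exp (- T) * \<bar>g X + T * kop J g X\<bar> \<le> exp (- T) * (exp T * D)" by (intro mult_left_mono) auto
  then have "\<bar>exp (- T) * (g X + T * kop J g X)\<bar> \<le> D" by (simp add: abs_mult minus_exp_cancel)
  then show ?thesis using flow_le[OF g T, of X] by linarith
qed

lemma second_term_le:
  assumes v: "admissible_source D t0 v" and t: "t0 \<le> t"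
  shows "\<bar>integral {t0..t} (duhamel k v X t)\<bar> \<le> 2 * D * (t - t0)"
  using integral_bound[OF t duhamel_continuous[OF v], of k X "2 * D"] duhamel_le[OF v] by simp

text \<open>Division by \<open>k\<close> turns \<open>norm (k x - k x') + 1\<close> into
  \<open>norm (x - x') + 1 / k\<close>, so \<open>d + 1 / k\<close> controls everything except the
  cut-off error \<open>4 * D * \<eta>\<close>. Since \<open>L\<close> involves
  \<open>1 / \<eta>\<close>, the cut-off is fixed before \<open>L\<close> is chosen.\<close>

lemma rescaled_modulus:
  assumes t0: "0 < t0" and \<rho>: "0 \<le> \<rho>" and C: "0 \<le> C" and D: "0 \<le> D" and \<eta>: "0 < \<eta>"
  obtains L where "0 \<le> L"
    "\<And>k g v x x' t t' d. 1 \<le> k \<Longrightarrow> bdd_borel C g \<Longrightarrow> admissible_source D t0 v \<Longrightarrow>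
      2 * t0 \<le> t \<Longrightarrow> t \<le> t' \<Longrightarrow> t \<le> \<rho> \<Longrightarrow> norm (x - x') \<le> d \<Longrightarrow> t' - t \<le> d \<Longrightarrow>
      \<bar>(flow g (k *\<^sub>R x) (k\<^sup>2 * (t - t0)) - exp (- (k\<^sup>2 * (t - t0))) * (g (k *\<^sub>R x) + k\<^sup>2 * (t - t0) * kop J g (k *\<^sub>R x)))
       - (flow g (k *\<^sub>R x') (k\<^sup>2 * (t' - t0)) - exp (- (k\<^sup>2 * (t' - t0))) * (g (k *\<^sub>R x') + k\<^sup>2 * (t' - t0) * kop J g (k *\<^sub>R x')))\<bar>
       \<le> L * (d + 1 / k) \<and>
      \<bar>integral {t0..t} (duhamel k v (k *\<^sub>R x) t) - integral {t0..t'} (duhamel k v (k *\<^sub>R x') t')\<bar>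
       \<le> 4 * D * \<eta> + L * (d + 1 / k)"
proof -
  obtain Ca where Ca: "0 < Ca" and A: "\<And>D g k t0 t t' X X'. bdd_borel D g \<Longrightarrow> 0 < k \<Longrightarrow> 0 < t0 \<Longrightarrow> 2 * t0 \<le> t \<Longrightarrow> t \<le> t' \<Longrightarrow>
      \<bar>(flow g X (k\<^sup>2 * (t - t0)) - exp (- (k\<^sup>2 * (t - t0))) * (g X + k\<^sup>2 * (t - t0) * kop J g X))
       - (flow g X' (k\<^sup>2 * (t' - t0)) - exp (- (k\<^sup>2 * (t' - t0))) * (g X' + k\<^sup>2 * (t' - t0) * kop J g X'))\<bar>
      \<le> Ca * D * ((norm (X - X') + 1) / (k * sqrt t0) + (t' - t) / t0) + 4 * D / (k\<^sup>2 * t0)"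
    by (rule first_term_modulus, rule that)
  obtain Cb where Cb: "0 < Cb" and B: "\<And>D v k t0 t t' \<eta> X X'. admissible_source D t0 v \<Longrightarrow> 0 < k \<Longrightarrow> 0 < \<eta> \<Longrightarrow> t0 \<le> t \<Longrightarrow> t \<le> t' \<Longrightarrow>
      \<bar>integral {t0..t} (duhamel k v X t) - integral {t0..t'} (duhamel k v X' t')\<bar>
      \<le> (t - t0) * (Cb * D * ((norm (X - X') + 1) / (k * sqrt \<eta>) + (t' - t) / \<eta>) + 2 * D / (k\<^sup>2 * \<eta>))
        + 4 * D * \<eta> + 2 * D * (t' - t)"
    by (rule second_term_modulus, rule that)
  define L1 where "L1 = Ca * C * (1 / sqrt t0 + 1 / t0) + 4 * C / t0"
  define L2 where "L2 = \<rho> * (Cb * D * (1 / sqrt \<eta> + 1 / \<eta>) + 2 * D / \<eta>) + 2 * D"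
  have L: "0 \<le> L1" "0 \<le> L2"
    unfolding L1_def L2_def using Ca Cb t0 \<eta> C D \<rho> by (auto intro!: add_nonneg_nonneg mult_nonneg_nonneg)
  show ?thesis
  proof (rule that[of "L1 + L2"])
    show "0 \<le> L1 + L2" using L by simp
    fix k t t' d :: real and g :: "'a \<Rightarrow> real" and v :: "'a \<Rightarrow> real \<Rightarrow> real" and x x' :: 'a
    assume k: "1 \<le> k" and g: "bdd_borel C g" and v: "admissible_source D t0 v"
      and t: "2 * t0 \<le> t" "t \<le> t'" "t \<le> \<rho>" and d: "norm (x - x') \<le> d" "t' - t \<le> d"
    define e where "e = d + 1 / k"
    have k0: "0 < k" using k by simp
    have "0 \<le> d" using d norm_ge_zero order_trans by blast
    moreover have "0 \<le> 1 / k" using k by simp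
    ultimately have e: "1 / k \<le> e" "t' - t \<le> e" "0 \<le> e" using d unfolding e_def by linarith+
    have ik: "1 / k\<^sup>2 \<le> e"
    proof -
      have "1 / k\<^sup>2 \<le> 1 / k" using k by (simp add: power2_eq_square divide_simps)
      then show ?thesis using e by simp
    qed
    have sp: "(norm (k *\<^sub>R x - k *\<^sub>R x') + 1) / (k * sqrt r) + (t' - t) / r \<le> (1 / sqrt r + 1 / r) * e" if r: "0 < r" for r
    proof -
      have "(norm (k *\<^sub>R x - k *\<^sub>R x') + 1) / (k * sqrt r) = (norm (x - x') + 1 / k) / sqrt r"
        using k0 r by (simp add: scaleR_right_diff_distrib[symmetric] add_divide_distrib)
      also have "\<dots> \<le> e / sqrt r" using d r by (intro divide_right_mono) (auto simp: e_def)
      finally have "(norm (k *\<^sub>R x - k *\<^sub>R x') + 1) / (k * sqrt r) \<le> e / sqrt r" .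
      moreover have "(t' - t) / r \<le> e / r" using e r by (intro divide_right_mono) auto
      ultimately show ?thesis by (simp add: distrib_right)
    qed
    have quad: "c / (k\<^sup>2 * r) \<le> (c / r) * e" if "0 \<le> c" "0 < r" for c r
      using mult_left_mono[OF ik, of "c / r"] that by (simp add: mult.commute)
    have "Ca * C * ((norm (k *\<^sub>R x - k *\<^sub>R x') + 1) / (k * sqrt t0) + (t' - t) / t0) + 4 * C / (k\<^sup>2 * t0)
        \<le> Ca * C * ((1 / sqrt t0 + 1 / t0) * e) + (4 * C / t0) * e"
      using Ca C t0 by (intro add_mono mult_left_mono sp quad) auto
    also have "\<dots> = L1 * e" by (simp add: L1_def algebra_simps)
    also have "\<dots> \<le> (L1 + L2) * e" using L e by (intro mult_right_mono) auto
    finally have 1: "Ca * C * ((norm (k *\<^sub>R x - k *\<^sub>R x') + 1) / (k * sqrt t0) + (t' - t) / t0) + 4 * C / (k\<^sup>2 * t0)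
        \<le> (L1 + L2) * e" .
    have "(t - t0) * (Cb * D * ((norm (k *\<^sub>R x - k *\<^sub>R x') + 1) / (k * sqrt \<eta>) + (t' - t) / \<eta>) + 2 * D / (k\<^sup>2 * \<eta>))
        \<le> \<rho> * (Cb * D * ((1 / sqrt \<eta> + 1 / \<eta>) * e) + (2 * D / \<eta>) * e)"
      using Cb D \<eta> t t0 e \<rho> k0
      by (intro mult_mono add_mono mult_left_mono sp quad) (auto intro!: add_nonneg_nonneg mult_nonneg_nonneg divide_nonneg_nonneg)
    moreover have "2 * D * (t' - t) \<le> 2 * D * e" using D e by (intro mult_left_mono) auto
    moreover have "\<rho> * (Cb * D * ((1 / sqrt \<eta> + 1 / \<eta>) * e) + (2 * D / \<eta>) * e) + 2 * D * e = L2 * e"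
      by (simp add: L2_def algebra_simps)
    moreover have "L2 * e \<le> (L1 + L2) * e" using L e by (intro mult_right_mono) auto
    ultimately have 2: "(t - t0) * (Cb * D * ((norm (k *\<^sub>R x - k *\<^sub>R x') + 1) / (k * sqrt \<eta>) + (t' - t) / \<eta>) + 2 * D / (k\<^sup>2 * \<eta>))
        + 4 * D * \<eta> + 2 * D * (t' - t) \<le> 4 * D * \<eta> + (L1 + L2) * e"
      by linarith
    have "t0 \<le> t" using t t0 by simp
    show "\<bar>(flow g (k *\<^sub>R x) (k\<^sup>2 * (t - t0)) - exp (- (k\<^sup>2 * (t - t0))) * (g (k *\<^sub>R x) + k\<^sup>2 * (t - t0) * kop J g (k *\<^sub>R x)))
       - (flow g (k *\<^sub>R x') (k\<^sup>2 * (t' - t0)) - exp (- (k\<^sup>2 * (t' - t0))) * (g (k *\<^sub>R x') + k\<^sup>2 * (t' - t0) * kop J g (k *\<^sub>R x')))\<bar>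
       \<le> (L1 + L2) * (d + 1 / k) \<and>
      \<bar>integral {t0..t} (duhamel k v (k *\<^sub>R x) t) - integral {t0..t'} (duhamel k v (k *\<^sub>R x') t')\<bar>
       \<le> 4 * D * \<eta> + (L1 + L2) * (d + 1 / k)"
      using order_trans[OF A[OF g k0 t0 t(1,2), of "k *\<^sub>R x" "k *\<^sub>R x'"] 1]
        order_trans[OF B[OF v k0 \<eta> \<open>t0 \<le> t\<close> t(2), of "k *\<^sub>R x" "k *\<^sub>R x'"] 2]
      unfolding e_def by blast
  qed
qed

end

lemma scaled_source_admissible:
  fixes J u0 :: "'a::euclidean_space \<Rightarrow> real"
  assumes u: "nonneg_bounded_solution J p u0 u" and p: "1 < p" and t0: "0 < t0" and C: "0 \<le> C"
    and bound: "0 < scale_f u0 k"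
      "AE z in lebesgue. \<forall>\<tau>\<ge>k\<^sup>2 * t0. 0 \<le> scale_f u0 k * u z \<tau> \<and> scale_f u0 k * u z \<tau> \<le> C"
    and heat: "heat_kernel J W"
  shows "heat_kernel.admissible_source (C powr p) t0 (\<lambda>y s. (scale_f u0 k * u y (k\<^sup>2 * s)) powr p)"
proof -
  interpret heat_kernel J W by (rule heat)
  let ?f = "scale_f u0 k"
  have um: "(\<lambda>x. u x t) \<in> borel_measurable lebesgue" if "0 \<le> t" for t
    using u that unfolding nonneg_bounded_solution_def by blast
  have uc: "AE x in lebesgue. continuous_on {0..} (u x)"
    using u unfolding nonneg_bounded_solution_def by blast
  show ?thesis
    unfolding admissible_source_def
  proof (intro conjI allI impI)
    show "0 \<le> C powr p" by simp
    show "(\<lambda>y. (?f * u y (k\<^sup>2 * s)) powr p) \<in> borel_measurable lebesgue" if "t0 \<le> s" for s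
      using that t0 by (intro powr_real_measurable borel_measurable_times um) auto
    show "AE y in lebesgue. \<forall>s\<ge>t0. 0 \<le> (?f * u y (k\<^sup>2 * s)) powr p \<and> (?f * u y (k\<^sup>2 * s)) powr p \<le> C powr p"
      using bound(2)
    proof eventually_elim
      case (elim y)
      show ?case
      proof (intro allI impI conjI)
        fix s assume "t0 \<le> s"
        then have "k\<^sup>2 * t0 \<le> k\<^sup>2 * s" by (intro mult_left_mono) auto
        then have "0 \<le> ?f * u y (k\<^sup>2 * s)" "?f * u y (k\<^sup>2 * s) \<le> C" using elim by blast+
        then show "(?f * u y (k\<^sup>2 * s)) powr p \<le> C powr p" using p by (intro powr_mono2) auto
      qed simp
    qed
    show "AE y in lebesgue. continuous_on {t0..} (\<lambda>s. (?f * u y (k\<^sup>2 * s)) powr p)"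
      using uc bound(2)
    proof eventually_elim
      case (elim y)
      have "continuous_on {t0..} (\<lambda>s. u y (k\<^sup>2 * s))"
        by (rule continuous_on_compose2[OF elim(1)]) (use t0 in \<open>auto intro!: continuous_intros\<close>)
      then have "continuous_on {t0..} (\<lambda>s. ?f * u y (k\<^sup>2 * s))" by (intro continuous_intros)
      moreover have "0 \<le> ?f * u y (k\<^sup>2 * s)" if "s \<in> {t0..}" for s
      proof -
        have "k\<^sup>2 * t0 \<le> k\<^sup>2 * s" using that by (intro mult_left_mono) auto
        then show ?thesis using elim(2) by blast
      qed
      \<comment> \<open>The base may vanish; a positive exponent keeps \<open>powr\<close>
        continuous there.\<close>
      ultimately show ?case using p by (intro continuous_on_powr' continuous_on_const) auto
    qed
  qed
qed

theorem theorem3p1: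
  fixes J u0 :: "'a::euclidean_space \<Rightarrow> real"
    and u W :: "'a \<Rightarrow> real \<Rightarrow> real"
    and p t0 :: real
  assumes J: "admissible_kernel J"
    and p: "1 < p"
    and u0: "admissible_datum u0"
    and F1: "\<exists>B>0. AE x in lebesgue. scale_f u0 (norm x) * u0 x \<le> B"
    and F2: "\<exists>k0>0. \<forall>\<delta>>0. \<exists>C>0. \<forall>k l.
               k0 \<le> k \<and> k \<le> l / \<delta> \<longrightarrow> scale_f u0 k \<le> C * scale_f u0 l"
    and F3: "\<exists>c0\<ge>0. (scale_F p u0 \<longlongrightarrow> c0) at_top"
    and u: "nonneg_bounded_solution J p u0 u"
    and W: "fundamental_solution_smooth_part J W"
    and t0: "0 < t0"
  shows "\<forall>\<kappa> :: nat \<Rightarrow> real. filterlim \<kappa> at_top sequentially \<longrightarrow>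
           (\<exists>r :: nat \<Rightarrow> nat. strict_mono r \<and>
             (\<forall>K. compact K \<and> K \<subseteq> UNIV \<times> {2 * t0..} \<longrightarrow>
               uniformly_convergent_on K
                 (\<lambda>n (x, t). h_family J p u0 u W t0 (\<kappa> (r n)) x t)))"
proof (intro allI impI)
  fix \<kappa> :: "nat \<Rightarrow> real" assume \<kappa>: "filterlim \<kappa> at_top sequentially"
  have heat: "heat_kernel J W" by (rule fundamental_solution_heat_kernel[OF J W])
  interpret heat_kernel J W by (rule heat)
  let ?f = "scale_f u0" and ?F = "scale_F p u0"
  define S where "S = (UNIV :: 'a set) \<times> {2 * t0..}"
  obtain C k1 where C: "0 \<le> C" and k1: "1 \<le> k1"
    and bound: "\<And>k. k1 \<le> k \<Longrightarrow> 0 < ?f k \<and>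
       (AE z in lebesgue. \<forall>\<tau>\<ge>k\<^sup>2 * t0. 0 \<le> ?f k * u z \<tau> \<and> ?f k * u z \<tau> \<le> C)"
    by (rule scaled_solution_bounded[OF J u0 F1 F2 u t0], rule that)
  obtain c0 where c0: "0 \<le> c0" "(?F \<longlongrightarrow> c0) at_top" using F3 by blast
  define Fb where "Fb = c0 + 1"
  have "\<forall>\<^sub>F k in at_top. dist (?F k) c0 < 1" using c0(2) by (rule tendstoD) simp
  then have "\<forall>\<^sub>F k in at_top. \<bar>?F k\<bar> \<le> Fb"
    by eventually_elim (use c0(1) in \<open>auto simp: Fb_def dist_real_def\<close>)
  then obtain k2 where k2: "\<And>k. k2 \<le> k \<Longrightarrow> \<bar>?F k\<bar> \<le> Fb" by (auto simp: eventually_at_top_linorder)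
  have Fb: "0 < Fb" using c0(1) by (simp add: Fb_def)
  define K where "K = max k1 k2"
  define D where "D = C powr p"
  have D: "0 \<le> D" by (simp add: D_def)
  define v where "v k y s = (?f k * u y (k\<^sup>2 * s)) powr p" for k y s
  have src: "admissible_source D t0 (v k)" if "K \<le> k" for k
    using scaled_source_admissible[OF u p t0 C _ _ heat, of k] bound[of k] that
    unfolding v_def D_def K_def by simp
  have um: "(\<lambda>x. u x t) \<in> borel_measurable lebesgue" if "0 \<le> t" for t
    using u that unfolding nonneg_bounded_solution_def by blast
  have "\<exists>g. bdd_borel C g \<and> (AE z in lebesgue. ?f k * u z (k\<^sup>2 * t0) = g z)" if "K \<le> k" for k
  proof -
    have "AE z in lebesgue. \<forall>\<tau>\<ge>k\<^sup>2 * t0. 0 \<le> ?f k * u z \<tau> \<and> ?f k * u z \<tau> \<le> C"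
      using bound[of k] that by (simp add: K_def)
    then have ae: "AE z in lebesgue. 0 \<le> ?f k * u z (k\<^sup>2 * t0) \<and> ?f k * u z (k\<^sup>2 * t0) \<le> C"
      by eventually_elim blast
    have "(\<lambda>z. ?f k * u z (k\<^sup>2 * t0)) \<in> borel_measurable lebesgue"
      using t0 by (intro borel_measurable_times um) auto
    then obtain g where "bdd_borel C g" "AE z in lebesgue. ?f k * u z (k\<^sup>2 * t0) = g z"
      by (rule bounded_borel_version[OF _ ae C])
    then show ?thesis by blast
  qed
  \<comment> \<open>One Borel version of the rescaled solution at time \<open>t0\<close> is fixed
    for each \<open>k\<close>, so that \<open>A\<close> below is a function of \<open>k\<close>,
    \<open>x\<close> and \<open>t\<close>.\<close>
  then have "\<forall>k. \<exists>g. K \<le> k \<longrightarrow> bdd_borel C g \<and> (AE z in lebesgue. ?f k * u z (k\<^sup>2 * t0) = g z)" by blast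
  from choice[OF this] obtain g where g: "\<And>k. K \<le> k \<Longrightarrow> bdd_borel C (g k)"
      "\<And>k. K \<le> k \<Longrightarrow> AE z in lebesgue. ?f k * u z (k\<^sup>2 * t0) = g k z"
    by blast
  define A where "A k x t = flow (g k) (k *\<^sub>R x) (k\<^sup>2 * (t - t0))
      - exp (- (k\<^sup>2 * (t - t0))) * (g k (k *\<^sub>R x) + k\<^sup>2 * (t - t0) * kop J (g k) (k *\<^sub>R x))" for k x t
  define I where "I k x t = integral {t0..t} (duhamel k (v k) (k *\<^sub>R x) t)" for k x t
  define h where "h k x t = h_family J p u0 u W t0 k x t" for k x t
  have K1: "1 \<le> k" if "K \<le> k" for k using that k1 by (simp add: K_def)
  have h: "h k x t = A k x t - ?F k * I k x t" if k: "K \<le> k" and t: "t0 \<le> t" for k x t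
  proof -
    have kp: "0 < k" using K1[OF k] by simp
    have veq: "v k y s = (?f k * u y (k\<^sup>2 * s)) powr p" for y s by (simp add: v_def)
    show ?thesis
      unfolding h_def A_def I_def
      by (rule h_family_eq[where u = u and ?u0.0 = u0 and g = "g k" and v = "v k" and k = k and p = p,
            OF kp t0 t um g(1)[OF k] g(2)[OF k] src[OF k] veq])
  qed
  have FK: "\<bar>?F k\<bar> \<le> Fb" if "K \<le> k" for k using k2 that by (simp add: K_def)
  have bounded: "\<bar>h k x t\<bar> \<le> 2 * C + Fb * (2 * D * t)" if k: "K \<le> k" and t: "2 * t0 \<le> t" for k x t
  proof -
    have t': "t0 \<le> t" using t t0 by simp
    have "\<bar>A k x t\<bar> \<le> 2 * C"
      unfolding A_def by (rule first_term_le[OF g(1)[OF k]]) (use t' in simp)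
    moreover have "\<bar>?F k * I k x t\<bar> \<le> Fb * (2 * D * t)"
    proof -
      have "\<bar>I k x t\<bar> \<le> 2 * D * (t - t0)" unfolding I_def by (rule second_term_le[OF src[OF k] t'])
      also have "\<dots> \<le> 2 * D * t" using D t0 by (intro mult_left_mono) auto
      finally show ?thesis unfolding abs_mult using FK[OF k] Fb by (intro mult_mono) auto
    qed
    ultimately show ?thesis unfolding h[OF k t'] by linarith
  qed
  have equi: "\<exists>\<delta>>0. \<exists>k3. \<forall>k\<ge>k3. \<forall>z\<in>S. \<forall>z'\<in>S. norm z \<le> \<rho> \<and> norm z' \<le> \<rho> \<and> dist z z' < \<delta> \<longrightarrow>
      \<bar>h k (fst z) (snd z) - h k (fst z') (snd z')\<bar> < \<epsilon>" if \<epsilon>: "0 < \<epsilon>" for \<rho> \<epsilon>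
  proof -
    \<comment> \<open>The cut-off error \<open>4 * D * \<eta>\<close>, multiplied by the bound
      \<open>Fb\<close> on the prefactor, may take a quarter of \<open>\<epsilon>\<close>; the
      \<open>+ 1\<close> covers \<open>D = 0\<close>.\<close>
    define \<eta> where "\<eta> = \<epsilon> / (16 * (Fb * D + 1))"
    have p1: "0 < Fb * D + 1" using Fb D by (simp add: add_nonneg_pos)
    have \<eta>: "0 < \<eta>" using \<epsilon> p1 by (simp add: \<eta>_def)
    have \<eta>_small: "Fb * (4 * D * \<eta>) \<le> \<epsilon> / 4"
    proof -
      have cancel: "q * (4 * (\<epsilon> / (16 * q))) = \<epsilon> / 4" if "0 < q" for q :: real
        using that by (simp add: field_simps)
      have "Fb * (4 * D * \<eta>) = (Fb * D) * (4 * \<eta>)" by simp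
      also have "\<dots> \<le> (Fb * D + 1) * (4 * \<eta>)" using \<eta> by (intro mult_right_mono) auto
      also have "\<dots> = \<epsilon> / 4" unfolding \<eta>_def by (rule cancel[OF p1])
      finally show ?thesis .
    qed
    obtain L where L: "0 \<le> L" and modulus: "\<And>k g v x x' t t' d. 1 \<le> k \<Longrightarrow> bdd_borel C g \<Longrightarrow> admissible_source D t0 v \<Longrightarrow>
      2 * t0 \<le> t \<Longrightarrow> t \<le> t' \<Longrightarrow> t \<le> \<bar>\<rho>\<bar> \<Longrightarrow> norm (x - x') \<le> d \<Longrightarrow> t' - t \<le> d \<Longrightarrow>
      \<bar>(flow g (k *\<^sub>R x) (k\<^sup>2 * (t - t0)) - exp (- (k\<^sup>2 * (t - t0))) * (g (k *\<^sub>R x) + k\<^sup>2 * (t - t0) * kop J g (k *\<^sub>R x)))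
       - (flow g (k *\<^sub>R x') (k\<^sup>2 * (t' - t0)) - exp (- (k\<^sup>2 * (t' - t0))) * (g (k *\<^sub>R x') + k\<^sup>2 * (t' - t0) * kop J g (k *\<^sub>R x')))\<bar>
       \<le> L * (d + 1 / k) \<and>
      \<bar>integral {t0..t} (duhamel k v (k *\<^sub>R x) t) - integral {t0..t'} (duhamel k v (k *\<^sub>R x') t')\<bar>
       \<le> 4 * D * \<eta> + L * (d + 1 / k)"
      by (rule rescaled_modulus[OF t0 abs_ge_zero C D \<eta>, of \<rho>], rule that)
    \<comment> \<open>The coefficient of \<open>d + 1 / k\<close> collected from both terms; the
      \<open>+ 1\<close> makes it positive and the final estimate strict.\<close>
    define M where "M = (1 + Fb) * L + 1"
    have M: "0 < M" using L Fb by (simp add: M_def add_nonneg_pos)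
    define \<delta> where "\<delta> = \<epsilon> / (4 * M)"
    have \<delta>: "0 < \<delta>" "M * \<delta> = \<epsilon> / 4" using \<epsilon> M by (auto simp: \<delta>_def)
    \<comment> \<open>Forces \<open>1 / k \<le> \<delta>\<close>, so that
      \<open>d + 1 / k \<le> 2 * \<delta>\<close> and this part of the modulus stays below
      \<open>\<epsilon> / 2\<close>.\<close>
    define k3 where "k3 = max K (1 / \<delta>)"
    have ordered: "\<bar>h k x t - h k x' t'\<bar> < \<epsilon>"
      if k: "k3 \<le> k" and t: "2 * t0 \<le> t" "t \<le> t'" "t \<le> \<bar>\<rho>\<bar>" and d: "norm (x - x') \<le> d" "t' - t \<le> d" "d < \<delta>"
      for k x x' t t' d
    proof -
      have kK: "K \<le> k" using k by (simp add: k3_def)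
      have kp: "0 < k" using K1[OF kK] by simp
      have "1 / \<delta> \<le> k" using k by (simp add: k3_def)
      then have "1 / k \<le> \<delta>" using \<delta> kp by (simp add: field_simps)
      then have e: "d + 1 / k \<le> 2 * \<delta>" using d by simp
      have tt: "t0 \<le> t" "t0 \<le> t'" using t t0 by auto
      have mA: "\<bar>A k x t - A k x' t'\<bar> \<le> L * (d + 1 / k)"
        and mI: "\<bar>I k x t - I k x' t'\<bar> \<le> 4 * D * \<eta> + L * (d + 1 / k)"
        using modulus[OF K1[OF kK] g(1)[OF kK] src[OF kK] t d(1,2)] unfolding A_def I_def by auto
      have "\<bar>?F k * (I k x t - I k x' t')\<bar> \<le> Fb * (4 * D * \<eta> + L * (d + 1 / k))"
        unfolding abs_mult using FK[OF kK] mI Fb by (intro mult_mono) auto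
      moreover have "h k x t - h k x' t' = (A k x t - A k x' t') - ?F k * (I k x t - I k x' t')"
        unfolding h[OF kK tt(1)] h[OF kK tt(2)] by (simp add: algebra_simps)
      ultimately have "\<bar>h k x t - h k x' t'\<bar> \<le> L * (d + 1 / k) + Fb * (4 * D * \<eta> + L * (d + 1 / k))"
        using mA by linarith
      also have "\<dots> = Fb * (4 * D * \<eta>) + ((1 + Fb) * L) * (d + 1 / k)" by (simp add: algebra_simps)
      also have "\<dots> \<le> \<epsilon> / 4 + ((1 + Fb) * L) * (2 * \<delta>)"
        using \<eta>_small e L Fb by (intro add_mono mult_left_mono) auto
      also have "\<dots> < \<epsilon> / 4 + M * (2 * \<delta>)" using \<delta> by (simp add: M_def)
      also have "\<dots> \<le> \<epsilon>" using \<delta>(2) \<epsilon> by simp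
      finally show ?thesis .
    qed
    have "\<bar>h k (fst z) (snd z) - h k (fst z') (snd z')\<bar> < \<epsilon>"
      if k: "k3 \<le> k" and z: "z \<in> S" "z' \<in> S" "norm z \<le> \<rho>" "norm z' \<le> \<rho>" "dist z z' < \<delta>" for k z z'
    proof -
      have 1: "norm (fst z - fst z') \<le> dist z z'" "\<bar>snd z - snd z'\<bar> \<le> dist z z'"
        using dist_fst_le[of z z'] dist_snd_le[of z z'] by (auto simp: dist_norm)
      have "\<bar>snd z\<bar> \<le> norm z" "\<bar>snd z'\<bar> \<le> norm z'"
        using norm_snd_le[of "snd z" "fst z"] norm_snd_le[of "snd z'" "fst z'"] by auto
      then have 2: "snd z \<le> \<bar>\<rho>\<bar>" "snd z' \<le> \<bar>\<rho>\<bar>" using z by linarith+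
      have 3: "2 * t0 \<le> snd z" "2 * t0 \<le> snd z'" using z by (auto simp: S_def)
      show ?thesis
      proof (cases "snd z \<le> snd z'")
        case True
        then show ?thesis using 1 2 3 z by (intro ordered[OF k, where d = "dist z z'"]) auto
      next
        case False
        then have "\<bar>h k (fst z') (snd z') - h k (fst z) (snd z)\<bar> < \<epsilon>"
          using 1 2 3 z by (intro ordered[OF k, where d = "dist z z'"]) (auto simp: norm_minus_commute)
        then show ?thesis by (simp add: abs_minus_commute)
      qed
    qed
    then show ?thesis using \<delta>(1) by blast
  qed
  have "\<forall>\<^sub>F n in sequentially. K \<le> \<kappa> n" using \<kappa> by (auto simp: filterlim_at_top)
  then obtain n0 where n0: "\<And>n. n0 \<le> n \<Longrightarrow> K \<le> \<kappa> n" by (auto simp: eventually_sequentially)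
  \<comment> \<open>The bounds hold for \<open>k \<ge> K\<close> only, while the compactness lemma
    asks for them at every index. The first \<open>n0\<close> terms are dropped, and the shift
    reappears in the final subsequence.\<close>
  define G where "G n z = h (\<kappa> (n + n0)) (fst z) (snd z)" for n z
  obtain r where r: "strict_mono (r :: nat \<Rightarrow> nat)"
    "\<And>Q. compact Q \<Longrightarrow> Q \<subseteq> S \<Longrightarrow> uniformly_convergent_on Q (\<lambda>n. G (r n))"
  proof (rule asymptotic_Arzela_Ascoli[of S G "\<lambda>z. 2 * C + Fb * (2 * D * snd z)"])
    show "\<bar>G n z\<bar> \<le> 2 * C + Fb * (2 * D * snd z)" if "z \<in> S" for n z
      unfolding G_def using that n0[of "n + n0"] by (intro bounded) (auto simp: S_def)
    show "\<exists>\<delta>>0. \<exists>n0. \<forall>n\<ge>n0. \<forall>z\<in>S. \<forall>z'\<in>S.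
      norm z \<le> \<rho> \<and> norm z' \<le> \<rho> \<and> dist z z' < \<delta> \<longrightarrow> \<bar>G n z - G n z'\<bar> < \<epsilon>" if \<epsilon>: "0 < \<epsilon>" for \<rho> \<epsilon>
    proof -
      obtain \<delta> k3 where \<delta>: "0 < \<delta>" and k3: "\<forall>k\<ge>k3. \<forall>z\<in>S. \<forall>z'\<in>S. norm z \<le> \<rho> \<and> norm z' \<le> \<rho> \<and> dist z z' < \<delta> \<longrightarrow>
          \<bar>h k (fst z) (snd z) - h k (fst z') (snd z')\<bar> < \<epsilon>"
        using equi[OF \<epsilon>, of \<rho>] by blast
      have "\<forall>\<^sub>F n in sequentially. k3 \<le> \<kappa> n" using \<kappa> by (auto simp: filterlim_at_top)
      then obtain n1 where n1: "\<And>n. n1 \<le> n \<Longrightarrow> k3 \<le> \<kappa> n" by (auto simp: eventually_sequentially)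
      have "k3 \<le> \<kappa> (n + n0)" if "n1 \<le> n" for n using n1[of "n + n0"] that by simp
      then have "\<forall>n\<ge>n1. \<forall>z\<in>S. \<forall>z'\<in>S. norm z \<le> \<rho> \<and> norm z' \<le> \<rho> \<and> dist z z' < \<delta> \<longrightarrow> \<bar>G n z - G n z'\<bar> < \<epsilon>"
        unfolding G_def using k3 by blast
      then show ?thesis using \<delta> by blast
    qed
  qed (rule that)
  have "strict_mono (\<lambda>n. r n + n0)" using r(1) by (simp add: strict_mono_def)
  moreover have "uniformly_convergent_on Q (\<lambda>n (x, t). h_family J p u0 u W t0 (\<kappa> (r n + n0)) x t)"
    if "compact Q \<and> Q \<subseteq> UNIV \<times> {2 * t0..}" for Q
  proof -
    have "(\<lambda>n. G (r n)) = (\<lambda>n (x, t). h_family J p u0 u W t0 (\<kappa> (r n + n0)) x t)"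
      by (auto simp: G_def h_def fun_eq_iff)
    then show ?thesis using r(2)[of Q] that by (simp add: S_def)
  qed
  ultimately show "\<exists>r. strict_mono r \<and> (\<forall>K. compact K \<and> K \<subseteq> UNIV \<times> {2 * t0..} \<longrightarrow>
      uniformly_convergent_on K (\<lambda>n (x, t). h_family J p u0 u W t0 (\<kappa> (r n)) x t))"
    by blast
qed

end
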